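(* Let $f:M\to(N,g)$ be a pluri-harmonic map from a compact complex manifold $M$ to a Riemannian manifold $(N,g)$ with non-positive complex sectional curvature. If $T^{1,0}M$ is uniformly RC-positive (that is, $T^{1,0}M$ admits a Hermitian metric whose Chern curvature is uniformly RC-positive), then $f$ is a constant map.
   Context: Manifolds are connected and maps are smooth. Pluri-harmonic: a smooth map $f:M\to(N,g)$ is pluri-harmonic if, in local holomorphic coordinates $\{z^\alpha\}$ on $M$ and local coordinates $\{y^i\}$ on $N$, with $\Gamma^i_{jk}$ the Christoffel symbols of $g$ evaluated along $f$ and $e_i=f^*(\partial/\partial y^i)$, $$\left(\frac{\partial^2 f^i}{\partial z^\alpha\partial\bar z^\beta}+\Gamma^i_{jk}\frac{\partial f^j}{\partial\bar z^\beta}\frac{\partial f^k}{\partial z^\alpha}\right)dz^\alpha\wedge d\bar z^\beta\otimes e_i=0.$$ Uniform RC-positivity: for a Hermitian metric $h$ on $T^{1,0}M$, let $R_{\alpha\bar\beta\gamma\bar\delta}=-\frac{\partial^2 h_{\gamma\bar\delta}}{\partial z^\alpha\partial\bar z^\beta}+h^{\mu\bar\nu}\frac{\partial h_{\gamma\bar\nu}}{\partial z^\alpha}\frac{\partial h_{\mu\bar\delta}}{\partial\bar z^\beta}$ be its Chern curvature tensor and $R(u,\bar u,v,\bar v)=R_{\alpha\bar\beta\gamma\bar\delta}u^\alpha\bar u^\beta v^\gamma\bar v^\delta$. It is uniformly RC-positive if at every point $q\in M$ there exists $u\in T^{1,0}_qM$ such that $R(u,\bar u,v,\bar v)>0$ for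 every nonzero $v\in T^{1,0}_qM$. Non-positive complex sectional curvature: for $(N,g)$ with Levi-Civita connection $\nabla$, put $R(X,Y)Z=\nabla_X\nabla_YZ-\nabla_Y\nabla_XZ-\nabla_{[X,Y]}Z$ and $R(X,Y,Z,W)=g(R(X,Y)Z,W)$, extended $\mathbb{C}$-multilinearly to $T_{\mathbb{C}}N=TN\otimes\mathbb{C}$. $(N,g)$ has non-positive complex sectional curvature if $R(Z,\bar W,W,\bar Z)\le 0$ for all $Z,W\in T_{\mathbb{C}}N$ (at the same point). *)

theory Defs
  imports "HOL-Analysis.Analysis"
begin

section \<open>Smooth and holomorphic maps between open sets of vector spaces\<close>

fun Ck_on :: "nat \<Rightarrow> ('a::real_normed_vector \<Rightarrow> 'b::real_normed_vector) \<Rightarrow> 'a set \<Rightarrow> bool" where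
  "Ck_on 0 F S \<longleftrightarrow> continuous_on S F"
| "Ck_on (Suc k) F S \<longleftrightarrow> (\<forall>x\<in>S. F differentiable at x) \<and>
     (\<forall>v. Ck_on k (\<lambda>x. frechet_derivative F (at x) v) S)"

definition smooth_on :: "('a::real_normed_vector \<Rightarrow> 'b::real_normed_vector) \<Rightarrow> 'a set \<Rightarrow> bool" where
  "smooth_on F S \<longleftrightarrow> (\<forall>k. Ck_on k F S)"

definition holomorphic_map_on :: "(complex^'m \<Rightarrow> complex^'n) \<Rightarrow> (complex^'m) set \<Rightarrow> bool" where
  "holomorphic_map_on F S \<longleftrightarrow>
     (\<forall>z\<in>S. \<exists>A :: complex^'m^'n. (F has_derivative (\<lambda>v. A *v v)) (at z))"

definition partial :: "'n \<Rightarrow> (real^'n \<Rightarrow> real) \<Rightarrow> real^'n \<Rightarrow> real" where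
  "partial i F x = frechet_derivative F (at x) (axis i 1)"

text \<open>Wirtinger derivatives. With \<open>z\<^sup>\<alpha> = x\<^sup>\<alpha> + \<i> y\<^sup>\<alpha>\<close> the real coordinate directions are
  \<open>axis \<alpha> 1\<close> and \<open>axis \<alpha> \<i>\<close>; \<^term>\<open>frechet_derivative\<close> is the real derivative.\<close>

definition d_z :: "'m \<Rightarrow> (complex^'m \<Rightarrow> complex) \<Rightarrow> complex^'m \<Rightarrow> complex" where
  "d_z \<alpha> F z = (frechet_derivative F (at z) (axis \<alpha> 1)
                 - \<i> * frechet_derivative F (at z) (axis \<alpha> \<i>)) / 2"

definition d_zbar :: "'m \<Rightarrow> (complex^'m \<Rightarrow> complex) \<Rightarrow> complex^'m \<Rightarrow> complex" where
  "d_zbar \<alpha> F z = (frechet_derivative F (at z) (axis \<alpha> 1)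
                    + \<i> * frechet_derivative F (at z) (axis \<alpha> \<i>)) / 2"

definition cnj_vec :: "complex^'n \<Rightarrow> complex^'n" where
  "cnj_vec Z = (\<chi> i. cnj (Z $ i))"


section \<open>Manifolds\<close>

text \<open>A chart is a pair of its domain and its coordinate map; the values of the coordinate map
  outside the domain are irrelevant. An atlas need not be maximal.\<close>

type_synonym ('a, 'e) chart = "'a set \<times> ('a \<Rightarrow> 'e)"

definition coord_dom :: "('a, 'e) chart \<Rightarrow> 'e set" where
  "coord_dom c = snd c ` fst c"

definition param :: "('a, 'e) chart \<Rightarrow> 'e \<Rightarrow> 'a" where
  "param c = inv_into (fst c) (snd c)"

definition transition :: "('a, 'e) chart \<Rightarrow> ('a, 'e) chart \<Rightarrow> 'e \<Rightarrow> 'e" where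
  "transition c d = snd d \<circ> param c"

definition topological_atlas :: "'a topology \<Rightarrow> ('a, 'e::euclidean_space) chart set \<Rightarrow> bool" where
  "topological_atlas X A \<longleftrightarrow>
     topspace X = (\<Union>c\<in>A. fst c) \<and>
     (\<forall>c\<in>A. openin X (fst c) \<and> open (coord_dom c) \<and>
        homeomorphic_map (subtopology X (fst c)) (top_of_set (coord_dom c)) (snd c))"

definition smooth_manifold :: "'a topology \<Rightarrow> ('a, real^'n) chart set \<Rightarrow> bool" where
  "smooth_manifold X A \<longleftrightarrow>
     Hausdorff_space X \<and> second_countable X \<and> connected_space X \<and> topological_atlas X A \<and>
     (\<forall>c\<in>A. \<forall>d\<in>A. smooth_on (transition c d) (snd c ` (fst c \<inter> fst d)))"

definition complex_manifold :: "'a topology \<Rightarrow> ('a, complex^'m) chart set \<Rightarrow> bool" where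
  "complex_manifold X A \<longleftrightarrow>
     Hausdorff_space X \<and> second_countable X \<and> connected_space X \<and> topological_atlas X A \<and>
     (\<forall>c\<in>A. \<forall>d\<in>A. holomorphic_map_on (transition c d) (snd c ` (fst c \<inter> fst d)))"

definition local_rep :: "('a, 'e) chart \<Rightarrow> ('b, 'f) chart \<Rightarrow> ('a \<Rightarrow> 'b) \<Rightarrow> 'e \<Rightarrow> 'f" where
  "local_rep c d f = snd d \<circ> f \<circ> param c"

definition smooth_map :: "'a topology \<Rightarrow> ('a, 'e::euclidean_space) chart set \<Rightarrow>
    'b topology \<Rightarrow> ('b, 'f::euclidean_space) chart set \<Rightarrow> ('a \<Rightarrow> 'b) \<Rightarrow> bool" where
  "smooth_map X A Y B f \<longleftrightarrow> continuous_map X Y f \<and>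
     (\<forall>c\<in>A. \<forall>d\<in>B. smooth_on (local_rep c d f) (snd c ` (fst c \<inter> f -` fst d)))"


section \<open>Riemannian metrics and non-positive complex sectional curvature\<close>

text \<open>A metric is given by its component matrices \<open>(g\<^sub>i\<^sub>j)\<close> on the coordinate domain of each chart.
  The last clause is the tensor transformation law: the derivative of the transition map converts
  the components of a tangent vector from one chart to the other. Tangent vectors at a point
  correspond, once a chart is chosen, to their component vectors in \<open>real^'n\<close>, and elements of
  the complexified tangent space to those in \<open>complex^'n\<close>.\<close>

definition riemannian_metric ::
  "('a, real^'n) chart set \<Rightarrow> (('a, real^'n) chart \<Rightarrow> real^'n \<Rightarrow> real^'n^'n) \<Rightarrow> bool" where
  "riemannian_metric A g \<longleftrightarrow>
     (\<forall>c\<in>A. smooth_on (g c) (coord_dom c) \<and>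
        (\<forall>x\<in>coord_dom c. transpose (g c x) = g c x \<and> (\<forall>v. v \<noteq> 0 \<longrightarrow> v \<bullet> (g c x *v v) > 0))) \<and>
     (\<forall>c\<in>A. \<forall>d\<in>A. \<forall>x\<in>snd c ` (fst c \<inter> fst d). \<forall>v w.
        v \<bullet> (g c x *v w) =
          frechet_derivative (transition c d) (at x) v
            \<bullet> (g d (transition c d x) *v frechet_derivative (transition c d) (at x) w))"

text \<open>In the definitions below \<open>G\<close> is the component matrix function of a metric in one chart and
  vector fields are component functions in this chart. \<open>christoffel G i j k x\<close> is
  \<open>\<Gamma>\<^sup>i\<^sub>j\<^sub>k\<close> at \<open>x\<close>.\<close>

definition christoffel ::
  "(real^'n \<Rightarrow> real^'n^'n) \<Rightarrow> 'n \<Rightarrow> 'n \<Rightarrow> 'n \<Rightarrow> real^'n \<Rightarrow> real" where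
  "christoffel G i j k x = (\<Sum>l\<in>UNIV. matrix_inv (G x) $ i $ l *
      (partial j (\<lambda>y. G y $ k $ l) x + partial k (\<lambda>y. G y $ j $ l) x
        - partial l (\<lambda>y. G y $ j $ k) x)) / 2"

definition levi_civita ::
  "(real^'n \<Rightarrow> real^'n^'n) \<Rightarrow> (real^'n \<Rightarrow> real^'n) \<Rightarrow> (real^'n \<Rightarrow> real^'n) \<Rightarrow> real^'n \<Rightarrow> real^'n" where
  "levi_civita G X Y x = frechet_derivative Y (at x) (X x) +
      (\<chi> i. \<Sum>j\<in>UNIV. \<Sum>k\<in>UNIV. christoffel G i j k x * X x $ j * Y x $ k)"

definition lie_bracket ::
  "(real^'n \<Rightarrow> real^'n) \<Rightarrow> (real^'n \<Rightarrow> real^'n) \<Rightarrow> real^'n \<Rightarrow> real^'n" where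
  "lie_bracket X Y x = frechet_derivative Y (at x) (X x) - frechet_derivative X (at x) (Y x)"

definition curvature_operator ::
  "(real^'n \<Rightarrow> real^'n^'n) \<Rightarrow> (real^'n \<Rightarrow> real^'n) \<Rightarrow> (real^'n \<Rightarrow> real^'n) \<Rightarrow>
    (real^'n \<Rightarrow> real^'n) \<Rightarrow> real^'n \<Rightarrow> real^'n" where
  "curvature_operator G X Y Z x =
     levi_civita G X (levi_civita G Y Z) x - levi_civita G Y (levi_civita G X Z) x
       - levi_civita G (lie_bracket X Y) Z x"

text \<open>\<open>R\<^sub>i\<^sub>j\<^sub>k\<^sub>l = g(R(\<partial>\<^sub>i, \<partial>\<^sub>j)\<partial>\<^sub>k, \<partial>\<^sub>l)\<close>.\<close>

definition riemann_coeff ::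
  "(real^'n \<Rightarrow> real^'n^'n) \<Rightarrow> real^'n \<Rightarrow> 'n \<Rightarrow> 'n \<Rightarrow> 'n \<Rightarrow> 'n \<Rightarrow> real" where
  "riemann_coeff G x i j k l =
     curvature_operator G (\<lambda>_. axis i 1) (\<lambda>_. axis j 1) (\<lambda>_. axis k 1) x \<bullet> (G x *v axis l 1)"

definition complex_riemann :: "(real^'n \<Rightarrow> real^'n^'n) \<Rightarrow> real^'n \<Rightarrow>
    complex^'n \<Rightarrow> complex^'n \<Rightarrow> complex^'n \<Rightarrow> complex^'n \<Rightarrow> complex" where
  "complex_riemann G x Z\<^sub>1 Z\<^sub>2 Z\<^sub>3 Z\<^sub>4 =
     (\<Sum>i\<in>UNIV. \<Sum>j\<in>UNIV. \<Sum>k\<in>UNIV. \<Sum>l\<in>UNIV.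
        of_real (riemann_coeff G x i j k l) * Z\<^sub>1 $ i * Z\<^sub>2 $ j * Z\<^sub>3 $ k * Z\<^sub>4 $ l)"

text \<open>By the symmetries of the curvature tensor the number below is real, so that the sign
  condition is one on its real part.\<close>

definition nonpositive_complex_sectional_curvature ::
  "('a, real^'n) chart set \<Rightarrow> (('a, real^'n) chart \<Rightarrow> real^'n \<Rightarrow> real^'n^'n) \<Rightarrow> bool" where
  "nonpositive_complex_sectional_curvature A g \<longleftrightarrow>
     (\<forall>c\<in>A. \<forall>x\<in>coord_dom c. \<forall>Z W.
        Re (complex_riemann (g c) x Z (cnj_vec W) W (cnj_vec Z)) \<le> 0)"


section \<open>Hermitian metrics and uniform RC-positivity\<close>

text \<open>\<open>H $ \<gamma> $ \<delta>\<close> is the component \<open>h(\<partial>/\<partial>z\<^sup>\<gamma>, \<partial>/\<partial>z\<^sup>\<delta>)\<close>, with the second index barred.\<close>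

definition hermitian_form :: "complex^'m^'m \<Rightarrow> complex^'m \<Rightarrow> complex^'m \<Rightarrow> complex" where
  "hermitian_form H v w = (\<Sum>\<gamma>\<in>UNIV. \<Sum>\<delta>\<in>UNIV. H $ \<gamma> $ \<delta> * v $ \<gamma> * cnj (w $ \<delta>))"

text \<open>A metric on the holomorphic tangent bundle, again given by component matrices. The transition
  maps are holomorphic, so their real derivative is complex linear and acts on components with
  respect to \<open>\<partial>/\<partial>z\<^sup>\<gamma>\<close> by the holomorphic Jacobian.\<close>

definition hermitian_metric ::
  "('a, complex^'m) chart set \<Rightarrow> (('a, complex^'m) chart \<Rightarrow> complex^'m \<Rightarrow> complex^'m^'m) \<Rightarrow> bool" where
  "hermitian_metric A h \<longleftrightarrow>
     (\<forall>c\<in>A. smooth_on (h c) (coord_dom c) \<and>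
        (\<forall>x\<in>coord_dom c. (\<forall>\<gamma> \<delta>. h c x $ \<delta> $ \<gamma> = cnj (h c x $ \<gamma> $ \<delta>)) \<and>
           (\<forall>v. v \<noteq> 0 \<longrightarrow> Re (hermitian_form (h c x) v v) > 0))) \<and>
     (\<forall>c\<in>A. \<forall>d\<in>A. \<forall>x\<in>snd c ` (fst c \<inter> fst d). \<forall>v w.
        hermitian_form (h c x) v w =
          hermitian_form (h d (transition c d x))
            (frechet_derivative (transition c d) (at x) v)
            (frechet_derivative (transition c d) (at x) w))"

text \<open>The inverse \<open>h\<^sup>\<mu>\<^sup>\<nu>\<close> in the curvature formula is normalised by
  \<open>\<Sum>\<nu>. h\<^sup>\<mu>\<^sup>\<nu> h\<^sub>\<gamma>\<^sub>\<nu> = \<delta>\<^sup>\<mu>\<^sub>\<gamma>\<close> (\<open>\<nu>\<close> barred), hence it is the \<open>(\<nu>, \<mu>)\<close> entry of the inverse matrix.\<close>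

definition chern_coeff :: "(complex^'m \<Rightarrow> complex^'m^'m) \<Rightarrow> complex^'m \<Rightarrow>
    'm \<Rightarrow> 'm \<Rightarrow> 'm \<Rightarrow> 'm \<Rightarrow> complex" where
  "chern_coeff H z \<alpha> \<beta> \<gamma> \<delta> =
     - d_z \<alpha> (d_zbar \<beta> (\<lambda>w. H w $ \<gamma> $ \<delta>)) z
     + (\<Sum>\<mu>\<in>UNIV. \<Sum>\<nu>\<in>UNIV. matrix_inv (H z) $ \<nu> $ \<mu> *
          d_z \<alpha> (\<lambda>w. H w $ \<gamma> $ \<nu>) z * d_zbar \<beta> (\<lambda>w. H w $ \<mu> $ \<delta>) z)"

definition chern_curvature :: "(complex^'m \<Rightarrow> complex^'m^'m) \<Rightarrow> complex^'m \<Rightarrow>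
    complex^'m \<Rightarrow> complex^'m \<Rightarrow> complex^'m \<Rightarrow> complex^'m \<Rightarrow> complex" where
  "chern_curvature H z u\<^sub>1 u\<^sub>2 v\<^sub>1 v\<^sub>2 =
     (\<Sum>\<alpha>\<in>UNIV. \<Sum>\<beta>\<in>UNIV. \<Sum>\<gamma>\<in>UNIV. \<Sum>\<delta>\<in>UNIV.
        chern_coeff H z \<alpha> \<beta> \<gamma> \<delta> * u\<^sub>1 $ \<alpha> * u\<^sub>2 $ \<beta> * v\<^sub>1 $ \<gamma> * v\<^sub>2 $ \<delta>)"

text \<open>Since \<open>h\<close> is Hermitian, \<open>R(u, cnj u, v, cnj v)\<close> is real. The curvature is a tensor, so it does
  not matter which chart around a point is used.\<close>

definition uniformly_RC_positive ::
  "('a, complex^'m) chart set \<Rightarrow> (('a, complex^'m) chart \<Rightarrow> complex^'m \<Rightarrow> complex^'m^'m) \<Rightarrow> bool" where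
  "uniformly_RC_positive A h \<longleftrightarrow>
     (\<forall>c\<in>A. \<forall>z\<in>coord_dom c. \<exists>u. \<forall>v. v \<noteq> 0 \<longrightarrow>
        Re (chern_curvature (h c) z u (cnj_vec u) v (cnj_vec v)) > 0)"


section \<open>Pluri-harmonic maps\<close>

text \<open>The forms \<open>dz\<^sup>\<alpha> \<and> d\<close>(\<open>cnj z\<^sup>\<beta>\<close>) \<open>\<otimes> e\<^sub>i\<close> are pointwise linearly independent, so the tensor
  vanishes iff all its coefficients do.\<close>

definition pluriharmonic :: "'a topology \<Rightarrow> ('a, complex^'m) chart set \<Rightarrow>
    'b topology \<Rightarrow> ('b, real^'n) chart set \<Rightarrow> (('b, real^'n) chart \<Rightarrow> real^'n \<Rightarrow> real^'n^'n) \<Rightarrow>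
    ('a \<Rightarrow> 'b) \<Rightarrow> bool" where
  "pluriharmonic X A Y B g f \<longleftrightarrow> smooth_map X A Y B f \<and>
     (\<forall>c\<in>A. \<forall>d\<in>B. \<forall>z\<in>snd c ` (fst c \<inter> f -` fst d). \<forall>\<alpha> \<beta> i.
        let F = (\<lambda>j w. complex_of_real (local_rep c d f w $ j)) in
          d_z \<alpha> (d_zbar \<beta> (F i)) z
          + (\<Sum>j\<in>UNIV. \<Sum>k\<in>UNIV.
               of_real (christoffel (g d) i j k (local_rep c d f z))
                 * d_zbar \<beta> (F j) z * d_z \<alpha> (F k) z) = 0)"

end

(*
  Let m be the maximum over M of |df(v)|^2 / h(v, v), where df(v) is the image of a (1,0)-vector v in
  the complexified tangent space of N, attained at v0 over q. Extend v0 to a local holomorphic field v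
  whose Chern derivative vanishes at q, and take u from RC-positivity at q. With W = df(v) and
  Z = df(u), |W|^2 - m h(v, v) has a local maximum at q, so its complex Hessian in the direction u is
  at most 0 there. The second term contributes m R(u, cnj u, v0, cnj v0). For the first one,
  pluriharmonicity gives nabla_{cnj u} W = 0, so that its Hessian is
      |nabla_u W|^2 + g(R(cnj Z, Z) W, cnj W),
  and R(Z, W) (cnj Z) = 0 because the (0,1)-derivatives of f are parallel in all (1,0)-directions. By
  the Bianchi identity the last term is - g(R(W, cnj Z) Z, cnj W), which is at least 0 by the curvature
  assumption. Hence m > 0 is impossible and df = 0.
*)
theory Submission
  imports Defs
begin

section \<open>Functions of class C^k\<close>

text \<open>For a holomorphic field v the complex Hessian of h(v, v) is |D_u v|^2 - R(u, cnj u, v,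
  cnj v), with D the Chern connection. In |W|^2 - m h(v, v) the square appears with the wrong sign,
  which is why D v = 0 is imposed at q. The quotient serves only to find (q, v0) by compactness.
  What gets differentiated is the difference: it is at most 0 for every local extension of v0 and
  equals 0 at q. Hence an extension that is affine in one chart is good enough, and the differential
  part of the proof takes place between coordinate domains with matrix-valued metrics. The vanishing
  of nabla_{cnj u} W, and of nabla_u on (0,1)-derivatives of f, is differentiated once more, so both
  are needed on an open set; v is therefore holomorphic throughout, although it is made parallel
  only at q. Complexified directions p + i q are kept constant: derivatives along them commute, and
  the commutator of pulled-back connections is pure curvature without a bracket term.\<close>

lemma frechet_derivative_eqI: "(f has_derivative f') (at x) \<Longrightarrow> frechet_derivative f (at x) = f'"
  by (metis frechet_derivative_at)

lemma has_frechet_derivative: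
  "f differentiable at x \<Longrightarrow> (f has_derivative frechet_derivative f (at x)) (at x)"
  by (simp add: frechet_derivative_works)

lemma has_derivative_cong_open:
  assumes "open S" "x \<in> S" "\<And>y. y \<in> S \<Longrightarrow> f y = g y"
  shows "(f has_derivative D) (at x) \<longleftrightarrow> (g has_derivative D) (at x)"
  using assms by (intro iffI) (erule has_derivative_transform_within_open[of _ _ _ _ S]; simp)+

lemma frechet_derivative_cong_open:
  assumes "open S" "x \<in> S" "\<And>y. y \<in> S \<Longrightarrow> f y = g y"
  shows "frechet_derivative f (at x) = frechet_derivative g (at x)"
  using has_derivative_cong_open[of S x f g, OF assms] by (simp add: frechet_derivative_def)

lemma differentiable_cong_open:
  assumes "open S" "x \<in> S" "\<And>y. y \<in> S \<Longrightarrow> f y = g y"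
  shows "f differentiable at x \<longleftrightarrow> g differentiable at x"
  using has_derivative_cong_open[of S x f g, OF assms] by (simp add: differentiable_def)

lemma Ck_on_cong:
  assumes "open S" "\<And>x. x \<in> S \<Longrightarrow> f x = g x"
  shows "Ck_on k f S \<longleftrightarrow> Ck_on k g S"
  using assms(2)
proof (induction k arbitrary: f g)
  case 0
  then show ?case by (simp cong: continuous_on_cong)
next
  case (Suc k)
  have "\<And>x. x \<in> S \<Longrightarrow> f differentiable at x \<longleftrightarrow> g differentiable at x"
    using differentiable_cong_open[OF assms(1)] Suc.prems by blast
  moreover have "Ck_on k (\<lambda>x. frechet_derivative f (at x) v) S \<longleftrightarrow>
      Ck_on k (\<lambda>x. frechet_derivative g (at x) v) S" for v
    by (intro Suc.IH) (simp add: frechet_derivative_cong_open[OF assms(1) _ Suc.prems])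
  ultimately show ?case by simp
qed

lemma Ck_on_subset: "Ck_on k f S \<Longrightarrow> T \<subseteq> S \<Longrightarrow> Ck_on k f T"
proof (induction k arbitrary: f)
  case 0
  then show ?case by (auto intro: continuous_on_subset)
qed auto

lemma Ck_on_Suc_imp: "Ck_on (Suc k) f S \<Longrightarrow> Ck_on k f S"
proof (induction k arbitrary: f)
  case 0
  then show ?case
    by (auto intro!: continuous_at_imp_continuous_on differentiable_imp_continuous_within)
qed auto

lemma Ck_on_le: "Ck_on k f S \<Longrightarrow> l \<le> k \<Longrightarrow> Ck_on l f S"
  by (induction k) (auto dest: Ck_on_Suc_imp simp: le_Suc_eq simp del: Ck_on.simps(2))

lemma Ck_on_SucI:
  assumes "open S" "\<And>x. x \<in> S \<Longrightarrow> (f has_derivative f' x) (at x)"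
    and "\<And>v. Ck_on k (\<lambda>x. f' x v) S"
  shows "Ck_on (Suc k) f S"
proof -
  have "Ck_on k (\<lambda>x. frechet_derivative f (at x) v) S" for v
    using assms(3)[of v]
    by (subst Ck_on_cong[OF assms(1), of _ "\<lambda>x. f' x v"]) (simp_all add: frechet_derivative_eqI[OF assms(2)])
  then show ?thesis
    using assms(2) by (auto simp: differentiable_def)
qed

lemma Ck_on_const: "open S \<Longrightarrow> Ck_on k (\<lambda>x. c) S"
  by (induction k arbitrary: c) auto

lemma Ck_on_add:
  assumes "open S"
  shows "Ck_on k f S \<Longrightarrow> Ck_on k g S \<Longrightarrow> Ck_on k (\<lambda>x. f x + g x) S"
proof (induction k arbitrary: f g)
  case 0
  then show ?case by (auto intro: continuous_intros)
next
  case (Suc k)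
  show ?case
    by (rule Ck_on_SucI[OF assms, where f' = "\<lambda>x v. frechet_derivative f (at x) v + frechet_derivative g (at x) v"])
      (use Suc in \<open>auto intro!: has_derivative_add has_frechet_derivative\<close>)
qed

lemma Ck_on_bounded_linear:
  assumes "open S" and L: "bounded_linear L"
  shows "Ck_on k f S \<Longrightarrow> Ck_on k (\<lambda>x. L (f x)) S"
proof (induction k arbitrary: f)
  case 0
  then show ?case using bounded_linear.continuous_on[OF L] by simp
next
  case (Suc k)
  show ?case
    by (rule Ck_on_SucI[OF assms(1), where f' = "\<lambda>x v. L (frechet_derivative f (at x) v)"])
      (use Suc in \<open>auto intro!: bounded_linear.has_derivative[OF L] has_frechet_derivative\<close>)
qed

lemma Ck_on_bounded_bilinear:
  assumes "open S" and L: "bounded_bilinear L"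
  shows "Ck_on k f S \<Longrightarrow> Ck_on k g S \<Longrightarrow> Ck_on k (\<lambda>x. L (f x) (g x)) S"
proof (induction k arbitrary: f g)
  case 0
  then show ?case using bounded_bilinear.continuous_on[OF L] by simp
next
  case (Suc k)
  show ?case
  proof (rule Ck_on_SucI[OF assms(1)])
    fix x assume "x \<in> S"
    then show "((\<lambda>x. L (f x) (g x)) has_derivative
        (\<lambda>v. L (f x) (frechet_derivative g (at x) v) + L (frechet_derivative f (at x) v) (g x))) (at x)"
      using Suc.prems by (auto intro!: bounded_bilinear.FDERIV[OF L] has_frechet_derivative)
  next
    fix v
    show "Ck_on k (\<lambda>x. L (f x) (frechet_derivative g (at x) v) +
        L (frechet_derivative f (at x) v) (g x)) S"
      using Suc.prems Ck_on_Suc_imp[OF Suc.prems(1)] Ck_on_Suc_imp[OF Suc.prems(2)]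
      by (auto intro!: Ck_on_add[OF assms(1)] Suc.IH)
  qed
qed

lemma Ck_on_sum:
  assumes "open S" "\<And>i. i \<in> I \<Longrightarrow> Ck_on k (f i) S"
  shows "Ck_on k (\<lambda>x. \<Sum>i\<in>I. f i x) S"
  using assms(2)
  by (induction I rule: infinite_finite_induct) (auto intro: Ck_on_const Ck_on_add assms(1))

lemma Ck_on_compose:
  fixes F :: "'a::real_normed_vector \<Rightarrow> 'b::euclidean_space"
  assumes "open S" "open T" "F ` S \<subseteq> T"
  shows "Ck_on k F S \<Longrightarrow> Ck_on k G T \<Longrightarrow> Ck_on k (\<lambda>x. G (F x)) S"
proof (induction k arbitrary: G)
  case 0
  then show ?case using assms(3) by (auto intro: continuous_on_compose2)
next
  case (Suc k)
  note F = Ck_on_Suc_imp[OF Suc.prems(1)]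
  show ?case
  proof (rule Ck_on_SucI[OF assms(1)])
    fix x assume x: "x \<in> S"
    have G: "(G has_derivative frechet_derivative G (at (F x))) (at (F x))"
      using Suc.prems(2) x assms(3) by (auto intro: has_frechet_derivative)
    have D: "((\<lambda>x. G (F x)) has_derivative
        (\<lambda>v. frechet_derivative G (at (F x)) (frechet_derivative F (at x) v))) (at x)"
      using Suc.prems(1) x by (intro has_derivative_compose[of F _ x UNIV G] has_frechet_derivative G) auto
    \<comment> \<open>The induction hypothesis covers derivatives of \<open>G\<close> in fixed
      directions only, whereas the chain rule applies them to a direction that varies with
      \<open>x\<close>. A basis expansion leaves fixed directions with scalar coefficients of class
      C^k.\<close>
    have "frechet_derivative G (at (F x)) w =
        (\<Sum>b\<in>Basis. (w \<bullet> b) *\<^sub>R frechet_derivative G (at (F x)) b)" for w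
    proof -
      interpret linear "frechet_derivative G (at (F x))"
        using G by (rule has_derivative_linear)
      show ?thesis by (subst euclidean_representation[of w, symmetric]) (simp add: sum scale)
    qed
    then show "((\<lambda>x. G (F x)) has_derivative
        (\<lambda>v. \<Sum>b\<in>Basis. (frechet_derivative F (at x) v \<bullet> b) *\<^sub>R frechet_derivative G (at (F x)) b)) (at x)"
      by (intro has_derivative_eq_rhs[OF D] ext)
  next
    fix v
    have 1: "Ck_on k (\<lambda>x. frechet_derivative F (at x) v \<bullet> b) S" for b
      using Suc.prems(1) by (auto intro: Ck_on_bounded_linear[OF assms(1) bounded_linear_inner_left])
    have 2: "Ck_on k (\<lambda>x. frechet_derivative G (at (F x)) b) S" for b
      by (rule Suc.IH[OF F]) (use Suc.prems(2) in auto)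
    show "Ck_on k (\<lambda>x. \<Sum>b\<in>Basis. (frechet_derivative F (at x) v \<bullet> b) *\<^sub>R
        frechet_derivative G (at (F x)) b) S"
      by (intro Ck_on_sum[OF assms(1)] Ck_on_bounded_bilinear[OF assms(1) bounded_bilinear_scaleR] 1 2)
  qed
qed

lemma Ck_on_vec_nth: "open S \<Longrightarrow> Ck_on k f S \<Longrightarrow> Ck_on k (\<lambda>x. f x $ i) S"
  by (rule Ck_on_bounded_linear[OF _ bounded_linear_vec_nth])

lemma vec_eq_sum_axis: "x = (\<Sum>i\<in>UNIV. axis i (x $ i))"
  by (simp add: vec_eq_iff axis_def)

lemma bounded_linear_axis: "bounded_linear (axis i :: 'a::euclidean_space \<Rightarrow> 'a^'n)"
  unfolding linear_conv_bounded_linear[symmetric]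
  by (rule linearI) (auto simp: axis_def vec_eq_iff)

lemma Ck_on_vec:
  fixes f :: "'a::real_normed_vector \<Rightarrow> 'b::euclidean_space^'n"
  assumes "open S" "\<And>i. Ck_on k (\<lambda>x. f x $ i) S"
  shows "Ck_on k f S"
proof -
  have "Ck_on k (\<lambda>x. \<Sum>i\<in>UNIV. axis i (f x $ i)) S"
    by (intro Ck_on_sum[OF assms(1)] Ck_on_bounded_linear[OF assms(1) bounded_linear_axis] assms)
  then show ?thesis by (simp flip: vec_eq_sum_axis)
qed

lemma has_derivative_vec:
  fixes f :: "'a::real_normed_vector \<Rightarrow> 'b::euclidean_space^'n"
  assumes "\<And>i. ((\<lambda>x. f x $ i) has_derivative (\<lambda>v. f' v $ i)) (at x)"
  shows "(f has_derivative f') (at x)"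
proof -
  have "((\<lambda>x. \<Sum>i\<in>UNIV. axis i (f x $ i)) has_derivative (\<lambda>v. \<Sum>i\<in>UNIV. axis i (f' v $ i))) (at x)"
    by (intro has_derivative_sum bounded_linear.has_derivative[OF bounded_linear_axis] assms)
  then show ?thesis by (simp flip: vec_eq_sum_axis)
qed

lemma frechet_derivative_vec_nth:
  assumes "f differentiable at x"
  shows "frechet_derivative (\<lambda>y. f y $ i) (at x) v = frechet_derivative f (at x) v $ i"
  by (subst frechet_derivative_eqI)
    (auto intro!: bounded_linear.has_derivative[OF bounded_linear_vec_nth] has_frechet_derivative assms)

lemma Ck_on_differentiable: "Ck_on k f S \<Longrightarrow> k > 0 \<Longrightarrow> x \<in> S \<Longrightarrow> f differentiable at x"
  by (cases k) auto

section \<open>Symmetry of second derivatives and the second derivative test\<close>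

lemma has_real_derivative_along:
  fixes f :: "'a::real_normed_vector \<Rightarrow> real"
  assumes "f differentiable at (x + s *\<^sub>R p)"
  shows "((\<lambda>s. f (x + s *\<^sub>R p)) has_real_derivative frechet_derivative f (at (x + s *\<^sub>R p)) p) (at s)"
proof -
  have f: "(f has_derivative frechet_derivative f (at (x + s *\<^sub>R p))) (at (x + s *\<^sub>R p))"
    by (rule has_frechet_derivative[OF assms])
  have "((\<lambda>s. x + s *\<^sub>R p) has_derivative (\<lambda>t. t *\<^sub>R p)) (at s)"
    by (auto intro!: derivative_eq_intros)
  from has_derivative_compose[OF this f] show ?thesis
    unfolding has_field_derivative_def
    by (simp add: linear_scale[OF has_derivative_linear[OF f]] mult_commute_abs)
qed

text \<open>Two applications of the mean value theorem: first in the direction \<open>p\<close> to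
  the increment of \<open>f\<close> by \<open>h *\<^sub>R q\<close>, then in the direction
  \<open>q\<close> to the derivative of \<open>f\<close> along \<open>p\<close>.\<close>

lemma second_difference:
  fixes f :: "'a::real_normed_vector \<Rightarrow> real"
  assumes S: "\<And>s t. 0 \<le> s \<Longrightarrow> s \<le> h \<Longrightarrow> 0 \<le> t \<Longrightarrow> t \<le> h \<Longrightarrow> x + s *\<^sub>R p + t *\<^sub>R q \<in> S"
    and C: "Ck_on 2 f S" and h: "h > 0"
  obtains s t where "0 < s" "s < h" "0 < t" "t < h"
    "f (x + h *\<^sub>R p + h *\<^sub>R q) - f (x + h *\<^sub>R p) - f (x + h *\<^sub>R q) + f x =
      h * h * frechet_derivative (\<lambda>y. frechet_derivative f (at y) p) (at (x + s *\<^sub>R p + t *\<^sub>R q)) q"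
proof -
  define f1 where "f1 y = frechet_derivative f (at y) p" for y
  have f: "f differentiable at y" and f1: "f1 differentiable at y" if "y \<in> S" for y
    using C that by (auto simp: numeral_2_eq_2 f1_def[abs_def])
  have "\<exists>s>0. s < h \<and> (f (x + h *\<^sub>R q + h *\<^sub>R p) - f (x + h *\<^sub>R p)) -
      (f (x + h *\<^sub>R q + 0 *\<^sub>R p) - f (x + 0 *\<^sub>R p)) =
      (h - 0) * (f1 (x + h *\<^sub>R q + s *\<^sub>R p) - f1 (x + s *\<^sub>R p))"
  proof (rule MVT2[OF h])
    fix s assume s: "0 \<le> s" "s \<le> h"
    have e: "x + h *\<^sub>R q + s *\<^sub>R p = x + s *\<^sub>R p + h *\<^sub>R q"
      by simp
    have "x + h *\<^sub>R q + s *\<^sub>R p \<in> S" "x + s *\<^sub>R p \<in> S"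
      using S[OF s, of h] S[OF s, of 0] h unfolding e by auto
    then show "((\<lambda>s. f (x + h *\<^sub>R q + s *\<^sub>R p) - f (x + s *\<^sub>R p)) has_real_derivative
        f1 (x + h *\<^sub>R q + s *\<^sub>R p) - f1 (x + s *\<^sub>R p)) (at s)"
      unfolding f1_def by (intro DERIV_diff has_real_derivative_along f)
  qed
  then obtain s where s: "0 < s" "s < h" and 1: "f (x + h *\<^sub>R p + h *\<^sub>R q) - f (x + h *\<^sub>R p) - f (x + h *\<^sub>R q) + f x
      = h * (f1 (x + s *\<^sub>R p + h *\<^sub>R q) - f1 (x + s *\<^sub>R p))"
    by (auto simp: algebra_simps)
  have "\<exists>t>0. t < h \<and> f1 (x + s *\<^sub>R p + h *\<^sub>R q) - f1 (x + s *\<^sub>R p + 0 *\<^sub>R q) =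
      (h - 0) * frechet_derivative f1 (at (x + s *\<^sub>R p + t *\<^sub>R q)) q"
    by (rule MVT2[OF h], rule has_real_derivative_along, rule f1, rule S) (use s in auto)
  then obtain t where "0 < t" "t < h" "f1 (x + s *\<^sub>R p + h *\<^sub>R q) - f1 (x + s *\<^sub>R p) =
      h * frechet_derivative f1 (at (x + s *\<^sub>R p + t *\<^sub>R q)) q"
    by auto
  with s 1 show ?thesis
    by (intro that[of s t]) (auto simp: f1_def[abs_def])
qed

text \<open>The second difference is symmetric in \<open>p\<close> and \<open>q\<close>, so the two
  mixed derivatives agree at two points of an arbitrarily small parallelogram at \<open>x\<close>;
  their continuity carries this over to \<open>x\<close> itself.\<close>

lemma frechet_derivative_commute_real:
  fixes f :: "'a::real_normed_vector \<Rightarrow> real"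
  assumes "open S" "x \<in> S" and C: "Ck_on 2 f S"
  shows "frechet_derivative (\<lambda>y. frechet_derivative f (at y) p) (at x) q =
    frechet_derivative (\<lambda>y. frechet_derivative f (at y) q) (at x) p"
proof -
  define D where "D p q y = frechet_derivative (\<lambda>y. frechet_derivative f (at y) p) (at y) q" for p q y
  have cont: "isCont (D p q) x" for p q
    using C assms(1,2) by (auto simp: numeral_2_eq_2 D_def[abs_def] continuous_on_eq_continuous_at)
  have "\<bar>D p q x - D q p x\<bar> \<le> e" if "e > 0" for e
  proof -
    obtain d where d: "d > 0" "ball x d \<subseteq> S"
      using assms(1,2) by (auto simp: open_contains_ball)
    obtain d1 where d1: "d1 > 0" "\<And>y. dist y x < d1 \<Longrightarrow> dist (D p q y) (D p q x) < e/2"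
      using cont[of p q] \<open>e > 0\<close> unfolding continuous_at_eps_delta by (meson half_gt_zero)
    obtain d2 where d2: "d2 > 0" "\<And>y. dist y x < d2 \<Longrightarrow> dist (D q p y) (D q p x) < e/2"
      using cont[of q p] \<open>e > 0\<close> unfolding continuous_at_eps_delta by (meson half_gt_zero)
    define r where "r = min d (min d1 d2)"
    \<comment> \<open>Small enough for the whole parallelogram to lie within distance
      \<open>r\<close> of \<open>x\<close>; the summand 1 keeps the denominator positive when
      \<open>p\<close> and \<open>q\<close> are both zero.\<close>
    define h where "h = r / (2 * (norm p + norm q + 1))"
    have r: "r > 0" using d d1 d2 by (simp add: r_def)
    have np: "norm p + norm q + 1 > 0"
      by (simp add: add_nonneg_pos)
    then have h: "h > 0" using r by (simp add: h_def)
    have near: "dist (x + s *\<^sub>R p + t *\<^sub>R q) x < r"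
      if "0 \<le> s" "s \<le> h" "0 \<le> t" "t \<le> h" for s t
    proof -
      have "dist (x + s *\<^sub>R p + t *\<^sub>R q) x = norm (s *\<^sub>R p + t *\<^sub>R q)"
        by (simp add: dist_norm)
      also have "\<dots> \<le> s * norm p + t * norm q"
        using norm_triangle_ineq[of "s *\<^sub>R p" "t *\<^sub>R q"] that by simp
      also have "\<dots> \<le> h * norm p + h * norm q"
        using that by (intro add_mono mult_right_mono) auto
      also have "\<dots> < h * (2 * (norm p + norm q + 1))"
        using mult_pos_pos[OF h np] h by (simp add: algebra_simps)
      also have "\<dots> = r" using np by (simp add: h_def)
      finally show ?thesis .
    qed
    have inS: "x + s *\<^sub>R p + t *\<^sub>R q \<in> S"
      if "0 \<le> s" "s \<le> h" "0 \<le> t" "t \<le> h" for s t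
      using near[OF that] d by (auto simp: r_def dist_commute subset_iff)
    obtain s t where st: "0 < s" "s < h" "0 < t" "t < h"
      "f (x + h *\<^sub>R p + h *\<^sub>R q) - f (x + h *\<^sub>R p) - f (x + h *\<^sub>R q) + f x =
        h * h * D p q (x + s *\<^sub>R p + t *\<^sub>R q)"
      by (rule second_difference[OF inS C h]) (unfold D_def, blast)
    have inS': "x + s *\<^sub>R q + t *\<^sub>R p \<in> S"
      if "0 \<le> s" "s \<le> h" "0 \<le> t" "t \<le> h" for s t
      using inS[of t s] that by (simp add: ac_simps)
    obtain s' t' where st': "0 < s'" "s' < h" "0 < t'" "t' < h"
      "f (x + h *\<^sub>R q + h *\<^sub>R p) - f (x + h *\<^sub>R q) - f (x + h *\<^sub>R p) + f x =
        h * h * D q p (x + s' *\<^sub>R q + t' *\<^sub>R p)"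
      by (rule second_difference[OF inS' C h]) (unfold D_def, blast)
    have e: "x + h *\<^sub>R q + h *\<^sub>R p = x + h *\<^sub>R p + h *\<^sub>R q"
      by simp
    have "h * h * D p q (x + s *\<^sub>R p + t *\<^sub>R q) = h * h * D q p (x + s' *\<^sub>R q + t' *\<^sub>R p)"
      using st(5) st'(5) unfolding e by linarith
    then have eq: "D p q (x + s *\<^sub>R p + t *\<^sub>R q) = D q p (x + t' *\<^sub>R p + s' *\<^sub>R q)"
      using h by (simp add: add.assoc add.commute[of "s' *\<^sub>R q" "t' *\<^sub>R p"])
    have "dist (D p q (x + s *\<^sub>R p + t *\<^sub>R q)) (D p q x) < e/2"
      using near[of s t] st by (intro d1(2)) (simp add: r_def)
    moreover have "dist (D q p (x + t' *\<^sub>R p + s' *\<^sub>R q)) (D q p x) < e/2"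
      using near[of t' s'] st' by (intro d2(2)) (simp add: r_def)
    ultimately show ?thesis unfolding eq dist_real_def by linarith
  qed
  then have "\<bar>D p q x - D q p x\<bar> \<le> 0"
    by (rule field_le_epsilon) (simp only: add_0)
  then show ?thesis by (simp add: D_def)
qed

lemma frechet_derivative_bounded_linear:
  assumes "bounded_linear L" "f differentiable at x"
  shows "frechet_derivative (\<lambda>y. L (f y)) (at x) v = L (frechet_derivative f (at x) v)"
  by (subst frechet_derivative_eqI)
    (auto intro!: bounded_linear.has_derivative[OF assms(1)] has_frechet_derivative assms(2))

lemma frechet_derivative_bounded_linear_twice:
  assumes "bounded_linear L" "open S" "x \<in> S" "Ck_on 2 f S"
  shows "frechet_derivative (\<lambda>y. frechet_derivative (\<lambda>y. L (f y)) (at y) p) (at x) q =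
    L (frechet_derivative (\<lambda>y. frechet_derivative f (at y) p) (at x) q)"
proof -
  have f: "f differentiable at y" "(\<lambda>y. frechet_derivative f (at y) p) differentiable at y" if "y \<in> S" for y
    using assms(4) that by (auto simp: numeral_2_eq_2)
  have "frechet_derivative (\<lambda>y. frechet_derivative (\<lambda>y. L (f y)) (at y) p) (at x) q =
      frechet_derivative (\<lambda>y. L (frechet_derivative f (at y) p)) (at x) q"
    by (subst frechet_derivative_cong_open[OF assms(2,3)])
      (simp_all add: frechet_derivative_bounded_linear[OF assms(1)] f)
  then show ?thesis
    by (simp add: frechet_derivative_bounded_linear[OF assms(1)] f assms(3))
qed

lemma frechet_derivative_commute:
  fixes f :: "'a::real_normed_vector \<Rightarrow> complex"
  assumes "open S" "x \<in> S" "Ck_on 2 f S"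
  shows "frechet_derivative (\<lambda>y. frechet_derivative f (at y) p) (at x) q =
    frechet_derivative (\<lambda>y. frechet_derivative f (at y) q) (at x) p"
proof (rule complex_eqI)
  have C: "Ck_on 2 (\<lambda>y. Re (f y)) S" "Ck_on 2 (\<lambda>y. Im (f y)) S"
    by (rule Ck_on_bounded_linear[OF assms(1) bounded_linear_Re assms(3)],
        rule Ck_on_bounded_linear[OF assms(1) bounded_linear_Im assms(3)])
  note * = frechet_derivative_bounded_linear_twice[OF _ assms, symmetric]
  show "Re (frechet_derivative (\<lambda>y. frechet_derivative f (at y) p) (at x) q) =
      Re (frechet_derivative (\<lambda>y. frechet_derivative f (at y) q) (at x) p)"
    unfolding *[OF bounded_linear_Re] by (rule frechet_derivative_commute_real[OF assms(1,2) C(1)])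
  show "Im (frechet_derivative (\<lambda>y. frechet_derivative f (at y) p) (at x) q) =
      Im (frechet_derivative (\<lambda>y. frechet_derivative f (at y) q) (at x) p)"
    unfolding *[OF bounded_linear_Im] by (rule frechet_derivative_commute_real[OF assms(1,2) C(2)])
qed

text \<open>Along the line through \<open>x\<close> the first derivative vanishes at the maximum. A
  positive second derivative would make it positive just to the right of 0, and the mean value
  theorem would then give a larger value of \<open>f\<close>.\<close>

lemma second_derivative_at_max_nonpos:
  fixes f :: "'a::real_normed_vector \<Rightarrow> real"
  assumes "open S" "x \<in> S" "Ck_on 2 f S" and max: "\<And>y. y \<in> S \<Longrightarrow> f y \<le> f x"
  shows "frechet_derivative (\<lambda>y. frechet_derivative f (at y) p) (at x) p \<le> 0"
proof (rule ccontr)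
  define f1 where "f1 y = frechet_derivative f (at y) p" for y
  define c where "c = frechet_derivative f1 (at x) p"
  assume "\<not> frechet_derivative (\<lambda>y. frechet_derivative f (at y) p) (at x) p \<le> 0"
  then have c: "c > 0" by (simp add: c_def f1_def[abs_def])
  have f: "f differentiable at y" and f1: "f1 differentiable at y" if "y \<in> S" for y
    using assms(3) that by (auto simp: numeral_2_eq_2 f1_def[abs_def])
  have "open ((\<lambda>s. x + s *\<^sub>R p) -` S)"
    by (intro open_vimage assms continuous_intros)
  moreover have "0 \<in> (\<lambda>s. x + s *\<^sub>R p) -` S"
    using assms(2) by simp
  ultimately obtain e where "e > 0" "ball 0 e \<subseteq> (\<lambda>s. x + s *\<^sub>R p) -` S"
    by (meson open_contains_ball)
  then have e: "e > 0" "\<And>s. \<bar>s\<bar> < e \<Longrightarrow> x + s *\<^sub>R p \<in> S"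
    by (auto simp: subset_iff)
  have d: "((\<lambda>s. f (x + s *\<^sub>R p)) has_real_derivative f1 (x + s *\<^sub>R p)) (at s)" if "\<bar>s\<bar> < e" for s
    unfolding f1_def by (rule has_real_derivative_along) (simp add: f e that)
  have "((\<lambda>s. f1 (x + s *\<^sub>R p)) has_real_derivative frechet_derivative f1 (at (x + 0 *\<^sub>R p)) p) (at 0)"
    by (rule has_real_derivative_along) (simp add: f1 assms(2))
  then obtain d1 where d1: "d1 > 0" "\<And>h. h > 0 \<Longrightarrow> h < d1 \<Longrightarrow> f1 (x + 0 *\<^sub>R p) < f1 (x + (0 + h) *\<^sub>R p)"
    using DERIV_pos_inc_right[of "\<lambda>s. f1 (x + s *\<^sub>R p)"] c by (force simp: c_def)
  have "f1 (x + 0 *\<^sub>R p) = 0"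
  proof (rule DERIV_local_max)
    show "((\<lambda>s. f (x + s *\<^sub>R p)) has_real_derivative f1 (x + 0 *\<^sub>R p)) (at 0)"
      using e by (intro d) simp
    show "\<forall>s. \<bar>0 - s\<bar> < e \<longrightarrow> f (x + s *\<^sub>R p) \<le> f (x + 0 *\<^sub>R p)"
      using e by (auto intro: max)
  qed (rule e)
  define h where "h = min e d1 / 2"
  have h: "h > 0" "h < e" "h < d1" using e d1 by (auto simp: h_def)
  obtain s where s: "0 < s" "s < h" "f (x + h *\<^sub>R p) - f (x + 0 *\<^sub>R p) = (h - 0) * f1 (x + s *\<^sub>R p)"
    using MVT2[of 0 h "\<lambda>s. f (x + s *\<^sub>R p)" "\<lambda>s. f1 (x + s *\<^sub>R p)"] d h by auto
  have "f1 (x + s *\<^sub>R p) > 0"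
    using d1(2)[of s] s h \<open>f1 (x + 0 *\<^sub>R p) = 0\<close> by simp
  with h have "h * f1 (x + s *\<^sub>R p) > 0" by simp
  with s have "f (x + h *\<^sub>R p) > f x" by simp
  moreover have "f (x + h *\<^sub>R p) \<le> f x"
    using h by (intro max e) simp
  ultimately show False by simp
qed

section \<open>Derivatives along complexified directions\<close>

text \<open>\<open>cd p q\<close> is the derivative along the complexified vector \<open>p + \<i> q\<close>.\<close>

definition cd :: "'a::real_normed_vector \<Rightarrow> 'a \<Rightarrow> ('a \<Rightarrow> complex) \<Rightarrow> 'a \<Rightarrow> complex" where
  "cd p q f z = frechet_derivative f (at z) p + \<i> * frechet_derivative f (at z) q"

lemma cd_eqI: "(f has_derivative f') (at z) \<Longrightarrow> cd p q f z = f' p + \<i> * f' q"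
  by (simp add: cd_def frechet_derivative_eqI)

lemma cd_cong:
  "open S \<Longrightarrow> z \<in> S \<Longrightarrow> (\<And>y. y \<in> S \<Longrightarrow> f y = g y) \<Longrightarrow> cd p q f z = cd p q g z"
  using frechet_derivative_cong_open[of S z f g] by (simp add: cd_def)

lemma cd_const [simp]: "cd p q (\<lambda>z. c) z = 0"
  by (simp add: cd_def)

lemma cd_add:
  assumes "f differentiable at z" "g differentiable at z"
  shows "cd p q (\<lambda>z. f z + g z) z = cd p q f z + cd p q g z"
  by (subst cd_eqI[OF has_derivative_add[OF assms[THEN has_frechet_derivative]]])
    (simp add: cd_def algebra_simps)

lemma cd_mult:
  assumes "f differentiable at z" "g differentiable at z"
  shows "cd p q (\<lambda>z. f z * g z) z = cd p q f z * g z + f z * cd p q g z"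
  by (subst cd_eqI[OF has_derivative_mult[OF assms[THEN has_frechet_derivative]]])
    (simp add: cd_def algebra_simps)

lemma cd_cmult:
  assumes "f differentiable at z"
  shows "cd p q (\<lambda>z. c * f z) z = c * cd p q f z"
  using assms by (simp add: cd_mult)

lemma cd_sum:
  assumes "\<And>i. i \<in> I \<Longrightarrow> f i differentiable at z"
  shows "cd p q (\<lambda>z. \<Sum>i\<in>I. f i z) z = (\<Sum>i\<in>I. cd p q (f i) z)"
proof -
  have "((\<lambda>z. \<Sum>i\<in>I. f i z) has_derivative (\<lambda>v. \<Sum>i\<in>I. frechet_derivative (f i) (at z) v)) (at z)"
    by (intro has_derivative_sum has_frechet_derivative assms)
  from cd_eqI[OF this] show ?thesis
    by (simp add: cd_def[of _ _ "f _"] sum.distrib sum_distrib_left)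
qed

lemma cd_cnj:
  assumes "f differentiable at z"
  shows "cd p q (\<lambda>z. cnj (f z)) z = cnj (cd p (- q) f z)"
  using linear_neg[OF linear_frechet_derivative[OF assms]]
  by (simp add: cd_def frechet_derivative_bounded_linear[OF bounded_linear_cnj assms])

lemma Ck_on_cd:
  assumes "open S" "Ck_on (Suc k) f S"
  shows "Ck_on k (cd p q f) S"
  unfolding cd_def[abs_def]
  using assms by (intro Ck_on_add Ck_on_bounded_linear[of S "\<lambda>x. \<i> * x"] bounded_linear_mult_right) auto

lemma cd_cd:
  assumes "z \<in> S" "Ck_on 2 f S"
  shows "cd r s (cd p q f) z =
    frechet_derivative (\<lambda>z. frechet_derivative f (at z) p) (at z) r
    + \<i> * frechet_derivative (\<lambda>z. frechet_derivative f (at z) p) (at z) s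
    + \<i> * frechet_derivative (\<lambda>z. frechet_derivative f (at z) q) (at z) r
    - frechet_derivative (\<lambda>z. frechet_derivative f (at z) q) (at z) s"
proof -
  have d: "(\<lambda>z. frechet_derivative f (at z) p) differentiable at z" for p
    using assms by (auto simp: numeral_2_eq_2)
  have "((\<lambda>z. frechet_derivative f (at z) p + \<i> * frechet_derivative f (at z) q) has_derivative
      (\<lambda>v. frechet_derivative (\<lambda>z. frechet_derivative f (at z) p) (at z) v +
        \<i> * frechet_derivative (\<lambda>z. frechet_derivative f (at z) q) (at z) v)) (at z)"
    by (intro has_derivative_add has_derivative_mult_right has_frechet_derivative d)
  from cd_eqI[OF this] show ?thesis
    by (simp add: cd_def[abs_def] algebra_simps)
qed

lemma cd_commute:
  assumes "open S" "z \<in> S" "Ck_on 2 f S"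
  shows "cd r s (cd p q f) z = cd p q (cd r s f) z"
  unfolding cd_cd[OF assms(2,3)]
  by (simp add: frechet_derivative_commute[OF assms, of p r] frechet_derivative_commute[OF assms, of p s]
      frechet_derivative_commute[OF assms, of q r] frechet_derivative_commute[OF assms, of q s])

text \<open>Since mixed derivatives commute, (p + i q)(p - i q) is the sum of the second derivatives
  along \<open>p\<close> and along \<open>q\<close>, each nonpositive at a maximum of the real
  part.\<close>

lemma cd_cd_at_max_nonpos:
  assumes "open S" "z \<in> S" "Ck_on 2 f S" and max: "\<And>y. y \<in> S \<Longrightarrow> Re (f y) \<le> Re (f z)"
  shows "Re (cd p q (cd p (- q) f) z) \<le> 0"
proof -
  have C: "Ck_on 2 (\<lambda>y. Re (f y)) S"
    by (rule Ck_on_bounded_linear[OF assms(1) bounded_linear_Re assms(3)])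
  have nonpos: "Re (frechet_derivative (\<lambda>z. frechet_derivative f (at z) p) (at z) p) \<le> 0" for p
    unfolding frechet_derivative_bounded_linear_twice[OF bounded_linear_Re assms(1-3), symmetric]
    by (rule second_derivative_at_max_nonpos[OF assms(1,2) C max])
  have "frechet_derivative f (at y) (- q) = - frechet_derivative f (at y) q" if "y \<in> S" for y q
    using assms(3) that by (auto simp: numeral_2_eq_2 intro!: linear_neg linear_frechet_derivative)
  then have neg: "frechet_derivative (\<lambda>z. frechet_derivative f (at z) (- q)) (at z) r =
      - frechet_derivative (\<lambda>z. frechet_derivative f (at z) q) (at z) r" for q r
    using assms frechet_derivative_cong_open[OF assms(1,2), of "\<lambda>z. frechet_derivative f (at z) (- q)"
        "\<lambda>z. - frechet_derivative f (at z) q"]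
      frechet_derivative_bounded_linear[of uminus "\<lambda>z. frechet_derivative f (at z) q" z r]
    by (auto simp: numeral_2_eq_2 bounded_linear_minus bounded_linear_ident)
  show ?thesis
    using nonpos[of p] nonpos[of q]
    by (simp add: cd_cd[OF assms(2,3)] neg frechet_derivative_commute[OF assms(1-3), of p q])
qed

section \<open>Vector- and matrix-valued functions, and the product rule for bilinear forms\<close>

definition cdv :: "'a::real_normed_vector \<Rightarrow> 'a \<Rightarrow> ('a \<Rightarrow> complex^'n) \<Rightarrow> 'a \<Rightarrow> complex^'n" where
  "cdv p q W z = (\<chi> i. cd p q (\<lambda>z. W z $ i) z)"

definition cdm :: "'a::real_normed_vector \<Rightarrow> 'a \<Rightarrow> ('a \<Rightarrow> complex^'n^'m) \<Rightarrow> 'a \<Rightarrow> complex^'n^'m" where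
  "cdm p q M z = (\<chi> i. cdv p q (\<lambda>z. M z $ i) z)"

lemma cdv_nth [simp]: "cdv p q W z $ i = cd p q (\<lambda>z. W z $ i) z"
  by (simp add: cdv_def)

lemma cdm_nth [simp]: "cdm p q M z $ i = cdv p q (\<lambda>z. M z $ i) z"
  by (simp add: cdm_def)

lemma differentiable_vec_nth: "W differentiable at z \<Longrightarrow> (\<lambda>z. W z $ i) differentiable at z"
  by (auto simp: differentiable_def intro: bounded_linear.has_derivative[OF bounded_linear_vec_nth])

lemma differentiable_vec:
  fixes f :: "'a::real_normed_vector \<Rightarrow> 'b::euclidean_space^'n"
  assumes "\<And>i. (\<lambda>x. f x $ i) differentiable at x"
  shows "f differentiable at x"
  using has_derivative_vec[of f "\<lambda>v. \<chi> i. frechet_derivative (\<lambda>x. f x $ i) (at x) v" x]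
  by (auto simp: differentiable_def intro: has_frechet_derivative assms)

lemma cdv_cong:
  "open S \<Longrightarrow> z \<in> S \<Longrightarrow> (\<And>y. y \<in> S \<Longrightarrow> f y = g y) \<Longrightarrow> cdv p q f z = cdv p q g z"
  by (simp add: vec_eq_iff) (rule allI, rule cd_cong[of S], simp_all)

lemma cdv_const [simp]: "cdv p q (\<lambda>z. c) z = 0"
  by (simp add: vec_eq_iff)

lemma cdv_add:
  assumes "f differentiable at z" "g differentiable at z"
  shows "cdv p q (\<lambda>z. f z + g z) z = cdv p q f z + cdv p q g z"
  by (simp add: vec_eq_iff cd_add assms[THEN differentiable_vec_nth])

lemma Ck_on_cdv:
  assumes "open S" "Ck_on (Suc k) f S"
  shows "Ck_on k (cdv p q f) S"
  using assms by (intro Ck_on_vec) (auto intro!: Ck_on_cd[where f = "\<lambda>z. f z $ _"] Ck_on_vec_nth simp del: Ck_on.simps)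

lemma cdv_commute:
  assumes "open S" "z \<in> S" "Ck_on 2 f S"
  shows "cdv r s (cdv p q f) z = cdv p q (cdv r s f) z"
  using cd_commute[OF assms(1,2), of "\<lambda>z. f z $ _"] Ck_on_vec_nth[OF assms(1,3)]
  by (simp add: vec_eq_iff)

lemma cnj_vec_nth [simp]: "cnj_vec v $ i = cnj (v $ i)"
  by (simp add: cnj_vec_def)

lemma bounded_linear_cnj_vec: "bounded_linear cnj_vec"
  unfolding linear_conv_bounded_linear[symmetric] by (rule linearI) (auto simp: vec_eq_iff)

lemma cdv_cnj:
  assumes "f differentiable at z"
  shows "cdv p q (\<lambda>z. cnj_vec (f z)) z = cnj_vec (cdv p (- q) f z)"
  by (simp add: vec_eq_iff cd_cnj differentiable_vec_nth assms)

text \<open>Bilinear rather than sesquilinear: the product rule then keeps one and the same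
  direction in every slot. Hermitian expressions arise by inserting \<open>cnj_vec\<close>, whose
  effect on directions is recorded separately in \<open>cdv_cnj\<close>.\<close>

definition bil :: "complex^'k^'m \<Rightarrow> complex^'m \<Rightarrow> complex^'k \<Rightarrow> complex" where
  "bil M X Y = (\<Sum>i\<in>UNIV. \<Sum>j\<in>UNIV. M $ i $ j * X $ i * Y $ j)"

lemma bil_add_left: "bil M (X + X') Y = bil M X Y + bil M X' Y"
  and bil_add_right: "bil M X (Y + Y') = bil M X Y + bil M X Y'"
  and bil_minus_left: "bil M (- X) Y = - bil M X Y"
  and bil_zero_left [simp]: "bil M 0 Y = 0"
  and bil_zero_right [simp]: "bil M X 0 = 0"
  by (simp_all add: bil_def algebra_simps sum.distrib sum_negf)

lemma differentiable_bil:
  assumes "M differentiable at z" "X differentiable at z" "Y differentiable at z"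
  shows "(\<lambda>z. bil (M z) (X z) (Y z)) differentiable at z"
  unfolding bil_def by (intro differentiable_sum differentiable_mult differentiable_vec_nth assms finite ballI)

lemma Ck_on_mult:
  fixes f :: "'a::real_normed_vector \<Rightarrow> 'b::real_normed_algebra"
  shows "open S \<Longrightarrow> Ck_on k f S \<Longrightarrow> Ck_on k g S \<Longrightarrow> Ck_on k (\<lambda>x. f x * g x) S"
  by (rule Ck_on_bounded_bilinear[OF _ bounded_bilinear_mult])

lemma Ck_on_bil:
  assumes "open S" "Ck_on k M S" "Ck_on k X S" "Ck_on k Y S"
  shows "Ck_on k (\<lambda>z. bil (M z) (X z) (Y z)) S"
  unfolding bil_def by (intro Ck_on_sum Ck_on_mult Ck_on_vec_nth assms)

lemma cd_bil:
  assumes "M differentiable at z" "X differentiable at z" "Y differentiable at z"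
  shows "cd p q (\<lambda>z. bil (M z) (X z) (Y z)) z =
    bil (cdm p q M z) (X z) (Y z) + bil (M z) (cdv p q X z) (Y z) + bil (M z) (X z) (cdv p q Y z)"
  unfolding bil_def
  by (subst cd_sum cd_mult, (intro differentiable_sum differentiable_mult differentiable_vec_nth assms finite ballI)+)+
    (simp add: algebra_simps sum.distrib)

lemma bil_sum_right: "bil M X (\<Sum>l\<in>L. Y l) = (\<Sum>l\<in>L. bil M X (Y l))"
  by (induction L rule: infinite_finite_induct) (simp_all add: bil_add_right)

lemma bil_scale_right: "bil M X (c *s Y) = c * bil M X Y"
  by (simp add: bil_def sum_distrib_left mult_ac)

text \<open>The chain rule that carries a complexified direction on the source over to the real
  coordinate derivatives of tensor components on the target.\<close>

lemma cd_of_real_compose: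
  fixes F :: "'a::real_normed_vector \<Rightarrow> real^'n"
  assumes F: "F differentiable at z" and T: "T differentiable at (F z)"
  shows "cd p q (\<lambda>z. complex_of_real (T (F z))) z =
    (\<Sum>l\<in>UNIV. of_real (partial l T (F z)) * cd p q (\<lambda>z. of_real (F z $ l)) z)"
proof -
  define T' where "T' = frechet_derivative T (at (F z))"
  define F' where "F' = frechet_derivative F (at z)"
  have dT: "(T has_derivative T') (at (F z))" and dF: "(F has_derivative F') (at z)"
    using assms by (simp_all add: T'_def F'_def has_frechet_derivative)
  interpret T': linear T' using dT by (rule has_derivative_linear)
  have T': "T' w = (\<Sum>l\<in>UNIV. w $ l * partial l T (F z))" for w
  proof -
    have "w = (\<Sum>l\<in>UNIV. (w $ l) *\<^sub>R axis l 1)"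
      by (simp add: vec_eq_iff axis_def if_distrib cong: if_cong)
    then have "T' w = T' (\<Sum>l\<in>UNIV. (w $ l) *\<^sub>R axis l 1)" by simp
    also have "\<dots> = (\<Sum>l\<in>UNIV. w $ l * T' (axis l 1))"
      by (simp only: T'.sum T'.scale real_scaleR_def)
    finally show ?thesis by (simp only: partial_def T'_def)
  qed
  have 1: "((\<lambda>z. complex_of_real (T (F z))) has_derivative (\<lambda>v. of_real (T' (F' v)))) (at z)"
    by (intro has_derivative_of_real has_derivative_compose[OF dF dT])
  have 2: "((\<lambda>z. complex_of_real (F z $ l)) has_derivative (\<lambda>v. of_real (F' v $ l))) (at z)" for l
    by (intro has_derivative_of_real bounded_linear.has_derivative[OF bounded_linear_vec_nth] dF)
  show ?thesis
    by (simp add: cd_eqI[OF 1] cd_eqI[OF 2] T' algebra_simps sum.distrib sum_distrib_left)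
qed

section \<open>The Levi-Civita connection along a map\<close>

lemma symmetric_matrix_nth: "transpose A = A \<Longrightarrow> A $ i $ j = A $ j $ i"
  unfolding transpose_def vec_eq_iff by simp

lemma sum_mult_axis:
  fixes f :: "'n::finite \<Rightarrow> 'a::semiring_1"
  shows "(\<Sum>i\<in>UNIV. f i * axis k 1 $ i) = f k"
proof -
  have "(\<Sum>i\<in>UNIV. f i * axis k 1 $ i) = (\<Sum>i\<in>UNIV. if i = k then f i else 0)"
    by (rule sum.cong) (simp_all add: axis_def)
  then show ?thesis by simp
qed

lemma matrix_inv_works:
  assumes "invertible A"
  shows "A ** matrix_inv A = mat 1" "matrix_inv A ** A = mat 1"
  using someI_ex[OF assms[unfolded invertible_def]] by (auto simp: matrix_inv_def)

text \<open>Cramer's rule for the columns of the inverse. It exhibits the entries of the inverse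
  metric as quotients of determinants, which can be differentiated.\<close>

lemma matrix_inv_nth:
  fixes A :: "'a::field^'n^'n"
  assumes "invertible A"
  shows "matrix_inv A $ k $ l = det (\<chi> i j. if j = k then axis l 1 $ i else A $ i $ j) / det A"
proof -
  have "A *v (matrix_inv A *v axis l 1) = axis l 1"
    by (simp add: matrix_vector_mul_assoc matrix_inv_works[OF assms])
  then have "matrix_inv A *v axis l 1 = (\<chi> k. det (\<chi> i j. if j = k then axis l 1 $ i else A $ i $ j) / det A)"
    using assms by (simp add: cramer invertible_det_nz)
  moreover have "(matrix_inv A *v axis l 1) $ k = matrix_inv A $ k $ l"
    by (simp add: matrix_vector_mult_def axis_def if_distrib cong: if_cong)
  ultimately show ?thesis by simp
qed

lemma differentiable_prod:
  fixes f :: "'i \<Rightarrow> 'a::real_normed_vector \<Rightarrow> 'b::real_normed_field"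
  assumes "\<And>i. i \<in> I \<Longrightarrow> f i differentiable at x"
  shows "(\<lambda>x. \<Prod>i\<in>I. f i x) differentiable at x"
  using assms by (induction I rule: infinite_finite_induct) auto

lemma differentiable_det:
  fixes A :: "'a::real_normed_vector \<Rightarrow> real^'n^'n"
  assumes "\<And>i j. (\<lambda>x. A x $ i $ j) differentiable at x"
  shows "(\<lambda>x. det (A x)) differentiable at x"
  unfolding det_def
  by (intro differentiable_sum ballI differentiable_mult differentiable_prod differentiable_const assms)
    (simp add: finite_permutations)

lemma invertible_positive_definite:
  fixes A :: "real^'n^'n"
  assumes "\<And>v. v \<noteq> 0 \<Longrightarrow> v \<bullet> (A *v v) > 0"
  shows "invertible A"
  by (metis assms inner_zero_right invertible_left_inverse less_irrefl matrix_left_invertible_ker)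

text \<open>Complex-multilinear extensions at a point \<open>y\<close> of the target: \<open>gc\<close> of the metric, \<open>Gam\<close> of the
  Christoffel symbols, \<open>dGam\<close> of their derivative in the direction \<open>L\<close>, and \<open>Rop\<close> of the curvature
  operator \<open>R(X, Y)Z\<close>. \<open>nab G F p q\<close> is the pulled-back connection along \<open>F\<close> in the direction
  \<open>p + \<i> q\<close>.\<close>

definition FC :: "('a \<Rightarrow> real^'n) \<Rightarrow> 'a \<Rightarrow> complex^'n" where
  "FC F z = (\<chi> i. of_real (F z $ i))"

definition gc :: "(real^'n \<Rightarrow> real^'n^'n) \<Rightarrow> real^'n \<Rightarrow> complex^'n^'n" where
  "gc G y = (\<chi> i j. of_real (G y $ i $ j))"

definition chr :: "(real^'n \<Rightarrow> real^'n^'n) \<Rightarrow> real^'n \<Rightarrow> 'n \<Rightarrow> complex^'n^'n" where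
  "chr G y i = (\<chi> j k. of_real (christoffel G i j k y))"

definition Gam :: "(real^'n \<Rightarrow> real^'n^'n) \<Rightarrow> real^'n \<Rightarrow> complex^'n \<Rightarrow> complex^'n \<Rightarrow> complex^'n" where
  "Gam G y X Y = (\<chi> i. bil (chr G y i) X Y)"

definition dchr :: "(real^'n \<Rightarrow> real^'n^'n) \<Rightarrow> real^'n \<Rightarrow> complex^'n \<Rightarrow> 'n \<Rightarrow> complex^'n^'n" where
  "dchr G y L i = (\<chi> j k. \<Sum>l\<in>UNIV. of_real (partial l (christoffel G i j k) y) * L $ l)"

definition dGam :: "(real^'n \<Rightarrow> real^'n^'n) \<Rightarrow> real^'n \<Rightarrow> complex^'n \<Rightarrow> complex^'n \<Rightarrow> complex^'n \<Rightarrow> complex^'n" where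
  "dGam G y L X Y = (\<chi> i. bil (dchr G y L i) X Y)"

definition Rop :: "(real^'n \<Rightarrow> real^'n^'n) \<Rightarrow> real^'n \<Rightarrow> complex^'n \<Rightarrow> complex^'n \<Rightarrow> complex^'n \<Rightarrow> complex^'n" where
  "Rop G y X Y Z = dGam G y X Y Z - dGam G y Y X Z + Gam G y X (Gam G y Y Z) - Gam G y Y (Gam G y X Z)"

definition nab :: "(real^'n \<Rightarrow> real^'n^'n) \<Rightarrow> ('a::real_normed_vector \<Rightarrow> real^'n) \<Rightarrow> 'a \<Rightarrow> 'a \<Rightarrow>
    ('a \<Rightarrow> complex^'n) \<Rightarrow> 'a \<Rightarrow> complex^'n" where
  "nab G F p q W z = cdv p q W z + Gam G (F z) (cdv p q (FC F) z) (W z)"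

lemma FC_nth [simp]: "FC F z $ i = of_real (F z $ i)"
  by (simp add: FC_def)

lemma gc_nth [simp]: "gc G y $ i $ j = of_real (G y $ i $ j)"
  by (simp add: gc_def)

lemma chr_nth [simp]: "chr G y i $ j $ k = of_real (christoffel G i j k y)"
  by (simp add: chr_def)

lemma Gam_nth [simp]: "Gam G y X Y $ i = bil (chr G y i) X Y"
  by (simp add: Gam_def)

lemma dGam_nth [simp]: "dGam G y L X Y $ i = bil (dchr G y L i) X Y"
  by (simp add: dGam_def)

lemma Gam_add_right: "Gam G y X (Y + Y') = Gam G y X Y + Gam G y X Y'"
  by (simp add: vec_eq_iff bil_add_right)

lemma Gam_zero_right [simp]: "Gam G y X 0 = 0"
  by (simp add: vec_eq_iff)

lemma Gam_sum_right: "Gam G y X (\<Sum>i\<in>I. Y i) = (\<Sum>i\<in>I. Gam G y X (Y i))"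
  by (simp add: vec_eq_iff bil_sum_right)

lemma Gam_scale_right: "Gam G y X (c *s Y) = c *s Gam G y X Y"
  by (simp add: vec_eq_iff bil_scale_right)

lemma cnj_bil: "cnj (bil M X Y) = bil (\<chi> i j. cnj (M $ i $ j)) (cnj_vec X) (cnj_vec Y)"
  by (simp add: bil_def)

lemma cnj_vec_Gam: "cnj_vec (Gam G y X Y) = Gam G y (cnj_vec X) (cnj_vec Y)"
  by (simp add: vec_eq_iff cnj_bil bil_def)

lemma cnj_vec_add: "cnj_vec (X + Y) = cnj_vec X + cnj_vec Y"
  by (simp add: vec_eq_iff)

lemma Ck_on_of_real: "open S \<Longrightarrow> Ck_on k f S \<Longrightarrow> Ck_on k (\<lambda>x. complex_of_real (f x)) S"
  by (rule Ck_on_bounded_linear[OF _ bounded_linear_of_real])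

lemma Ck_on_FC: "open S \<Longrightarrow> Ck_on k F S \<Longrightarrow> Ck_on k (FC F) S"
  by (rule Ck_on_vec) (auto intro: Ck_on_of_real Ck_on_vec_nth)

lemma differentiable_of_real: "f differentiable at z \<Longrightarrow> (\<lambda>z. complex_of_real (f z)) differentiable at z"
  by (auto simp: differentiable_def intro: has_derivative_of_real)

lemma differentiable_FC: "F differentiable at z \<Longrightarrow> FC F differentiable at z"
  by (rule differentiable_vec) (simp add: differentiable_of_real differentiable_vec_nth)

text \<open>The components of \<open>F\<close> are real, so conjugation exchanges its derivatives
  along p - i q and p + i q, and thereby its (1,0)- and (0,1)-derivatives.\<close>

lemma cdv_FC_cnj:
  assumes "F differentiable at z"
  shows "cnj_vec (cdv p (- q) (FC F) z) = cdv p q (FC F) z"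
proof -
  have "(\<lambda>z. cnj_vec (FC F z)) = FC F"
    by (simp add: fun_eq_iff vec_eq_iff)
  then show ?thesis
    using cdv_cnj[OF differentiable_FC[OF assms], of p q] by simp
qed

lemma nab_cnj:
  assumes "F differentiable at z" "W differentiable at z"
  shows "nab G F p q (\<lambda>z. cnj_vec (W z)) z = cnj_vec (nab G F p (- q) W z)"
  by (simp add: nab_def cdv_cnj[OF assms(2)] cnj_vec_add cnj_vec_Gam cdv_FC_cnj[OF assms(1)])

lemma differentiable_compose':
  assumes "f differentiable at (g x)" "g differentiable at x"
  shows "(\<lambda>x. f (g x)) differentiable at x"
  using assms unfolding differentiable_def by (auto intro: has_derivative_compose)

lemma cdm_chr:
  assumes "F differentiable at z" "\<And>i j k. christoffel G i j k differentiable at (F z)"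
  shows "cdm p q (\<lambda>z. chr G (F z) i) z = dchr G (F z) (cdv p q (FC F) z) i"
  using assms by (simp add: vec_eq_iff dchr_def cd_of_real_compose)

lemma differentiable_chr:
  assumes "F differentiable at z" "\<And>i j k. christoffel G i j k differentiable at (F z)"
  shows "(\<lambda>z. chr G (F z) i) differentiable at z"
  by (intro differentiable_vec) (simp add: differentiable_of_real differentiable_compose' assms)

lemma cdv_Gam:
  assumes "F differentiable at z" "\<And>i j k. christoffel G i j k differentiable at (F z)"
    and "X differentiable at z" "Y differentiable at z"
  shows "cdv p q (\<lambda>z. Gam G (F z) (X z) (Y z)) z = dGam G (F z) (cdv p q (FC F) z) (X z) (Y z)
    + Gam G (F z) (cdv p q X z) (Y z) + Gam G (F z) (X z) (cdv p q Y z)"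
  by (simp add: vec_eq_iff cd_bil differentiable_chr assms cdm_chr)

lemma differentiable_Gam:
  assumes "F differentiable at z" "\<And>i j k. christoffel G i j k differentiable at (F z)"
    and "X differentiable at z" "Y differentiable at z"
  shows "(\<lambda>z. Gam G (F z) (X z) (Y z)) differentiable at z"
  by (intro differentiable_vec) (simp add: differentiable_bil differentiable_chr assms)

lemma differentiable_cdv:
  assumes "open S" "z \<in> S" "Ck_on 2 f S"
  shows "cdv p q f differentiable at z"
  using Ck_on_cdv[OF assms(1), of 1 f p q] assms(2,3)
  by (auto simp: numeral_2_eq_2 One_nat_def simp del: Ck_on.simps intro: Ck_on_differentiable[of 1])

text \<open>The curvature of the pulled-back connection is the pulled-back curvature. The directions
  p + i q and r + i s are constant and commute, so no bracket term appears.\<close>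

lemma nab_commutator:
  assumes S: "open S" "z \<in> S" and F: "Ck_on 2 F S" and W: "Ck_on 2 W S"
    and G: "\<And>i j k. christoffel G i j k differentiable at (F z)"
  shows "nab G F r s (nab G F p q W) z - nab G F p q (nab G F r s W) z =
    Rop G (F z) (cdv r s (FC F) z) (cdv p q (FC F) z) (W z)"
proof -
  have dF: "F differentiable at z" and dW: "W differentiable at z"
    using F W S by (auto intro: Ck_on_differentiable[of 2])
  note d = differentiable_cdv[OF S W] differentiable_cdv[OF S Ck_on_FC[OF S(1) F]]
  \<comment> \<open>Fully expanded, the second derivatives of \<open>W\<close> and of
    \<open>F\<close> are symmetric under exchanging the two directions, as are the two terms pairing
    a derivative of \<open>F\<close> with one of \<open>W\<close> when taken together. Only the
    terms of \<open>Rop\<close> survive the antisymmetrisation.\<close>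
  have *: "nab G F r s (nab G F p q W) z =
     cdv r s (cdv p q W) z +
     (dGam G (F z) (cdv r s (FC F) z) (cdv p q (FC F) z) (W z)
       + Gam G (F z) (cdv r s (cdv p q (FC F)) z) (W z) + Gam G (F z) (cdv p q (FC F) z) (cdv r s W z)) +
     (Gam G (F z) (cdv r s (FC F) z) (cdv p q W z)
       + Gam G (F z) (cdv r s (FC F) z) (Gam G (F z) (cdv p q (FC F) z) (W z)))" for p q r s
    unfolding nab_def
    by (simp add: cdv_add cdv_Gam differentiable_Gam d dF dW G Gam_add_right)
  show ?thesis
    unfolding *
    by (simp add: cdv_commute[OF S W, of r s p q] cdv_commute[OF S Ck_on_FC[OF S(1) F], of r s p q] Rop_def)
qed

section \<open>Vanishing torsion, the Bianchi identity and compatibility with the metric\<close>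

lemma christoffel_symmetric:
  assumes "open V" "y \<in> V" and sym: "\<And>x. x \<in> V \<Longrightarrow> transpose (G x) = G x"
  shows "christoffel G i j k y = christoffel G i k j y"
proof -
  have "G x $ a $ b = G x $ b $ a" if "x \<in> V" for x a b
    by (rule symmetric_matrix_nth[OF sym[OF that]])
  then have "partial l (\<lambda>y. G y $ j $ k) y = partial l (\<lambda>y. G y $ k $ j) y" for l
    unfolding partial_def by (intro frechet_derivative_cong_open[OF assms(1,2), THEN fun_cong])
  then show ?thesis
    by (simp add: christoffel_def algebra_simps)
qed

lemma Gam_commute:
  assumes "open V" "y \<in> V" and sym: "\<And>x. x \<in> V \<Longrightarrow> transpose (G x) = G x"
  shows "Gam G y X Y = Gam G y Y X"
  unfolding vec_eq_iff Gam_nth bil_def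
  by (subst sum.swap) (simp add: christoffel_symmetric[OF assms] mult_ac)

lemma dGam_commute:
  assumes "open V" "y \<in> V" and sym: "\<And>x. x \<in> V \<Longrightarrow> transpose (G x) = G x"
  shows "dGam G y L X Y = dGam G y L Y X"
proof -
  have "partial l (christoffel G i j k) y = partial l (christoffel G i k j) y" for l i j k
    unfolding partial_def
    by (intro frechet_derivative_cong_open[OF assms(1,2), THEN fun_cong] christoffel_symmetric[OF assms(1)] sym)
  then have "dchr G y L i $ j $ k = dchr G y L i $ k $ j" for i j k
    by (simp add: dchr_def)
  then show ?thesis
    unfolding vec_eq_iff dGam_nth bil_def
    by (subst sum.swap) (simp add: mult_ac)
qed

text \<open>Vanishing torsion makes \<open>Gam\<close> and \<open>dGam\<close> symmetric in their
  last two arguments, whereupon the twelve terms of the cyclic sum cancel in pairs.\<close>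

lemma bianchi:
  assumes "open V" "y \<in> V" and sym: "\<And>x. x \<in> V \<Longrightarrow> transpose (G x) = G x"
  shows "Rop G y X Y Z + Rop G y Y Z X + Rop G y Z X Y = 0"
  by (simp add: Rop_def Gam_commute[where G = G and X = Y and Y = Z, OF assms] Gam_commute[where G = G and X = X and Y = Z, OF assms] Gam_commute[where G = G and X = X and Y = Y, OF assms]
      dGam_commute[where G = G and L = X and X = Y and Y = Z, OF assms] dGam_commute[where G = G and L = Y and X = X and Y = Z, OF assms] dGam_commute[where G = G and L = Z and X = X and Y = Y, OF assms])

lemma sum_rotate3: "(\<Sum>a\<in>A. \<Sum>b\<in>B. \<Sum>c\<in>C. f a b c) = (\<Sum>b\<in>B. \<Sum>c\<in>C. \<Sum>a\<in>A. f a b c)"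
  by (subst sum.swap, rule sum.cong[OF refl], rule sum.swap)

definition dgc :: "(real^'n \<Rightarrow> real^'n^'n) \<Rightarrow> real^'n \<Rightarrow> complex^'n \<Rightarrow> complex^'n^'n" where
  "dgc G y L = (\<chi> i j. \<Sum>l\<in>UNIV. of_real (partial l (\<lambda>y. G y $ i $ j) y) * L $ l)"

lemma christoffel_lower:
  assumes "invertible (G y)" and sym: "transpose (G y) = G y"
  shows "(\<Sum>i\<in>UNIV. christoffel G i j k y * G y $ i $ m) =
    (partial j (\<lambda>y. G y $ k $ m) y + partial k (\<lambda>y. G y $ j $ m) y - partial m (\<lambda>y. G y $ j $ k) y) / 2"
proof -
  let ?P = "\<lambda>l. (partial j (\<lambda>y. G y $ k $ l) y + partial k (\<lambda>y. G y $ j $ l) y - partial l (\<lambda>y. G y $ j $ k) y)"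
  have G: "G y $ i $ m = G y $ m $ i" for i m
    by (rule symmetric_matrix_nth[OF sym])
  have "(\<Sum>i\<in>UNIV. G y $ m $ i * matrix_inv (G y) $ i $ l) = (if m = l then 1 else 0)" for l
    using matrix_inv_works(1)[OF assms(1)] by (simp add: matrix_matrix_mult_def mat_def vec_eq_iff)
  note inv = this
  have "(\<Sum>i\<in>UNIV. christoffel G i j k y * G y $ i $ m) =
      (\<Sum>i\<in>UNIV. \<Sum>l\<in>UNIV. G y $ m $ i * matrix_inv (G y) $ i $ l * (?P l / 2))"
    by (simp add: christoffel_def sum_distrib_left sum_divide_distrib sum_distrib_right G[of _ m] mult_ac)
  also have "\<dots> = (\<Sum>l\<in>UNIV. (\<Sum>i\<in>UNIV. G y $ m $ i * matrix_inv (G y) $ i $ l) * (?P l / 2))"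
    by (subst sum.swap) (simp only: sum_distrib_right)
  also have "\<dots> = (\<Sum>l\<in>UNIV. if m = l then ?P l / 2 else 0)"
    by (rule sum.cong) (simp_all add: inv)
  also have "\<dots> = ?P m / 2"
    by simp
  finally show ?thesis .
qed

text \<open>This is nabla g = 0 in coordinates: after lowering an index, each Christoffel sum is
  half of three metric derivatives, and the two sums leave only the derivative in question.\<close>

lemma partial_metric:
  assumes "open V" "y \<in> V" and sym: "\<And>x. x \<in> V \<Longrightarrow> transpose (G x) = G x"
    and inv: "invertible (G y)"
  shows "partial l (\<lambda>y. G y $ j $ k) y =
    (\<Sum>i\<in>UNIV. christoffel G i l j y * G y $ i $ k) + (\<Sum>i\<in>UNIV. christoffel G i l k y * G y $ j $ i)"
proof -
  have G: "G x $ a $ b = G x $ b $ a" if "x \<in> V" for x a b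
    by (rule symmetric_matrix_nth[OF sym[OF that]])
  have P: "partial l (\<lambda>y. G y $ j $ k) y = partial l (\<lambda>y. G y $ k $ j) y" for l j k
    unfolding partial_def by (intro frechet_derivative_cong_open[OF assms(1,2), THEN fun_cong] G)
  show ?thesis
    by (simp add: G[OF assms(2), of j] christoffel_lower[of G y, OF inv sym[OF assms(2)]]
        P[of _ k j] P[of _ l j] P[of _ l k] field_simps)
qed

text \<open>\<open>partial_metric\<close> contracted with three complex vectors. The sums are
  rearranged until the index shared by metric and Christoffel symbol is innermost, where the
  coordinate identity can be applied.\<close>

lemma dgc_Gam:
  assumes "open V" "y \<in> V" and sym: "\<And>x. x \<in> V \<Longrightarrow> transpose (G x) = G x"
    and inv: "invertible (G y)"
  shows "bil (dgc G y L) X Y = bil (gc G y) (Gam G y L X) Y + bil (gc G y) X (Gam G y L Y)"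
proof -
  let ?g = "\<lambda>i k. complex_of_real (G y $ i $ k)"
  let ?c = "\<lambda>i l j. complex_of_real (christoffel G i l j y)"
  let ?t = "\<lambda>l j k. L $ l * X $ j * Y $ k"
  have "bil (gc G y) (Gam G y L X) Y =
      (\<Sum>i\<in>UNIV. \<Sum>k\<in>UNIV. \<Sum>l\<in>UNIV. \<Sum>j\<in>UNIV. ?c i l j * ?g i k * ?t l j k)"
    by (simp add: bil_def sum_distrib_left sum_distrib_right mult_ac)
  also have "\<dots> = (\<Sum>i\<in>UNIV. \<Sum>l\<in>UNIV. \<Sum>j\<in>UNIV. \<Sum>k\<in>UNIV. ?c i l j * ?g i k * ?t l j k)"
    by (rule sum.cong[OF refl], rule sum_rotate3)
  also have "\<dots> = (\<Sum>l\<in>UNIV. \<Sum>j\<in>UNIV. \<Sum>i\<in>UNIV. \<Sum>k\<in>UNIV. ?c i l j * ?g i k * ?t l j k)"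
    by (rule sum_rotate3)
  also have "\<dots> = (\<Sum>l\<in>UNIV. \<Sum>j\<in>UNIV. \<Sum>k\<in>UNIV. \<Sum>i\<in>UNIV. ?c i l j * ?g i k * ?t l j k)"
    by (rule sum.cong[OF refl], rule sum.cong[OF refl], rule sum.swap)
  finally have 1: "bil (gc G y) (Gam G y L X) Y =
      (\<Sum>l\<in>UNIV. \<Sum>j\<in>UNIV. \<Sum>k\<in>UNIV. (\<Sum>i\<in>UNIV. ?c i l j * ?g i k) * ?t l j k)"
    by (simp only: sum_distrib_right)
  have "bil (gc G y) X (Gam G y L Y) =
      (\<Sum>j\<in>UNIV. \<Sum>i\<in>UNIV. \<Sum>l\<in>UNIV. \<Sum>k\<in>UNIV. ?c i l k * ?g j i * ?t l j k)"
    by (simp add: bil_def sum_distrib_left sum_distrib_right mult_ac)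
  also have "\<dots> = (\<Sum>j\<in>UNIV. \<Sum>l\<in>UNIV. \<Sum>k\<in>UNIV. \<Sum>i\<in>UNIV. ?c i l k * ?g j i * ?t l j k)"
    by (rule sum.cong[OF refl], rule sum_rotate3)
  also have "\<dots> = (\<Sum>l\<in>UNIV. \<Sum>j\<in>UNIV. \<Sum>k\<in>UNIV. \<Sum>i\<in>UNIV. ?c i l k * ?g j i * ?t l j k)"
    by (rule sum.swap)
  finally have 2: "bil (gc G y) X (Gam G y L Y) =
      (\<Sum>l\<in>UNIV. \<Sum>j\<in>UNIV. \<Sum>k\<in>UNIV. (\<Sum>i\<in>UNIV. ?c i l k * ?g j i) * ?t l j k)"
    by (simp only: sum_distrib_right)
  have "bil (dgc G y L) X Y =
      (\<Sum>j\<in>UNIV. \<Sum>k\<in>UNIV. \<Sum>l\<in>UNIV. of_real (partial l (\<lambda>y. G y $ j $ k) y) * ?t l j k)"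
    by (simp add: bil_def dgc_def sum_distrib_left sum_distrib_right mult_ac)
  also have "\<dots> = (\<Sum>l\<in>UNIV. \<Sum>j\<in>UNIV. \<Sum>k\<in>UNIV. of_real (partial l (\<lambda>y. G y $ j $ k) y) * ?t l j k)"
    by (rule sum_rotate3[symmetric])
  finally show ?thesis
    unfolding 1 2 by (simp add: partial_metric[where G = G, OF assms] distrib_right sum.distrib)
qed

text \<open>The product rule for the complex bilinear extension of the metric, so both slots are
  differentiated in the same direction. Conjugate directions enter only later, through
  \<open>nab_cnj\<close>.\<close>

lemma cd_metric:
  assumes "F differentiable at z" "\<And>i j. (\<lambda>y. G y $ i $ j) differentiable at (F z)"
    and "X differentiable at z" "Y differentiable at z"
    and "open V" "F z \<in> V" and sym: "\<And>x. x \<in> V \<Longrightarrow> transpose (G x) = G x"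
    and inv: "invertible (G (F z))"
  shows "cd p q (\<lambda>z. bil (gc G (F z)) (X z) (Y z)) z =
    bil (gc G (F z)) (nab G F p q X z) (Y z) + bil (gc G (F z)) (X z) (nab G F p q Y z)"
proof -
  have 1: "cdm p q (\<lambda>z. gc G (F z)) z = dgc G (F z) (cdv p q (FC F) z)"
    by (simp add: vec_eq_iff dgc_def cd_of_real_compose[where T = "\<lambda>y. G y $ _ $ _", OF assms(1,2)])
  have 2: "(\<lambda>z. gc G (F z)) differentiable at z"
    by (intro differentiable_vec) (simp add: differentiable_of_real
        differentiable_compose'[where f = "\<lambda>y. G y $ _ $ _", OF assms(2,1)])
  show ?thesis
    by (simp add: cd_bil[OF 2 assms(3,4)] 1 dgc_Gam[where G = G, OF assms(5-8)] nab_def bil_add_left bil_add_right)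
qed

text \<open>By Cramer's rule the inverse metric is a quotient of determinants in the metric, with
  nonzero denominator; the remaining factors are first derivatives of a metric of class C^2.\<close>

lemma christoffel_differentiable:
  assumes V: "open V" "y \<in> V" and G: "Ck_on 2 G V"
    and inv: "\<And>x. x \<in> V \<Longrightarrow> invertible (G x)"
  shows "christoffel G i j k differentiable at y"
proof -
  have C: "Ck_on 2 (\<lambda>x. G x $ a $ b) V" for a b
    by (intro Ck_on_vec_nth V G)
  then have p: "partial l (\<lambda>y. G y $ a $ b) differentiable at y" for l a b
    using V(2) by (auto simp: numeral_2_eq_2 partial_def[abs_def])
  have d: "(\<lambda>x. G x $ a $ b) differentiable at y" for a b
    by (rule Ck_on_differentiable[OF C _ V(2)]) simp
  have "(\<lambda>x. if j = m then axis l 1 $ i else G x $ i $ j) differentiable at y" for m l i j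
    by (cases "j = m") (simp_all add: d)
  then have "(\<lambda>x. det (\<chi> i j. if j = m then axis l 1 $ i else G x $ i $ j) / det (G x)) differentiable at y" for m l
    using inv[OF V(2)] d
    by (intro differentiable_divide differentiable_det) (auto simp: invertible_det_nz)
  then have m: "(\<lambda>x. matrix_inv (G x) $ m $ l) differentiable at y" for m l
    by (subst differentiable_cong_open[OF V]) (auto simp: matrix_inv_nth inv)
  show ?thesis
    unfolding christoffel_def[abs_def] divide_inverse
    by (intro differentiable_mult differentiable_sum differentiable_diff differentiable_add
        differentiable_const m p ballI finite)
qed

section \<open>The curvature tensor in coordinates\<close>

lemma frechet_derivative_christoffel:
  assumes "\<And>i j k. christoffel G i j k differentiable at x"
  shows "frechet_derivative (\<lambda>x. \<chi> i. christoffel G i j k x) (at x) (axis l 1) $ i = partial l (christoffel G i j k) x"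
  using frechet_derivative_vec_nth[of "\<lambda>x. \<chi> i. christoffel G i j k x" x i "axis l 1"]
    differentiable_vec[of "\<lambda>x. \<chi> i. christoffel G i j k x" x] assms
  by (simp add: partial_def)

lemma levi_civita_const:
  "levi_civita G (\<lambda>_. axis j 1) (\<lambda>_. axis k 1) = (\<lambda>x. \<chi> i. christoffel G i j k x)"
proof -
  have "(\<Sum>a\<in>UNIV. \<Sum>b\<in>UNIV. christoffel G i a b x * axis j 1 $ a * axis k 1 $ b) = christoffel G i j k x" for i x
    by (simp add: sum_mult_axis)
  then show ?thesis
    by (simp add: levi_civita_def fun_eq_iff vec_eq_iff)
qed

lemma curvature_operator_coordinate:
  assumes "\<And>i j k. christoffel G i j k differentiable at x"
  shows "curvature_operator G (\<lambda>_. axis i 1) (\<lambda>_. axis j 1) (\<lambda>_. axis k 1) x $ m =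
    partial i (christoffel G m j k) x - partial j (christoffel G m i k) x
    + (\<Sum>a\<in>UNIV. christoffel G m i a x * christoffel G a j k x)
    - (\<Sum>a\<in>UNIV. christoffel G m j a x * christoffel G a i k x)"
proof -
  have 1: "levi_civita G (\<lambda>_. axis i 1) (\<lambda>x. \<chi> m. christoffel G m j k x) x $ m =
      partial i (christoffel G m j k) x + (\<Sum>a\<in>UNIV. christoffel G m i a x * christoffel G a j k x)" for i j k
  proof -
    have "(\<Sum>a\<in>UNIV. \<Sum>b\<in>UNIV. christoffel G m a b x * axis i 1 $ a * christoffel G b j k x) =
        (\<Sum>b\<in>UNIV. christoffel G m i b x * christoffel G b j k x)"
      using sum_mult_axis[of "\<lambda>a. \<Sum>b\<in>UNIV. christoffel G m a b x * christoffel G b j k x" i]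
      by (simp add: sum_distrib_right sum_distrib_left mult_ac)
    then show ?thesis
      by (simp add: levi_civita_def frechet_derivative_christoffel assms)
  qed
  have 2: "lie_bracket (\<lambda>_. axis i 1) (\<lambda>_. axis j 1) = (\<lambda>_. 0 :: real^'a)"
    by (simp add: lie_bracket_def fun_eq_iff)
  have 3: "levi_civita G (\<lambda>_. 0) (\<lambda>_. axis k 1) x = 0"
    by (simp add: levi_civita_def vec_eq_iff)
  show ?thesis
    by (simp add: curvature_operator_def levi_civita_const 1 2 3)
qed

lemma Rop_nth:
  fixes X Y Z :: "complex^'n"
  assumes "\<And>i j k. christoffel G i j k differentiable at x"
  shows "Rop G x X Y Z $ m = (\<Sum>i\<in>UNIV. \<Sum>j\<in>UNIV. \<Sum>k\<in>UNIV.
     of_real (curvature_operator G (\<lambda>_. axis i 1) (\<lambda>_. axis j 1) (\<lambda>_. axis k 1) x $ m) * (X $ i * Y $ j * Z $ k))"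
proof -
  let ?c = "\<lambda>i j k. complex_of_real (christoffel G i j k x)"
  let ?p = "\<lambda>l i j k. complex_of_real (partial l (christoffel G i j k) x)"
  let ?t = "\<lambda>i j k. X $ i * Y $ j * Z $ k"
  have "bil (dchr G x X m) Y Z = (\<Sum>j\<in>UNIV. \<Sum>k\<in>UNIV. \<Sum>i\<in>UNIV. ?p i m j k * ?t i j k)"
    by (simp add: bil_def dchr_def sum_distrib_left sum_distrib_right mult_ac)
  then have 1: "bil (dchr G x X m) Y Z = (\<Sum>i\<in>UNIV. \<Sum>j\<in>UNIV. \<Sum>k\<in>UNIV. ?p i m j k * ?t i j k)"
    using sum_rotate3[of "\<lambda>i j k. ?p i m j k * ?t i j k" UNIV UNIV UNIV] by simp
  have "bil (dchr G x Y m) X Z = (\<Sum>i\<in>UNIV. \<Sum>k\<in>UNIV. \<Sum>j\<in>UNIV. ?p j m i k * ?t i j k)"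
    by (simp add: bil_def dchr_def sum_distrib_left sum_distrib_right mult_ac)
  also have "\<dots> = (\<Sum>i\<in>UNIV. \<Sum>j\<in>UNIV. \<Sum>k\<in>UNIV. ?p j m i k * ?t i j k)"
    by (rule sum.cong[OF refl], rule sum.swap)
  finally have 2: "bil (dchr G x Y m) X Z = (\<Sum>i\<in>UNIV. \<Sum>j\<in>UNIV. \<Sum>k\<in>UNIV. ?p j m i k * ?t i j k)" .
  have "bil (chr G x m) X (Gam G x Y Z) =
      (\<Sum>i\<in>UNIV. \<Sum>a\<in>UNIV. \<Sum>j\<in>UNIV. \<Sum>k\<in>UNIV. ?c m i a * ?c a j k * ?t i j k)"
    by (simp add: bil_def sum_distrib_left sum_distrib_right mult_ac)
  also have "\<dots> = (\<Sum>i\<in>UNIV. \<Sum>j\<in>UNIV. \<Sum>k\<in>UNIV. \<Sum>a\<in>UNIV. ?c m i a * ?c a j k * ?t i j k)"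
    by (rule sum.cong[OF refl], rule sum_rotate3)
  finally have 3: "bil (chr G x m) X (Gam G x Y Z) =
      (\<Sum>i\<in>UNIV. \<Sum>j\<in>UNIV. \<Sum>k\<in>UNIV. (\<Sum>a\<in>UNIV. ?c m i a * ?c a j k) * ?t i j k)"
    by (simp only: sum_distrib_right)
  have "bil (chr G x m) Y (Gam G x X Z) =
      (\<Sum>j\<in>UNIV. \<Sum>a\<in>UNIV. \<Sum>i\<in>UNIV. \<Sum>k\<in>UNIV. ?c m j a * ?c a i k * ?t i j k)"
    by (simp add: bil_def sum_distrib_left sum_distrib_right mult_ac)
  also have "\<dots> = (\<Sum>j\<in>UNIV. \<Sum>i\<in>UNIV. \<Sum>k\<in>UNIV. \<Sum>a\<in>UNIV. ?c m j a * ?c a i k * ?t i j k)"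
    by (rule sum.cong[OF refl], rule sum_rotate3)
  also have "\<dots> = (\<Sum>i\<in>UNIV. \<Sum>j\<in>UNIV. \<Sum>k\<in>UNIV. \<Sum>a\<in>UNIV. ?c m j a * ?c a i k * ?t i j k)"
    by (rule sum.swap)
  finally have 4: "bil (chr G x m) Y (Gam G x X Z) =
      (\<Sum>i\<in>UNIV. \<Sum>j\<in>UNIV. \<Sum>k\<in>UNIV. (\<Sum>a\<in>UNIV. ?c m j a * ?c a i k) * ?t i j k)"
    by (simp only: sum_distrib_right)
  show ?thesis
    by (simp add: Rop_def 1 2 3 4 curvature_operator_coordinate assms sum.distrib sum_subtractf
        distrib_right left_diff_distrib)
qed

text \<open>The bridge between the two descriptions of curvature: the sign hypothesis is about the
  tensor built from covariant derivatives of coordinate fields, while the commutator of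
  \<open>nab\<close> produces \<open>Rop\<close>.\<close>

lemma complex_riemann_Rop:
  fixes X Y Z W :: "complex^'n"
  assumes "\<And>i j k. christoffel G i j k differentiable at x" and sym: "transpose (G x) = G x"
  shows "complex_riemann G x X Y Z W = bil (gc G x) (Rop G x X Y Z) W"
proof -
  let ?R = "\<lambda>i j k m. curvature_operator G (\<lambda>_. axis i 1) (\<lambda>_. axis j 1) (\<lambda>_. axis k 1) x $ m"
  let ?t = "\<lambda>i j k l. X $ i * Y $ j * Z $ k * W $ l"
  have R: "riemann_coeff G x i j k l = (\<Sum>m\<in>UNIV. ?R i j k m * G x $ m $ l)" for i j k l
    by (simp add: riemann_coeff_def inner_vec_def matrix_vector_mult_def axis_def if_distrib cong: if_cong)
  have "bil (gc G x) (Rop G x X Y Z) W =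
      (\<Sum>m\<in>UNIV. \<Sum>l\<in>UNIV. \<Sum>i\<in>UNIV. \<Sum>j\<in>UNIV. \<Sum>k\<in>UNIV. of_real (?R i j k m * G x $ m $ l) * ?t i j k l)"
    by (simp add: bil_def Rop_nth assms sum_distrib_left sum_distrib_right mult_ac)
  also have "\<dots> = (\<Sum>l\<in>UNIV. \<Sum>i\<in>UNIV. \<Sum>m\<in>UNIV. \<Sum>j\<in>UNIV. \<Sum>k\<in>UNIV. of_real (?R i j k m * G x $ m $ l) * ?t i j k l)"
    by (rule sum_rotate3)
  also have "\<dots> = (\<Sum>l\<in>UNIV. \<Sum>i\<in>UNIV. \<Sum>j\<in>UNIV. \<Sum>k\<in>UNIV. \<Sum>m\<in>UNIV. of_real (?R i j k m * G x $ m $ l) * ?t i j k l)"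
    by (rule sum.cong[OF refl], rule sum.cong[OF refl], rule sum_rotate3)
  also have "\<dots> = (\<Sum>i\<in>UNIV. \<Sum>j\<in>UNIV. \<Sum>l\<in>UNIV. \<Sum>k\<in>UNIV. \<Sum>m\<in>UNIV. of_real (?R i j k m * G x $ m $ l) * ?t i j k l)"
    by (rule sum_rotate3)
  also have "\<dots> = (\<Sum>i\<in>UNIV. \<Sum>j\<in>UNIV. \<Sum>k\<in>UNIV. \<Sum>l\<in>UNIV. \<Sum>m\<in>UNIV. of_real (?R i j k m * G x $ m $ l) * ?t i j k l)"
    by (rule sum.cong[OF refl], rule sum.cong[OF refl], rule sum.swap)
  finally show ?thesis
    by (simp add: complex_riemann_def R sum_distrib_left sum_distrib_right mult_ac)
qed

text \<open>With X = a + i b the cross terms are purely imaginary, so positivity of the Hermitian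
  extension reduces to that of the real metric on \<open>a\<close> and on \<open>b\<close>.\<close>

lemma Re_bil_cnj:
  "Re (bil (gc G y) X (cnj_vec X)) =
    (\<chi> i. Re (X $ i)) \<bullet> (G y *v (\<chi> i. Re (X $ i))) + (\<chi> i. Im (X $ i)) \<bullet> (G y *v (\<chi> i. Im (X $ i)))"
  by (simp add: bil_def inner_vec_def matrix_vector_mult_def sum_distrib_left sum.distrib algebra_simps)

section \<open>The local maximum principle\<close>

text \<open>\<open>cd (wp u) (- wq u)\<close> and \<open>cd (wp u) (wq u)\<close> are the derivatives along the
  (1,0)-vector \<open>u\<close> and its conjugate.\<close>

definition wp :: "complex^'m \<Rightarrow> complex^'m" where
  "wp u = (1/2) *\<^sub>R u"

definition wq :: "complex^'m \<Rightarrow> complex^'m" where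
  "wq u = (1/2) *\<^sub>R (\<i> *s u)"

lemma linear_complex_vec_expand:
  fixes L :: "complex^'m \<Rightarrow> complex"
  assumes "linear L"
  shows "L u = (\<Sum>\<alpha>\<in>UNIV. of_real (Re (u $ \<alpha>)) * L (axis \<alpha> 1) + of_real (Im (u $ \<alpha>)) * L (axis \<alpha> \<i>))"
proof -
  have "u = (\<Sum>\<alpha>\<in>UNIV. Re (u $ \<alpha>) *\<^sub>R axis \<alpha> 1 + Im (u $ \<alpha>) *\<^sub>R axis \<alpha> \<i>)"
  proof -
    have "axis \<alpha> (u $ \<alpha>) = Re (u $ \<alpha>) *\<^sub>R axis \<alpha> 1 + Im (u $ \<alpha>) *\<^sub>R axis \<alpha> \<i>" for \<alpha>
      by (simp add: vec_eq_iff axis_def complex_eq_iff)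
    then show ?thesis using vec_eq_sum_axis[of u] by simp
  qed
  then have "L u = L (\<Sum>\<alpha>\<in>UNIV. Re (u $ \<alpha>) *\<^sub>R axis \<alpha> 1 + Im (u $ \<alpha>) *\<^sub>R axis \<alpha> \<i>)"
    by simp
  also have "\<dots> = (\<Sum>\<alpha>\<in>UNIV. of_real (Re (u $ \<alpha>)) * L (axis \<alpha> 1) + of_real (Im (u $ \<alpha>)) * L (axis \<alpha> \<i>))"
    by (simp add: linear_sum[OF assms] linear_add[OF assms] linear_scale[OF assms] scaleR_conv_of_real[where 'a = complex])
  finally show ?thesis .
qed

lemma
  assumes "f differentiable at z"
  shows cd_10: "cd (wp u) (- wq u) f z = (\<Sum>\<alpha>\<in>UNIV. u $ \<alpha> * d_z \<alpha> f z)"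
    and cd_01: "cd (wp u) (wq u) f z = (\<Sum>\<alpha>\<in>UNIV. cnj (u $ \<alpha>) * d_zbar \<alpha> f z)"
proof -
  define L where "L = frechet_derivative f (at z)"
  have L: "linear L" unfolding L_def by (rule linear_frechet_derivative[OF assms])
  have iu: "L (\<i> *s u) = (\<Sum>\<alpha>\<in>UNIV. of_real (- Im (u $ \<alpha>)) * L (axis \<alpha> 1) + of_real (Re (u $ \<alpha>)) * L (axis \<alpha> \<i>))"
    by (subst linear_complex_vec_expand[OF L]) simp
  have w: "L (wp u) = L u / 2" "L (wq u) = L (\<i> *s u) / 2" "L (- wq u) = - L (\<i> *s u) / 2"
    by (simp_all add: wp_def wq_def linear_scale[OF L] linear_neg[OF L] scaleR_conv_of_real[where 'a = complex])
  have e: "w = of_real (Re w) + \<i> * of_real (Im w)" "cnj w = of_real (Re w) - \<i> * of_real (Im w)" for w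
    by (simp_all add: complex_eq_iff)
  show "cd (wp u) (- wq u) f z = (\<Sum>\<alpha>\<in>UNIV. u $ \<alpha> * d_z \<alpha> f z)"
    unfolding cd_def d_z_def L_def[symmetric] w iu linear_complex_vec_expand[OF L, of u]
    by (subst e(1)[of "u $ _"]) (simp add: algebra_simps sum.distrib sum_distrib_left sum_divide_distrib add_divide_distrib diff_divide_distrib sum_subtractf sum_negf)
  show "cd (wp u) (wq u) f z = (\<Sum>\<alpha>\<in>UNIV. cnj (u $ \<alpha>) * d_zbar \<alpha> f z)"
    unfolding cd_def d_zbar_def L_def[symmetric] w iu linear_complex_vec_expand[OF L, of u]
    by (subst e(2)[of "u $ _"]) (simp add: algebra_simps sum.distrib sum_distrib_left sum_divide_distrib add_divide_distrib diff_divide_distrib sum_subtractf sum_negf)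
qed

lemma d_zbar_eq_cd: "d_zbar \<beta> f = (\<lambda>z. 1/2 * cd (axis \<beta> 1) (axis \<beta> \<i>) f z)"
  by (simp add: d_zbar_def cd_def fun_eq_iff)

lemma Ck_on_d_zbar: "open S \<Longrightarrow> Ck_on (Suc k) f S \<Longrightarrow> Ck_on k (d_zbar \<beta> f) S"
  unfolding d_zbar_eq_cd
  by (rule Ck_on_bounded_linear[OF _ bounded_linear_mult_right]) (auto simp del: Ck_on.simps intro: Ck_on_cd)

lemma cd_10_01:
  assumes S: "open S" "z \<in> S" and f: "Ck_on 2 f S"
  shows "cd (wp u) (- wq u) (cd (wp w) (wq w) f) z =
    (\<Sum>\<alpha>\<in>UNIV. \<Sum>\<beta>\<in>UNIV. u $ \<alpha> * cnj (w $ \<beta>) * d_z \<alpha> (d_zbar \<beta> f) z)"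
proof -
  have d: "f differentiable at y" if "y \<in> S" for y
    by (rule Ck_on_differentiable[OF f _ that]) simp
  have d2: "d_zbar \<beta> f differentiable at z" for \<beta>
    using Ck_on_differentiable[OF Ck_on_d_zbar[OF S(1), of 1 f] _ S(2)] f
    by (simp add: numeral_2_eq_2 del: Ck_on.simps)
  have "cd (wp u) (- wq u) (cd (wp w) (wq w) f) z =
      cd (wp u) (- wq u) (\<lambda>z. \<Sum>\<beta>\<in>UNIV. cnj (w $ \<beta>) * d_zbar \<beta> f z) z"
    by (rule cd_cong[OF S]) (simp add: cd_01 d)
  also have "\<dots> = (\<Sum>\<beta>\<in>UNIV. cnj (w $ \<beta>) * (\<Sum>\<alpha>\<in>UNIV. u $ \<alpha> * d_z \<alpha> (d_zbar \<beta> f) z))"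
    by (subst cd_sum) (simp_all add: cd_cmult cd_10 d2)
  also have "\<dots> = (\<Sum>\<beta>\<in>UNIV. \<Sum>\<alpha>\<in>UNIV. u $ \<alpha> * cnj (w $ \<beta>) * d_z \<alpha> (d_zbar \<beta> f) z)"
    by (simp add: sum_distrib_left mult_ac)
  finally show ?thesis
    by (subst sum.swap)
qed

lemma cd_10_axis: "f differentiable at z \<Longrightarrow> cd (wp (axis \<gamma> 1)) (- wq (axis \<gamma> 1)) f z = d_z \<gamma> f z"
  using sum_mult_axis[of "\<lambda>\<alpha>. d_z \<alpha> f z" \<gamma>] by (simp add: cd_10 mult.commute)

lemma bounded_linear_matrix_vector_mult:
  fixes A :: "complex^'m^'n"
  shows "bounded_linear ((*v) A)"
  unfolding linear_conv_bounded_linear[symmetric]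
  by (rule linearI) (simp_all add: vec_eq_iff matrix_vector_mult_def algebra_simps sum.distrib scaleR_sum_right)

lemma Ck_on_ident: "open S \<Longrightarrow> Ck_on k (\<lambda>x. x) S"
  by (cases k) (auto intro: Ck_on_const continuous_on_id)

lemma has_derivative_affine:
  fixes A :: "complex^'m^'n"
  shows "((\<lambda>z. b + A *v (z - a)) has_derivative (*v) A) (at z)"
proof -
  have "((\<lambda>z. z - a) has_derivative (\<lambda>h. h)) (at z)"
    by (auto intro!: derivative_eq_intros)
  then have "((\<lambda>z. A *v (z - a)) has_derivative (\<lambda>h. A *v h)) (at z)"
    by (rule bounded_linear.has_derivative[OF bounded_linear_matrix_vector_mult])
  then show ?thesis
    using has_derivative_add[OF has_derivative_const[of b]] by fastforce
qed

lemma Ck_on_affine: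
  fixes A :: "complex^'m^'n"
  assumes "open S"
  shows "Ck_on k (\<lambda>z. b + A *v (z - a)) S"
proof -
  have "Ck_on k (\<lambda>z. z + - a) S"
    by (intro Ck_on_add[OF assms] Ck_on_ident Ck_on_const assms)
  then have "Ck_on k (\<lambda>z. A *v (z - a)) S"
    using Ck_on_bounded_linear[OF assms bounded_linear_matrix_vector_mult] by simp
  then show ?thesis
    by (rule Ck_on_add[OF assms Ck_on_const[OF assms]])
qed

lemma cdv_affine:
  fixes A :: "complex^'m^'n"
  shows "cdv (wp u) (- wq u) (\<lambda>z. b + A *v (z - a)) z = A *v u"
    and "cdv (wp u) (wq u) (\<lambda>z. b + A *v (z - a)) z = 0"
proof -
  have *: "cd p q (\<lambda>z. (b + A *v (z - a)) $ i) z = (A *v p) $ i + \<i> * (A *v q) $ i" for p q i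
    by (rule cd_eqI, rule bounded_linear.has_derivative[OF bounded_linear_vec_nth has_derivative_affine])
  have w: "A *v wp u = (1/2) *\<^sub>R (A *v u)" "A *v wq u = (1/2) *\<^sub>R (\<i> *s (A *v u))" "A *v (- wq u) = - (1/2) *\<^sub>R (\<i> *s (A *v u))"
    by (simp_all add: wp_def wq_def vec_eq_iff matrix_vector_mult_def scaleR_sum_right sum_distrib_left sum_negf mult_ac)
  show "cdv (wp u) (- wq u) (\<lambda>z. b + A *v (z - a)) z = A *v u"
    unfolding vec_eq_iff cdv_nth * w by (simp add: scaleR_conv_of_real[where 'a = complex])
  show "cdv (wp u) (wq u) (\<lambda>z. b + A *v (z - a)) z = 0"
    unfolding vec_eq_iff cdv_nth * w by (simp add: scaleR_conv_of_real[where 'a = complex])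
qed

lemma Ck_on_scale:
  fixes X :: "'a::real_normed_vector \<Rightarrow> complex^'n"
  assumes "open S" "Ck_on k c S" "Ck_on k X S"
  shows "Ck_on k (\<lambda>z. c z *s X z) S"
  using assms by (intro Ck_on_vec) (simp_all add: Ck_on_mult Ck_on_vec_nth)

lemma cdv_sum_scale:
  fixes X :: "'i \<Rightarrow> 'a::real_normed_vector \<Rightarrow> complex^'n"
  assumes "\<And>i. i \<in> I \<Longrightarrow> c i differentiable at z" "\<And>i. i \<in> I \<Longrightarrow> X i differentiable at z"
  shows "cdv p q (\<lambda>z. \<Sum>i\<in>I. c i z *s X i z) z =
    (\<Sum>i\<in>I. cd p q (c i) z *s X i z) + (\<Sum>i\<in>I. c i z *s cdv p q (X i) z)"
  using assms
  by (simp add: vec_eq_iff cd_sum cd_mult differentiable_vec_nth differentiable_mult sum.distrib)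

section \<open>Hermitian metrics and the Chern curvature as a Hessian\<close>

lemma hermitian_form_eq_bil: "hermitian_form H v w = bil H v (cnj_vec w)"
  by (simp add: hermitian_form_def bil_def)

lemma invertible_hermitian:
  fixes H :: "complex^'m^'m"
  assumes "\<And>v. v \<noteq> 0 \<Longrightarrow> Re (hermitian_form H v v) > 0"
  shows "invertible H"
proof -
  have "x = 0" if "H *v x = 0" for x
  proof (rule ccontr)
    assume "x \<noteq> 0"
    \<comment> \<open>The form conjugates its second argument, which is contracted with the column
      index; inserting the conjugate of \<open>x\<close> therefore produces \<open>H *v x\<close>
      itself.\<close>
    then have "cnj_vec x \<noteq> 0" by (simp add: vec_eq_iff)
    then have "Re (hermitian_form H (cnj_vec x) (cnj_vec x)) > 0" by (rule assms)
    moreover have "hermitian_form H (cnj_vec x) (cnj_vec x) = (\<Sum>\<gamma>\<in>UNIV. cnj (x $ \<gamma>) * (H *v x) $ \<gamma>)"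
      by (simp add: hermitian_form_def matrix_vector_mult_def sum_distrib_left mult_ac)
    ultimately show False using that by simp
  qed
  then show ?thesis
    by (simp add: invertible_left_inverse matrix_left_invertible_ker)
qed

lemma differentiable_cnj_vec: "X differentiable at z \<Longrightarrow> (\<lambda>z. cnj_vec (X z)) differentiable at z"
  unfolding differentiable_def by (auto intro: bounded_linear.has_derivative[OF bounded_linear_cnj_vec])

lemma cnj_vec_zero [simp]: "cnj_vec 0 = 0"
  by (simp add: vec_eq_iff)

lemma cdm_cdm_nth: "cdm p q (cdm r s H) z $ i $ j = cd p q (cd r s (\<lambda>z. H z $ i $ j)) z"
  by simp

lemma Ck_on_cdm:
  fixes H :: "'a::real_normed_vector \<Rightarrow> complex^'n^'m"
  assumes "open S" "Ck_on (Suc k) H S"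
  shows "Ck_on k (cdm p q H) S"
  by (intro Ck_on_vec[OF assms(1)])
    (simp, rule Ck_on_cd[OF assms(1) Ck_on_vec_nth[OF assms(1) Ck_on_vec_nth[OF assms]]])

text \<open>A holomorphic field \<open>v\<close> that is parallel for the Chern connection at \<open>q\<close> to first order:
  its derivative there is the negative connection form.\<close>

definition chern_field :: "(complex^'m \<Rightarrow> complex^'m^'m) \<Rightarrow> complex^'m \<Rightarrow> complex^'m \<Rightarrow> complex^'m^'m" where
  "chern_field H q v = (\<chi> \<mu> \<alpha>. - (\<Sum>\<nu>\<in>UNIV. matrix_inv (H q) $ \<nu> $ \<mu> *
     (\<Sum>\<gamma>\<in>UNIV. d_z \<alpha> (\<lambda>w. H w $ \<gamma> $ \<nu>) q * v $ \<gamma>)))"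

lemma chern_field_mult:
  assumes d: "\<And>\<gamma> \<nu>. (\<lambda>w. H w $ \<gamma> $ \<nu>) differentiable at q"
  shows "(chern_field H q v *v u) $ \<mu> = - (\<Sum>\<nu>\<in>UNIV. matrix_inv (H q) $ \<nu> $ \<mu> *
     (\<Sum>\<gamma>\<in>UNIV. cdm (wp u) (- wq u) H q $ \<gamma> $ \<nu> * v $ \<gamma>))"
proof -
  have "(chern_field H q v *v u) $ \<mu> = - (\<Sum>\<alpha>\<in>UNIV. \<Sum>\<nu>\<in>UNIV. \<Sum>\<gamma>\<in>UNIV.
      matrix_inv (H q) $ \<nu> $ \<mu> * (u $ \<alpha> * d_z \<alpha> (\<lambda>w. H w $ \<gamma> $ \<nu>) q * v $ \<gamma>))"
    by (simp add: chern_field_def matrix_vector_mult_def sum_distrib_left sum_distrib_right sum_negf mult_ac)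
  also have "\<dots> = - (\<Sum>\<nu>\<in>UNIV. \<Sum>\<gamma>\<in>UNIV. \<Sum>\<alpha>\<in>UNIV.
      matrix_inv (H q) $ \<nu> $ \<mu> * (u $ \<alpha> * d_z \<alpha> (\<lambda>w. H w $ \<gamma> $ \<nu>) q * v $ \<gamma>))"
    by (rule arg_cong[of _ _ uminus], rule sum_rotate3)
  finally show ?thesis
    by (simp add: cd_10 d sum_distrib_left sum_distrib_right)
qed

text \<open>The identity for which \<open>chern_field\<close> is built: the (1,0)-derivative of the
  field and that of the metric cancel when paired with any \<open>Y\<close>, so the Chern derivative
  of the field vanishes at \<open>q\<close>.\<close>

lemma bil_chern_field:
  assumes d: "\<And>\<gamma> \<nu>. (\<lambda>w. H w $ \<gamma> $ \<nu>) differentiable at q" and inv: "invertible (H q)"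
  shows "bil (H q) (chern_field H q v *v u) Y = - bil (cdm (wp u) (- wq u) H q) v Y"
proof -
  have I: "(\<Sum>\<mu>\<in>UNIV. matrix_inv (H q) $ \<nu> $ \<mu> * H q $ \<mu> $ \<delta>) = (if \<nu> = \<delta> then 1 else 0)" for \<nu> \<delta>
    using matrix_inv_works(2)[OF inv] by (simp add: matrix_matrix_mult_def mat_def vec_eq_iff)
  define c where "c \<nu> = (\<Sum>\<gamma>\<in>UNIV. cdm (wp u) (- wq u) H q $ \<gamma> $ \<nu> * v $ \<gamma>)" for \<nu>
  have "bil (H q) (chern_field H q v *v u) Y =
      - (\<Sum>\<mu>\<in>UNIV. \<Sum>\<delta>\<in>UNIV. \<Sum>\<nu>\<in>UNIV. (matrix_inv (H q) $ \<nu> $ \<mu> * H q $ \<mu> $ \<delta>) * (c \<nu> * Y $ \<delta>))"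
    unfolding bil_def chern_field_mult[OF d] c_def[symmetric]
    by (simp add: sum_distrib_left sum_distrib_right sum_negf mult_ac)
  also have "\<dots> = - (\<Sum>\<delta>\<in>UNIV. \<Sum>\<nu>\<in>UNIV. \<Sum>\<mu>\<in>UNIV. (matrix_inv (H q) $ \<nu> $ \<mu> * H q $ \<mu> $ \<delta>) * (c \<nu> * Y $ \<delta>))"
    by (rule arg_cong[of _ _ uminus], rule sum_rotate3)
  also have "\<dots> = - (\<Sum>\<delta>\<in>UNIV. \<Sum>\<nu>\<in>UNIV. if \<nu> = \<delta> then c \<nu> * Y $ \<delta> else 0)"
    by (rule arg_cong[of _ _ uminus], intro sum.cong refl) (simp add: I flip: sum_distrib_right)
  also have "\<dots> = - (\<Sum>\<delta>\<in>UNIV. c \<delta> * Y $ \<delta>)"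
    by simp
  also have "\<dots> = - bil (cdm (wp u) (- wq u) H q) v Y"
    by (subst bil_def, subst sum.swap) (simp add: c_def sum_distrib_right)
  finally show ?thesis .
qed

text \<open>In the quadratic part of the curvature the inverse metric times the (1,0)-derivative of
  the metric is the connection form, that is, minus \<open>chern_field\<close>. Substituting it
  removes the inverse matrix and leaves exactly the terms that appear in the Hessian of h(v,
  v).\<close>

lemma chern_curvature_eq:
  assumes S: "open S" "q \<in> S" and H: "\<And>\<gamma> \<nu>. Ck_on 2 (\<lambda>w. H w $ \<gamma> $ \<nu>) S"
  shows "chern_curvature H q u (cnj_vec u) v (cnj_vec v) =
    - bil (cdm (wp u) (- wq u) (cdm (wp u) (wq u) H) q) v (cnj_vec v)
    - bil (cdm (wp u) (wq u) H q) (chern_field H q v *v u) (cnj_vec v)"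
proof -
  have d: "(\<lambda>w. H w $ \<gamma> $ \<nu>) differentiable at q" for \<gamma> \<nu>
    by (rule Ck_on_differentiable[OF H _ S(2)]) simp
  let ?t = "\<lambda>\<alpha> \<beta> \<gamma> \<delta>. u $ \<alpha> * cnj (u $ \<beta>) * v $ \<gamma> * cnj (v $ \<delta>)"
  let ?I = "\<lambda>\<nu> \<mu>. matrix_inv (H q) $ \<nu> $ \<mu>"
  let ?h = "\<lambda>\<alpha> \<beta> \<gamma> \<delta>. d_z \<alpha> (d_zbar \<beta> (\<lambda>w. H w $ \<gamma> $ \<delta>)) q"
  let ?k = "\<lambda>\<alpha> \<beta> \<gamma> \<delta>. (\<Sum>\<mu>\<in>UNIV. \<Sum>\<nu>\<in>UNIV. ?I \<nu> \<mu> * d_z \<alpha> (\<lambda>w. H w $ \<gamma> $ \<nu>) q * d_zbar \<beta> (\<lambda>w. H w $ \<mu> $ \<delta>) q)"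
  have 1: "bil (cdm (wp u) (- wq u) (cdm (wp u) (wq u) H) q) v (cnj_vec v) =
      (\<Sum>\<alpha>\<in>UNIV. \<Sum>\<beta>\<in>UNIV. \<Sum>\<gamma>\<in>UNIV. \<Sum>\<delta>\<in>UNIV. ?h \<alpha> \<beta> \<gamma> \<delta> * ?t \<alpha> \<beta> \<gamma> \<delta>)"
  proof -
    have "bil (cdm (wp u) (- wq u) (cdm (wp u) (wq u) H) q) v (cnj_vec v) =
        (\<Sum>\<gamma>\<in>UNIV. \<Sum>\<delta>\<in>UNIV. \<Sum>\<alpha>\<in>UNIV. \<Sum>\<beta>\<in>UNIV. ?h \<alpha> \<beta> \<gamma> \<delta> * ?t \<alpha> \<beta> \<gamma> \<delta>)"
      unfolding bil_def cdm_cdm_nth cd_10_01[OF S H]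
      by (simp add: sum_distrib_left sum_distrib_right mult_ac)
    also have "\<dots> = (\<Sum>\<gamma>\<in>UNIV. \<Sum>\<alpha>\<in>UNIV. \<Sum>\<beta>\<in>UNIV. \<Sum>\<delta>\<in>UNIV. ?h \<alpha> \<beta> \<gamma> \<delta> * ?t \<alpha> \<beta> \<gamma> \<delta>)"
      by (rule sum.cong[OF refl], rule sum_rotate3)
    also have "\<dots> = (\<Sum>\<alpha>\<in>UNIV. \<Sum>\<beta>\<in>UNIV. \<Sum>\<gamma>\<in>UNIV. \<Sum>\<delta>\<in>UNIV. ?h \<alpha> \<beta> \<gamma> \<delta> * ?t \<alpha> \<beta> \<gamma> \<delta>)"
      by (rule sum_rotate3)
    finally show ?thesis .
  qed
  have 2: "- bil (cdm (wp u) (wq u) H q) (chern_field H q v *v u) (cnj_vec v) =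
      (\<Sum>\<alpha>\<in>UNIV. \<Sum>\<beta>\<in>UNIV. \<Sum>\<gamma>\<in>UNIV. \<Sum>\<delta>\<in>UNIV. ?k \<alpha> \<beta> \<gamma> \<delta> * ?t \<alpha> \<beta> \<gamma> \<delta>)"
  proof -
    let ?e = "\<lambda>\<mu> \<nu> \<alpha> \<beta> \<gamma> \<delta>. ?I \<nu> \<mu> * d_z \<alpha> (\<lambda>w. H w $ \<gamma> $ \<nu>) q * d_zbar \<beta> (\<lambda>w. H w $ \<mu> $ \<delta>) q * ?t \<alpha> \<beta> \<gamma> \<delta>"
    \<comment> \<open>\<open>S\<close> and \<open>T\<close> (here \<open>S\<close> no longer denotes
      the open set) seal the (1,0)- and (0,1)-derivatives of the metric while the outer sums are
      arranged; \<open>sum_product\<close> then opens both at once.\<close>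
    define S where "S \<gamma> \<nu> = (\<Sum>\<alpha>\<in>UNIV. u $ \<alpha> * d_z \<alpha> (\<lambda>w. H w $ \<gamma> $ \<nu>) q)" for \<gamma> \<nu>
    define T where "T \<mu> \<delta> = (\<Sum>\<beta>\<in>UNIV. cnj (u $ \<beta>) * d_zbar \<beta> (\<lambda>w. H w $ \<mu> $ \<delta>) q)" for \<mu> \<delta>
    have "- bil (cdm (wp u) (wq u) H q) (chern_field H q v *v u) (cnj_vec v) =
        (\<Sum>\<mu>\<in>UNIV. \<Sum>\<delta>\<in>UNIV. \<Sum>\<nu>\<in>UNIV. \<Sum>\<gamma>\<in>UNIV. ?I \<nu> \<mu> * v $ \<gamma> * cnj (v $ \<delta>) * (S \<gamma> \<nu> * T \<mu> \<delta>))"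
      unfolding bil_def chern_field_mult[OF d] cdm_nth cdv_nth cd_10[OF d] cd_01[OF d] S_def[symmetric] T_def[symmetric]
      by (simp add: sum_distrib_left sum_distrib_right sum_negf mult_ac)
    also have "\<dots> = (\<Sum>\<mu>\<in>UNIV. \<Sum>\<delta>\<in>UNIV. \<Sum>\<nu>\<in>UNIV. \<Sum>\<gamma>\<in>UNIV. \<Sum>\<alpha>\<in>UNIV. \<Sum>\<beta>\<in>UNIV. ?e \<mu> \<nu> \<alpha> \<beta> \<gamma> \<delta>)"
      unfolding S_def T_def sum_product by (simp add: sum_distrib_left mult_ac)
    also have "\<dots> = (\<Sum>\<mu>\<in>UNIV. \<Sum>\<delta>\<in>UNIV. \<Sum>\<nu>\<in>UNIV. \<Sum>\<alpha>\<in>UNIV. \<Sum>\<beta>\<in>UNIV. \<Sum>\<gamma>\<in>UNIV. ?e \<mu> \<nu> \<alpha> \<beta> \<gamma> \<delta>)"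
      by (rule sum.cong[OF refl], rule sum.cong[OF refl], rule sum.cong[OF refl], rule sum_rotate3)
    also have "\<dots> = (\<Sum>\<mu>\<in>UNIV. \<Sum>\<delta>\<in>UNIV. \<Sum>\<alpha>\<in>UNIV. \<Sum>\<beta>\<in>UNIV. \<Sum>\<nu>\<in>UNIV. \<Sum>\<gamma>\<in>UNIV. ?e \<mu> \<nu> \<alpha> \<beta> \<gamma> \<delta>)"
      by (rule sum.cong[OF refl], rule sum.cong[OF refl], rule sum_rotate3)
    also have "\<dots> = (\<Sum>\<mu>\<in>UNIV. \<Sum>\<alpha>\<in>UNIV. \<Sum>\<beta>\<in>UNIV. \<Sum>\<delta>\<in>UNIV. \<Sum>\<nu>\<in>UNIV. \<Sum>\<gamma>\<in>UNIV. ?e \<mu> \<nu> \<alpha> \<beta> \<gamma> \<delta>)"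
      by (rule sum.cong[OF refl], rule sum_rotate3)
    also have "\<dots> = (\<Sum>\<alpha>\<in>UNIV. \<Sum>\<beta>\<in>UNIV. \<Sum>\<mu>\<in>UNIV. \<Sum>\<delta>\<in>UNIV. \<Sum>\<nu>\<in>UNIV. \<Sum>\<gamma>\<in>UNIV. ?e \<mu> \<nu> \<alpha> \<beta> \<gamma> \<delta>)"
      by (rule sum_rotate3)
    also have "\<dots> = (\<Sum>\<alpha>\<in>UNIV. \<Sum>\<beta>\<in>UNIV. \<Sum>\<gamma>\<in>UNIV. \<Sum>\<delta>\<in>UNIV. \<Sum>\<mu>\<in>UNIV. \<Sum>\<nu>\<in>UNIV. ?e \<mu> \<nu> \<alpha> \<beta> \<gamma> \<delta>)"
    proof (rule sum.cong[OF refl], rule sum.cong[OF refl])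
      fix \<alpha> \<beta>
      have "(\<Sum>\<mu>\<in>UNIV. \<Sum>\<delta>\<in>UNIV. \<Sum>\<nu>\<in>UNIV. \<Sum>\<gamma>\<in>UNIV. ?e \<mu> \<nu> \<alpha> \<beta> \<gamma> \<delta>) =
          (\<Sum>\<mu>\<in>UNIV. \<Sum>\<delta>\<in>UNIV. \<Sum>\<gamma>\<in>UNIV. \<Sum>\<nu>\<in>UNIV. ?e \<mu> \<nu> \<alpha> \<beta> \<gamma> \<delta>)"
        by (rule sum.cong[OF refl], rule sum.cong[OF refl], rule sum.swap)
      also have "\<dots> = (\<Sum>\<delta>\<in>UNIV. \<Sum>\<gamma>\<in>UNIV. \<Sum>\<mu>\<in>UNIV. \<Sum>\<nu>\<in>UNIV. ?e \<mu> \<nu> \<alpha> \<beta> \<gamma> \<delta>)"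
        by (rule sum_rotate3)
      also have "\<dots> = (\<Sum>\<gamma>\<in>UNIV. \<Sum>\<delta>\<in>UNIV. \<Sum>\<mu>\<in>UNIV. \<Sum>\<nu>\<in>UNIV. ?e \<mu> \<nu> \<alpha> \<beta> \<gamma> \<delta>)"
        by (rule sum.swap)
      finally show "(\<Sum>\<mu>\<in>UNIV. \<Sum>\<delta>\<in>UNIV. \<Sum>\<nu>\<in>UNIV. \<Sum>\<gamma>\<in>UNIV. ?e \<mu> \<nu> \<alpha> \<beta> \<gamma> \<delta>) =
          (\<Sum>\<gamma>\<in>UNIV. \<Sum>\<delta>\<in>UNIV. \<Sum>\<mu>\<in>UNIV. \<Sum>\<nu>\<in>UNIV. ?e \<mu> \<nu> \<alpha> \<beta> \<gamma> \<delta>)" .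
    qed
    finally show ?thesis by (simp only: sum_distrib_right)
  qed
  show ?thesis
    unfolding 1 diff_conv_add_uminus[of "- _"] 2
    by (simp add: chern_curvature_def chern_coeff_def left_diff_distrib mult.assoc sum_subtractf)
qed

text \<open>The field is affine with complex linear part, so its (1,0)-derivative \<open>a\<close>
  is constant and its (0,1)-derivative is zero. The inner (0,1)-derivative thus sees only the metric
  and the conjugated slot.\<close>

lemma hessian_norm_chern_field:
  fixes H :: "complex^'m \<Rightarrow> complex^'m^'m" and v0 :: "complex^'m"
  assumes S: "open S" "q \<in> S" and H: "Ck_on 3 H S" and inv: "invertible (H q)"
  defines "v \<equiv> \<lambda>z. v0 + chern_field H q v0 *v (z - q)"
  shows "cd (wp u) (- wq u) (cd (wp u) (wq u) (\<lambda>z. bil (H z) (v z) (cnj_vec (v z)))) q =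
    - chern_curvature H q u (cnj_vec u) v0 (cnj_vec v0)"
proof -
  define a where "a = chern_field H q v0 *v u"
  have H2: "Ck_on 2 H S" by (rule Ck_on_le[OF H]) simp
  have dH: "H differentiable at z" if "z \<in> S" for z
    by (rule Ck_on_differentiable[OF H _ that]) simp
  have H2': "Ck_on 2 (\<lambda>w. H w $ \<gamma> $ \<nu>) S" for \<gamma> \<nu>
    by (intro Ck_on_vec_nth S H2)
  have "Ck_on 1 (cdm (wp u) (wq u) H) S"
    using Ck_on_cdm[OF S(1), of 1 H] H2 by (simp add: numeral_2_eq_2 del: Ck_on.simps)
  then have dEH: "cdm (wp u) (wq u) H differentiable at q"
    by (rule Ck_on_differentiable[OF _ _ S(2)]) simp
  have dv: "v differentiable at z" for z
    unfolding v_def differentiable_def using has_derivative_affine by blast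
  have Dv: "cdv (wp u) (- wq u) v z = a" "cdv (wp u) (wq u) v z = 0" for z
    unfolding v_def a_def by (rule cdv_affine)+
  have Dcv: "cdv (wp u) (- wq u) (\<lambda>z. cnj_vec (v z)) z = 0" "cdv (wp u) (wq u) (\<lambda>z. cnj_vec (v z)) z = cnj_vec a" for z
    by (simp_all add: cdv_cnj[OF dv] Dv)
  have vq: "v q = v0"
    by (simp add: v_def)
  have E: "cd (wp u) (wq u) (\<lambda>z. bil (H z) (v z) (cnj_vec (v z))) z =
      bil (cdm (wp u) (wq u) H z) (v z) (cnj_vec (v z)) + bil (H z) (v z) (cnj_vec a)" if "z \<in> S" for z
    by (simp add: cd_bil[OF dH[OF that] dv differentiable_cnj_vec[OF dv]] Dv Dcv)
  have "cd (wp u) (- wq u) (cd (wp u) (wq u) (\<lambda>z. bil (H z) (v z) (cnj_vec (v z)))) q =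
      cd (wp u) (- wq u) (\<lambda>z. bil (cdm (wp u) (wq u) H z) (v z) (cnj_vec (v z)) + bil (H z) (v z) (cnj_vec a)) q"
    by (rule cd_cong[OF S]) (rule E)
  also have "\<dots> = bil (cdm (wp u) (- wq u) (cdm (wp u) (wq u) H) q) v0 (cnj_vec v0)
      + bil (cdm (wp u) (wq u) H q) a (cnj_vec v0) + (bil (cdm (wp u) (- wq u) H q) v0 (cnj_vec a) + bil (H q) a (cnj_vec a))"
    by (simp add: cd_add differentiable_bil dEH dH[OF S(2)] dv differentiable_cnj_vec cd_bil Dv Dcv vq)
  \<comment> \<open>The bracketed last two terms cancel by \<open>bil_chern_field\<close> with the
    conjugate of \<open>a\<close> in the second slot; together they would be the pairing of the
    Chern derivative of \<open>v\<close> with that conjugate. The first two are minus the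
    curvature.\<close>
  also have "\<dots> = - chern_curvature H q u (cnj_vec u) v0 (cnj_vec v0)"
    unfolding chern_curvature_eq[OF S H2'] a_def
    by (subst bil_chern_field) (simp_all add: inv differentiable_vec_nth dH S)
  finally show ?thesis .
qed

section \<open>Pluri-harmonic maps between coordinate domains\<close>

locale local_pluriharmonic =
  fixes U :: "(complex^'m) set" and F :: "complex^'m \<Rightarrow> real^'n"
    and V :: "(real^'n) set" and G :: "real^'n \<Rightarrow> real^'n^'n"
  assumes open_U: "open U" and open_V: "open V" and maps: "F ` U \<subseteq> V"
    and smooth_F: "smooth_on F U" and smooth_G: "smooth_on G V"
    and symmetric_G: "\<And>y. y \<in> V \<Longrightarrow> transpose (G y) = G y"
    and positive_G: "\<And>y v. y \<in> V \<Longrightarrow> v \<noteq> 0 \<Longrightarrow> v \<bullet> (G y *v v) > 0"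
    and pluriharmonic: "\<And>z \<alpha> \<beta> i. z \<in> U \<Longrightarrow>
      d_z \<alpha> (d_zbar \<beta> (\<lambda>w. complex_of_real (F w $ i))) z
      + (\<Sum>j\<in>UNIV. \<Sum>k\<in>UNIV. of_real (christoffel G i j k (F z))
          * d_zbar \<beta> (\<lambda>w. complex_of_real (F w $ j)) z * d_z \<alpha> (\<lambda>w. complex_of_real (F w $ k)) z) = 0"
begin

lemma Ck_F: "Ck_on k F U"
  using smooth_F by (simp add: smooth_on_def)

lemma differentiable_F: "z \<in> U \<Longrightarrow> F differentiable at z"
  by (rule Ck_on_differentiable[OF Ck_F[of 1]]) simp

lemma F_in_V: "z \<in> U \<Longrightarrow> F z \<in> V"
  using maps by auto

lemma Ck_FC: "Ck_on k (FC F) U"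
  by (rule Ck_on_FC[OF open_U Ck_F])

lemma invertible_G: "y \<in> V \<Longrightarrow> invertible (G y)"
  by (rule invertible_positive_definite) (rule positive_G)

lemma Ck_G: "Ck_on k G V"
  using smooth_G by (simp add: smooth_on_def)

lemma christoffel_diff: "y \<in> V \<Longrightarrow> christoffel G i j k differentiable at y"
  by (rule christoffel_differentiable[OF open_V _ Ck_G invertible_G])

definition dF :: "complex^'m \<Rightarrow> complex^'m \<Rightarrow> complex^'n" where
  "dF z v = cdv (wp v) (- wq v) (FC F) z"

lemma dF_eq_sum:
  assumes "z \<in> U"
  shows "dF z v = (\<Sum>\<gamma>\<in>UNIV. v $ \<gamma> *s dF z (axis \<gamma> 1))"
  using differentiable_of_real[OF differentiable_vec_nth[OF differentiable_F[OF assms]]]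
  by (simp add: dF_def vec_eq_iff cd_10_axis) (simp add: cd_10)

text \<open>The pluri-harmonic equation contracted with \<open>u\<close> in the holomorphic index
  and with the conjugate of \<open>w\<close> in the antiholomorphic one; the rest is a rearrangement
  of finite sums.\<close>

lemma cdv_10_01:
  assumes z: "z \<in> U"
  shows "cdv (wp u) (- wq u) (cdv (wp w) (wq w) (FC F)) z
    = - Gam G (F z) (cdv (wp w) (wq w) (FC F) z) (cdv (wp u) (- wq u) (FC F) z)"
proof -
  have C: "Ck_on 2 (\<lambda>z. complex_of_real (F z $ i)) U" for i
    by (intro Ck_on_of_real Ck_on_vec_nth open_U Ck_F)
  have d: "(\<lambda>z. complex_of_real (F z $ i)) differentiable at z" for i
    by (rule Ck_on_differentiable[OF C _ z]) simp
  let ?c = "\<lambda>i j k. complex_of_real (christoffel G i j k (F z))"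
  let ?b = "\<lambda>\<beta> j. d_zbar \<beta> (\<lambda>w. complex_of_real (F w $ j)) z"
  let ?a = "\<lambda>\<alpha> j. d_z \<alpha> (\<lambda>w. complex_of_real (F w $ j)) z"
  have "bil (chr G (F z) i) (cdv (wp w) (wq w) (FC F) z) (cdv (wp u) (- wq u) (FC F) z) =
      (\<Sum>\<alpha>\<in>UNIV. \<Sum>\<beta>\<in>UNIV. u $ \<alpha> * cnj (w $ \<beta>) * (\<Sum>j\<in>UNIV. \<Sum>k\<in>UNIV. ?c i j k * ?b \<beta> j * ?a \<alpha> k))" for i
  proof -
    have "bil (chr G (F z) i) (cdv (wp w) (wq w) (FC F) z) (cdv (wp u) (- wq u) (FC F) z) =
        (\<Sum>j\<in>UNIV. \<Sum>k\<in>UNIV. \<Sum>\<alpha>\<in>UNIV. \<Sum>\<beta>\<in>UNIV. u $ \<alpha> * cnj (w $ \<beta>) * (?c i j k * ?b \<beta> j * ?a \<alpha> k))"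
    proof -
      have "?c i j k * (\<Sum>\<beta>\<in>UNIV. cnj (w $ \<beta>) * ?b \<beta> j) * (\<Sum>\<alpha>\<in>UNIV. u $ \<alpha> * ?a \<alpha> k) =
          ?c i j k * ((\<Sum>\<alpha>\<in>UNIV. u $ \<alpha> * ?a \<alpha> k) * (\<Sum>\<beta>\<in>UNIV. cnj (w $ \<beta>) * ?b \<beta> j))" for j k
        by (simp only: mult_ac)
      also have "\<dots> j k = (\<Sum>\<alpha>\<in>UNIV. \<Sum>\<beta>\<in>UNIV. u $ \<alpha> * cnj (w $ \<beta>) * (?c i j k * ?b \<beta> j * ?a \<alpha> k))" for j k
        by (subst sum_product) (simp add: sum_distrib_left mult_ac)
      finally show ?thesis
        by (simp add: bil_def cd_10 cd_01 d)
    qed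
    also have "\<dots> = (\<Sum>j\<in>UNIV. \<Sum>\<alpha>\<in>UNIV. \<Sum>\<beta>\<in>UNIV. \<Sum>k\<in>UNIV. u $ \<alpha> * cnj (w $ \<beta>) * (?c i j k * ?b \<beta> j * ?a \<alpha> k))"
      by (rule sum.cong[OF refl], rule sum_rotate3)
    also have "\<dots> = (\<Sum>\<alpha>\<in>UNIV. \<Sum>\<beta>\<in>UNIV. \<Sum>j\<in>UNIV. \<Sum>k\<in>UNIV. u $ \<alpha> * cnj (w $ \<beta>) * (?c i j k * ?b \<beta> j * ?a \<alpha> k))"
      by (rule sum_rotate3)
    finally show ?thesis by (simp only: sum_distrib_left)
  qed
  note Gam = this
  have "cdv (wp u) (- wq u) (cdv (wp w) (wq w) (FC F)) z $ i +
      bil (chr G (F z) i) (cdv (wp w) (wq w) (FC F) z) (cdv (wp u) (- wq u) (FC F) z) =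
      (\<Sum>\<alpha>\<in>UNIV. \<Sum>\<beta>\<in>UNIV. u $ \<alpha> * cnj (w $ \<beta>) *
        (d_z \<alpha> (d_zbar \<beta> (\<lambda>w. complex_of_real (F w $ i))) z + (\<Sum>j\<in>UNIV. \<Sum>k\<in>UNIV. ?c i j k * ?b \<beta> j * ?a \<alpha> k)))" for i
    unfolding Gam by (simp add: cd_10_01[OF open_U z C] distrib_left sum.distrib)
  then show ?thesis
    by (simp add: vec_eq_iff pluriharmonic[OF z] eq_neg_iff_add_eq_0)
qed

text \<open>The coordinate equation has the (0,1)-derivative in the first slot of the Christoffel
  symbol, the connection has the direction there; symmetry of the symbol reconciles them. The
  conclusion holds at every point of \<open>U\<close>, so it may be differentiated.\<close>

lemma nab_10_01:
  assumes "z \<in> U"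
  shows "nab G F (wp u) (- wq u) (cdv (wp w) (wq w) (FC F)) z = 0"
  by (simp add: nab_def cdv_10_01[OF assms]
      Gam_commute[where G = G and X = "cdv (wp u) (- wq u) (FC F) z", OF open_V F_in_V[OF assms] symmetric_G])

text \<open>\<open>push v\<close> is the image of the vector field \<open>v\<close> under \<open>dF\<close>; the sum is the form of \<open>dF z (v z)\<close>
  to which the product rule applies.\<close>

definition push :: "(complex^'m \<Rightarrow> complex^'m) \<Rightarrow> complex^'m \<Rightarrow> complex^'n" where
  "push v z = (\<Sum>\<gamma>\<in>UNIV. v z $ \<gamma> *s cdv (wp (axis \<gamma> 1)) (- wq (axis \<gamma> 1)) (FC F) z)"

lemma push_eq_dF: "z \<in> U \<Longrightarrow> push v z = dF z (v z)"
  unfolding dF_eq_sum[of z "v z"] by (simp add: push_def dF_def)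

lemma Ck_push: "Ck_on k v U \<Longrightarrow> Ck_on k (push v) U"
  unfolding push_def[abs_def]
  by (intro Ck_on_sum Ck_on_scale Ck_on_cdv Ck_FC Ck_on_vec_nth open_U)

text \<open>The coefficients of the field have zero derivative in this direction at
  \<open>z\<close>, so only the coordinate vectors are differentiated. Interchanging the two
  derivatives of \<open>F\<close> turns each of these terms into one governed by the pluri-harmonic
  equation.\<close>

lemma nab_01_push:
  assumes z: "z \<in> U" and v: "v differentiable at z" "cdv (wp u) (wq u) v z = 0"
  shows "nab G F (wp u) (wq u) (push v) z = 0"
proof -
  have v0: "cd (wp u) (wq u) (\<lambda>z. v z $ i) z = 0" for i
    using v(2) by (simp add: vec_eq_iff)
  have "cdv (wp u) (wq u) (push v) z =
      (\<Sum>\<gamma>\<in>UNIV. v z $ \<gamma> *s cdv (wp u) (wq u) (cdv (wp (axis \<gamma> 1)) (- wq (axis \<gamma> 1)) (FC F)) z)"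
    unfolding push_def[abs_def]
    by (subst cdv_sum_scale) (auto simp: v0 intro!: differentiable_vec_nth v differentiable_cdv[OF open_U z Ck_FC])
  also have "\<dots> = (\<Sum>\<gamma>\<in>UNIV. v z $ \<gamma> *s - Gam G (F z) (cdv (wp u) (wq u) (FC F) z) (cdv (wp (axis \<gamma> 1)) (- wq (axis \<gamma> 1)) (FC F) z))"
    by (subst cdv_commute[OF open_U z Ck_FC]) (simp only: cdv_10_01[OF z])
  also have "\<dots> = - Gam G (F z) (cdv (wp u) (wq u) (FC F) z) (push v z)"
    by (simp add: push_def Gam_sum_right Gam_scale_right sum_negf)
  finally show ?thesis by (simp add: nab_def)
qed

lemma cdv_01_eq_cnj: "z \<in> U \<Longrightarrow> cdv (wp u) (wq u) (FC F) z = cnj_vec (dF z u)"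
  unfolding dF_def by (rule cdv_FC_cnj[OF differentiable_F, symmetric])

lemma nab_cong:
  assumes "z \<in> U" "\<And>y. y \<in> U \<Longrightarrow> X y = Y y"
  shows "nab G F p q X z = nab G F p q Y z"
  using cdv_cong[OF open_U assms(1), of X Y] assms by (simp add: nab_def)

lemma nab_zero [simp]: "nab G F p q (\<lambda>z. 0) z = 0"
  by (simp add: nab_def)

lemma differentiable_nab:
  assumes "Ck_on 2 W U" "z \<in> U"
  shows "nab G F p q W differentiable at z"
  unfolding nab_def[abs_def]
  by (intro differentiable_add differentiable_cdv[OF open_U assms(2)] assms differentiable_Gam differentiable_F
      christoffel_diff F_in_V Ck_FC Ck_on_differentiable[OF assms(1)]) simp_all

text \<open>The field of (0,1)-derivatives of \<open>F\<close> is parallel in all (1,0)-directions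
  on the whole of \<open>U\<close>, so both iterated derivatives in the commutator vanish, and their
  difference is this curvature term.\<close>

lemma Rop_10_10_01:
  assumes "z \<in> U"
  shows "Rop G (F z) (dF z u) (dF z v) (cnj_vec (dF z w)) = 0"
proof -
  have "nab G F (wp u) (- wq u) (nab G F (wp v) (- wq v) (cdv (wp w) (wq w) (FC F))) z
      - nab G F (wp v) (- wq v) (nab G F (wp u) (- wq u) (cdv (wp w) (wq w) (FC F))) z = 0"
    using nab_cong[OF assms nab_10_01] by simp
  moreover have "Ck_on 2 (cdv (wp w) (wq w) (FC F)) U"
    by (intro Ck_on_cdv open_U Ck_FC)
  ultimately show ?thesis
    using nab_commutator[OF open_U assms Ck_F _ christoffel_diff[OF F_in_V[OF assms]]]
    by (simp add: dF_def cdv_FC_cnj[OF differentiable_F[OF assms]])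
qed

text \<open>The (1,0)-derivative is taken first: with W = \<open>push v\<close>, its derivative of
  the conjugate of W is the conjugate of the vanishing (0,1)-derivative, so a single term remains on
  all of \<open>U\<close>. The outer (0,1)-derivative then yields a curvature term and the square of
  nabla_u W.\<close>

lemma nonneg_hessian:
  assumes q: "q \<in> U" and v: "Ck_on 3 v U" "\<And>z. z \<in> U \<Longrightarrow> cdv (wp u) (wq u) v z = 0"
    and curv: "\<And>Z W. Re (complex_riemann G (F q) Z (cnj_vec W) W (cnj_vec Z)) \<le> 0"
  shows "Re (cd (wp u) (wq u) (cd (wp u) (- wq u)
    (\<lambda>z. bil (gc G (F z)) (push v z) (cnj_vec (push v z)))) q) \<ge> 0"
proof -
  let ?W = "push v"
  let ?D = "nab G F (wp u) (- wq u)" and ?E = "nab G F (wp u) (wq u)"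
  have v': "v differentiable at z" if "z \<in> U" for z
    by (rule Ck_on_differentiable[OF v(1) _ that]) simp
  have W: "Ck_on 2 ?W U"
    by (rule Ck_push, rule Ck_on_le[OF v(1)]) simp
  have dW: "?W differentiable at z" if "z \<in> U" for z
    by (rule Ck_on_differentiable[OF W _ that]) simp
  have G: "(\<lambda>y. G y $ i $ j) differentiable at (F z)" if "z \<in> U" for i j z
    by (intro differentiable_vec_nth Ck_on_differentiable[OF Ck_G[of 1]] F_in_V that) simp
  have EW: "?E ?W z = 0" if "z \<in> U" for z
    by (rule nab_01_push[OF that v'[OF that] v(2)[OF that]])
  have metric: "cd p r (\<lambda>z. bil (gc G (F z)) (X z) (Y z)) z =
      bil (gc G (F z)) (nab G F p r X z) (Y z) + bil (gc G (F z)) (X z) (nab G F p r Y z)"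
    if "z \<in> U" "X differentiable at z" "Y differentiable at z" for p r X Y z
    by (rule cd_metric[OF differentiable_F[OF that(1)] G[OF that(1)] that(2,3) open_V F_in_V[OF that(1)]
        symmetric_G invertible_G[OF F_in_V[OF that(1)]]])
  have 1: "cd (wp u) (- wq u) (\<lambda>z. bil (gc G (F z)) (?W z) (cnj_vec (?W z))) z =
      bil (gc G (F z)) (?D ?W z) (cnj_vec (?W z))" if "z \<in> U" for z
    using EW[OF that]
    by (simp add: metric[OF that dW[OF that] differentiable_cnj_vec[OF dW[OF that]]] nab_cnj[OF differentiable_F[OF that] dW[OF that]])
  \<comment> \<open>Because \<open>EW\<close> holds throughout \<open>U\<close>, the
    (1,0)-derivative of \<open>?E ?W\<close> is zero as well, and the commutator reduces to this one
    term.\<close>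
  have ED: "?E (?D ?W) q = Rop G (F q) (cnj_vec (dF q u)) (dF q u) (?W q)"
    using nab_commutator[OF open_U q Ck_F W christoffel_diff[OF F_in_V[OF q]], of "wp u" "wq u" "wp u" "- wq u"]
      nab_cong[OF q EW, where p = "wp u" and q = "- wq u"]
    by (simp add: cdv_01_eq_cnj[OF q] dF_def[symmetric])
  have "cd (wp u) (wq u) (cd (wp u) (- wq u) (\<lambda>z. bil (gc G (F z)) (?W z) (cnj_vec (?W z)))) q =
      cd (wp u) (wq u) (\<lambda>z. bil (gc G (F z)) (?D ?W z) (cnj_vec (?W z))) q"
    by (rule cd_cong[OF open_U q]) (rule 1)
  also have "\<dots> = bil (gc G (F q)) (?E (?D ?W) q) (cnj_vec (?W q)) + bil (gc G (F q)) (?D ?W q) (cnj_vec (?D ?W q))"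
    by (simp add: metric[OF q differentiable_nab[OF W q] differentiable_cnj_vec[OF dW[OF q]]] nab_cnj[OF differentiable_F[OF q] dW[OF q]])
  finally have eq: "cd (wp u) (wq u) (cd (wp u) (- wq u) (\<lambda>z. bil (gc G (F z)) (?W z) (cnj_vec (?W z)))) q =
      bil (gc G (F q)) (?E (?D ?W) q) (cnj_vec (?W q)) + bil (gc G (F q)) (?D ?W q) (cnj_vec (?D ?W q))" .
  have "Rop G (F q) (dF q u) (?W q) (cnj_vec (dF q u)) = 0"
    unfolding push_eq_dF[OF q] by (rule Rop_10_10_01[OF q])
  then have "Rop G (F q) (cnj_vec (dF q u)) (dF q u) (?W q) = - Rop G (F q) (?W q) (cnj_vec (dF q u)) (dF q u)"
    using bianchi[where G = G and X = "cnj_vec (dF q u)" and Y = "dF q u" and Z = "?W q", OF open_V F_in_V[OF q] symmetric_G]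
    by (simp add: eq_neg_iff_add_eq_0)
  then have "bil (gc G (F q)) (?E (?D ?W) q) (cnj_vec (?W q)) =
      - complex_riemann G (F q) (?W q) (cnj_vec (dF q u)) (dF q u) (cnj_vec (?W q))"
    by (simp add: ED bil_minus_left complex_riemann_Rop[OF christoffel_diff[OF F_in_V[OF q]] symmetric_G[OF F_in_V[OF q]]])
  moreover have "x \<bullet> (G (F q) *v x) \<ge> 0" for x
    using positive_G[OF F_in_V[OF q], of x] by (cases "x = 0") (auto simp: less_imp_le)
  then have "Re (bil (gc G (F q)) (?D ?W q) (cnj_vec (?D ?W q))) \<ge> 0"
    unfolding Re_bil_cnj by (intro add_nonneg_nonneg)
  ultimately show ?thesis
    unfolding eq using curv[of "?W q" "dF q u"] by simp
qed

lemma Ck_gc: "Ck_on k (\<lambda>z. gc G (F z)) U"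
proof -
  have "Ck_on k (\<lambda>z. G (F z) $ i $ j) U" for i j
    by (rule Ck_on_vec_nth[OF open_U Ck_on_vec_nth[OF open_U Ck_on_compose[OF open_U open_V maps Ck_F Ck_G]]])
  then show ?thesis
    by (intro Ck_on_vec open_U) (simp add: Ck_on_of_real open_U)
qed

text \<open>\<open>c\<close> is the maximal ratio. The bound is needed only along the field
  \<open>v\<close>, where \<open>\<phi> + k * \<psi>\<close> has nonpositive real part on
  \<open>U\<close> and real part zero at \<open>q\<close>. The factor \<open>k\<close> is complex so
  that the calculus of \<open>cd\<close> applies.\<close>

lemma no_positive_maximum:
  assumes q: "q \<in> U" and H: "smooth_on H U"
    and pos: "\<And>v. v \<noteq> 0 \<Longrightarrow> Re (hermitian_form (H q) v v) > 0"
    and RC: "\<And>v. v \<noteq> 0 \<Longrightarrow> Re (chern_curvature H q u (cnj_vec u) v (cnj_vec v)) > 0"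
    and curv: "\<And>Z W. Re (complex_riemann G (F q) Z (cnj_vec W) W (cnj_vec Z)) \<le> 0"
    and v0: "v0 \<noteq> 0" and "c > 0"
    and eq: "Re (bil (gc G (F q)) (dF q v0) (cnj_vec (dF q v0))) = c * Re (hermitian_form (H q) v0 v0)"
    and le: "\<And>z v. z \<in> U \<Longrightarrow> Re (bil (gc G (F z)) (dF z v) (cnj_vec (dF z v))) \<le> c * Re (hermitian_form (H z) v v)"
  shows False
proof -
  define v where "v z = v0 + chern_field H q v0 *v (z - q)" for z
  define \<phi> where "\<phi> z = bil (gc G (F z)) (push v z) (cnj_vec (push v z))" for z
  define \<psi> where "\<psi> z = bil (H z) (v z) (cnj_vec (v z))" for z
  define k where "k = - complex_of_real c"
  have CH: "Ck_on n H U" for n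
    using H by (simp add: smooth_on_def)
  have Cv: "Ck_on n v U" for n
    unfolding v_def[abs_def] by (rule Ck_on_affine[OF open_U])
  have cnj: "Ck_on n (\<lambda>z. cnj_vec (X z)) U" if "Ck_on n X U" for n and X :: "complex^'m \<Rightarrow> complex^'k"
    by (rule Ck_on_bounded_linear[OF open_U bounded_linear_cnj_vec that])
  have C\<phi>: "Ck_on n \<phi> U" for n
    unfolding \<phi>_def[abs_def] by (intro Ck_on_bil open_U Ck_gc Ck_push cnj Cv)
  have C\<psi>: "Ck_on n \<psi> U" for n
    unfolding \<psi>_def[abs_def] by (intro Ck_on_bil open_U CH cnj Cv)
  have C\<theta>: "Ck_on n (\<lambda>z. \<phi> z + k * \<psi> z) U" for n
    by (intro Ck_on_add open_U C\<phi> Ck_on_bounded_linear[OF open_U bounded_linear_mult_right] C\<psi>)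
  have vq: "v q = v0" by (simp add: v_def)
  have "Re (\<phi> z + k * \<psi> z) \<le> 0" if "z \<in> U" for z
    using le[OF that, of "v z"] by (simp add: k_def \<phi>_def \<psi>_def push_eq_dF[OF that] hermitian_form_eq_bil)
  moreover have "Re (\<phi> q + k * \<psi> q) = 0"
    using eq by (simp add: k_def \<phi>_def \<psi>_def push_eq_dF[OF q] vq hermitian_form_eq_bil)
  ultimately have 1: "Re (cd (wp u) (wq u) (cd (wp u) (- wq u) (\<lambda>z. \<phi> z + k * \<psi> z)) q) \<le> 0"
    using cd_cd_at_max_nonpos[OF open_U q C\<theta>, of "wp u" "wq u"] by simp
  have d: "f differentiable at z" if "\<And>k. Ck_on k f U" "z \<in> U" for f :: "complex^'m \<Rightarrow> complex" and z
    using Ck_on_differentiable[OF that(1)[of 1] _ that(2)] by simp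
  have Cd: "Ck_on n (cd p r f) U" if "\<And>n. Ck_on n f U" for f p r n
    by (rule Ck_on_cd[OF open_U that])
  have "cd (wp u) (wq u) (cd (wp u) (- wq u) (\<lambda>z. \<phi> z + k * \<psi> z)) q =
      cd (wp u) (wq u) (\<lambda>z. cd (wp u) (- wq u) \<phi> z + k * cd (wp u) (- wq u) \<psi> z) q"
    by (rule cd_cong[OF open_U q], subst cd_add) (simp_all add: d C\<phi> C\<psi> cd_mult)
  also have "\<dots> = cd (wp u) (wq u) (cd (wp u) (- wq u) \<phi>) q + k * cd (wp u) (wq u) (cd (wp u) (- wq u) \<psi>) q"
    by (subst cd_add) (simp_all add: d[OF Cd q] C\<phi> C\<psi> cd_mult)
  \<comment> \<open>The two estimates prescribe opposite orders: \<open>nonneg_hessian\<close> has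
    the (0,1)-derivative outside, the Chern curvature has the (1,0)-derivative outside.
    \<open>cd_commute\<close> reconciles them.\<close>
  also have "cd (wp u) (wq u) (cd (wp u) (- wq u) \<psi>) q = - chern_curvature H q u (cnj_vec u) v0 (cnj_vec v0)"
    unfolding cd_commute[OF open_U q C\<psi>, of "wp u" "wq u"]
    using hessian_norm_chern_field[OF open_U q CH invertible_hermitian[of "H q", OF pos]]
    by (simp add: \<psi>_def[abs_def] v_def[abs_def])
  finally have "Re (cd (wp u) (wq u) (cd (wp u) (- wq u) \<phi>) q) + c * Re (chern_curvature H q u (cnj_vec u) v0 (cnj_vec v0)) \<le> 0"
    using 1 by (simp add: k_def)
  moreover have "Re (cd (wp u) (wq u) (cd (wp u) (- wq u) \<phi>) q) \<ge> 0"
    unfolding \<phi>_def[abs_def]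
    by (rule nonneg_hessian[OF q Cv _ curv]) (unfold v_def[abs_def], rule cdv_affine)
  moreover have "c * Re (chern_curvature H q u (cnj_vec u) v0 (cnj_vec v0)) > 0"
    using RC[OF v0] \<open>c > 0\<close> by simp
  ultimately show False by linarith
qed

end

section \<open>Passage to charts\<close>

context
  fixes X :: "'a topology" and A :: "('a, 'e::euclidean_space) chart set" and c
  assumes atlas: "topological_atlas X A" and c: "c \<in> A"
begin

lemma chart_homeomorphic: "homeomorphic_map (subtopology X (fst c)) (top_of_set (coord_dom c)) (snd c)"
  and chart_openin: "openin X (fst c)"
  and chart_open: "open (coord_dom c)"
  using atlas c by (auto simp: topological_atlas_def)

lemma chart_subset: "fst c \<subseteq> topspace X"
  by (rule openin_subset[OF chart_openin])

lemma chart_inj: "inj_on (snd c) (fst c)"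
  using homeomorphic_imp_injective_map[OF chart_homeomorphic] chart_subset
  by (simp add: inf_absorb2)

lemma param_chart: "x \<in> fst c \<Longrightarrow> param c (snd c x) = x"
  by (simp add: param_def chart_inj)

lemma chart_param: "z \<in> coord_dom c \<Longrightarrow> snd c (param c z) = z"
  and param_in_chart: "z \<in> coord_dom c \<Longrightarrow> param c z \<in> fst c"
  by (auto simp: param_def coord_dom_def f_inv_into_f inv_into_into)

lemma chart_image_open:
  assumes "openin X S"
  shows "open (snd c ` (fst c \<inter> S))"
proof -
  have "openin (subtopology X (fst c)) (fst c \<inter> S)"
    using assms by (auto simp: openin_subtopology)
  then have "openin (top_of_set (coord_dom c)) (snd c ` (fst c \<inter> S))"
    using homeomorphic_imp_open_map[OF chart_homeomorphic] by (auto simp: open_map_def)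
  then show ?thesis
    using chart_open by (simp add: openin_open_eq)
qed

lemma param_image_openin:
  assumes "open W" "W \<subseteq> coord_dom c"
  shows "openin X (param c ` W)"
proof -
  have "snd c ` (param c ` W) = W"
    using assms(2) by (force simp: chart_param image_image)
  moreover have sub: "param c ` W \<subseteq> fst c"
    using assms(2) param_in_chart by auto
  ultimately have "openin (subtopology X (fst c)) (param c ` W)"
    using homeomorphic_map_openness[OF chart_homeomorphic, of "param c ` W"] assms chart_subset chart_open
    by (simp add: openin_open_eq inf_absorb2)
  then show ?thesis
    using chart_openin openin_trans_full by blast
qed

end

text \<open>A chart domain of the source need not be mapped into a single chart domain of the
  target, so local computations are confined to the part that is.\<close>

definition rep_dom :: "('a, 'e) chart \<Rightarrow> ('b, 'f) chart \<Rightarrow> ('a \<Rightarrow> 'b) \<Rightarrow> 'e set" where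
  "rep_dom c d f = snd c ` (fst c \<inter> f -` fst d)"

lemma hermitian_form_scaleR: "Re (hermitian_form H (t *\<^sub>R v) (t *\<^sub>R v)) = t\<^sup>2 * Re (hermitian_form H v v)"
proof -
  have "hermitian_form H (t *\<^sub>R v) (t *\<^sub>R v) = of_real (t\<^sup>2) * hermitian_form H v v"
    by (simp add: hermitian_form_def sum_distrib_left scaleR_conv_of_real[where 'a = complex] power2_eq_square mult_ac)
  then show ?thesis by (simp add: Re_complex_of_real)
qed

section \<open>The quadratic form |df(v)|^2 in a pair of charts\<close>

context local_pluriharmonic
begin

definition energy :: "complex^'m \<Rightarrow> complex^'m \<Rightarrow> real" where
  "energy z v = Re (bil (gc G (F z)) (dF z v) (cnj_vec (dF z v)))"

text \<open>The (1,0)-vector of \<open>v\<close> is half of v - i J v, with J multiplication by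
  \<open>\<i>\<close> on coordinates; this explains the quarter. The real form is the one to which
  the real chain rule applies under a change of charts, and from which the vanishing of the real
  derivative can be read off.\<close>

lemma energy_real:
  assumes "z \<in> U"
  defines "L \<equiv> frechet_derivative F (at z)"
  shows "energy z v = (L v \<bullet> (G (F z) *v L v) + L (\<i> *s v) \<bullet> (G (F z) *v L (\<i> *s v))) / 4"
proof -
  have L: "linear L" unfolding L_def by (rule linear_frechet_derivative[OF differentiable_F[OF assms(1)]])
  have d: "(\<lambda>z. F z $ i) differentiable at z" for i
    by (rule differentiable_vec_nth[OF differentiable_F[OF assms(1)]])
  have 1: "dF z v $ i = of_real (L (wp v) $ i) - \<i> * of_real (L (wq v) $ i)" for i
    by (simp add: dF_def cd_def frechet_derivative_bounded_linear[OF bounded_linear_of_real d]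
        frechet_derivative_vec_nth[OF differentiable_F[OF assms(1)]] L_def[symmetric] linear_neg[OF L])
  have "(\<chi> i. Re (dF z v $ i)) = (1/2) *\<^sub>R L v" "(\<chi> i. Im (dF z v $ i)) = - (1/2) *\<^sub>R L (\<i> *s v)"
    by (simp_all add: 1 vec_eq_iff wp_def wq_def linear_scale[OF L])
  then show ?thesis
    unfolding energy_def Re_bil_cnj
    by (simp add: matrix_vector_mult_scaleR linear_neg[OF matrix_vector_mul_linear])
qed

lemma form_nonneg: "z \<in> U \<Longrightarrow> x \<bullet> (G (F z) *v x) \<ge> 0"
  using positive_G[OF F_in_V, of z x] by (cases "x = 0") (auto simp: less_imp_le)

lemma energy_scaleR:
  assumes "z \<in> U"
  shows "energy z (t *\<^sub>R v) = t\<^sup>2 * energy z v"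
proof -
  have L: "linear (frechet_derivative F (at z))" by (rule linear_frechet_derivative[OF differentiable_F[OF assms]])
  have "\<i> *s (t *\<^sub>R v) = t *\<^sub>R (\<i> *s v)"
    by (simp add: vec_eq_iff)
  then show ?thesis
    by (simp add: energy_real[OF assms] linear_scale[OF L] matrix_vector_mult_scaleR power2_eq_square algebra_simps)
qed

text \<open>Both summands of \<open>energy_real\<close> are nonnegative, so the one for
  \<open>v\<close> must vanish, and the metric is definite.\<close>

lemma energy_nonpos_imp:
  assumes "z \<in> U" "energy z v \<le> 0"
  shows "frechet_derivative F (at z) v = 0"
proof (rule ccontr)
  assume "frechet_derivative F (at z) v \<noteq> 0"
  then have "frechet_derivative F (at z) v \<bullet> (G (F z) *v frechet_derivative F (at z) v) > 0"
    by (rule positive_G[OF F_in_V[OF assms(1)]])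
  then show False
    using assms(2) form_nonneg[OF assms(1), of "frechet_derivative F (at z) (\<i> *s v)"]
    by (simp add: energy_real[OF assms(1)])
qed

text \<open>By \<open>dF_eq_sum\<close> the image of a (1,0)-vector is linear in its components with
  coefficients continuous in the base point, which gives joint continuity.\<close>

lemma continuous_on_energy: "continuous_on (U \<times> UNIV) (\<lambda>p. energy (fst p) (snd p))"
proof -
  have c: "continuous_on (U \<times> UNIV) (\<lambda>p. k (fst p))" if "continuous_on U k" for k :: "complex^'m \<Rightarrow> complex"
    by (rule continuous_on_compose2[OF that continuous_on_fst[OF continuous_on_id]]) auto
  have "continuous_on U (\<lambda>z. G (F z))"
    using Ck_on_compose[OF open_U open_V maps Ck_F[of 0] Ck_G] by simp
  then have 1: "continuous_on (U \<times> UNIV) (\<lambda>p. G (F (fst p)))"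
    by (rule continuous_on_compose2[OF _ continuous_on_fst[OF continuous_on_id]]) auto
  have 2: "continuous_on U (\<lambda>z. dF z w $ i)" for w i
    using Ck_on_vec_nth[OF open_U Ck_on_cdv[OF open_U Ck_FC[of "Suc 0"]], of "wp w" "- wq w" i]
    by (simp add: dF_def)
  have "continuous_on (U \<times> UNIV) (\<lambda>p. Re (bil (gc G (F (fst p))) (\<Sum>\<gamma>\<in>UNIV. snd p $ \<gamma> *s dF (fst p) (axis \<gamma> 1))
      (cnj_vec (\<Sum>\<gamma>\<in>UNIV. snd p $ \<gamma> *s dF (fst p) (axis \<gamma> 1)))))"
    unfolding bil_def by (auto intro!: continuous_intros 1 c[OF 2])
  then show ?thesis
    by (rule continuous_on_eq) (auto simp: energy_def dF_eq_sum[symmetric])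
qed

end

lemma continuous_on_hermitian_form:
  assumes "continuous_on U h"
  shows "continuous_on (U \<times> UNIV) (\<lambda>p. Re (hermitian_form (h (fst p)) (snd p) (snd p)))"
proof -
  have "continuous_on (U \<times> UNIV) (\<lambda>p. h (fst p))"
    by (rule continuous_on_compose2[OF assms continuous_on_fst[OF continuous_on_id]]) auto
  then show ?thesis
    unfolding hermitian_form_def by (auto intro!: continuous_intros)
qed

lemma rep_dom_image: "x \<in> fst c \<Longrightarrow> f x \<in> fst d \<Longrightarrow> snd c x \<in> rep_dom c d f"
  by (auto simp: rep_dom_def)

section \<open>Independence of charts and the maximum over the manifold\<close>

locale pluriharmonic_setting =
  fixes X :: "'a topology" and A :: "('a, complex^'m) chart set"
    and Y :: "'b topology" and B :: "('b, real^'n) chart set"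
    and g :: "('b, real^'n) chart \<Rightarrow> real^'n \<Rightarrow> real^'n^'n"
    and f :: "'a \<Rightarrow> 'b"
    and h :: "('a, complex^'m) chart \<Rightarrow> complex^'m \<Rightarrow> complex^'m^'m"
  assumes X: "complex_manifold X A" and Y: "smooth_manifold Y B"
    and g: "riemannian_metric B g" and h: "hermitian_metric A h"
    and f: "pluriharmonic X A Y B g f"
begin

lemma atlas_X: "topological_atlas X A" and atlas_Y: "topological_atlas Y B"
  using X Y by (simp_all add: complex_manifold_def smooth_manifold_def)

lemma cont_f: "continuous_map X Y f"
  using f by (simp add: pluriharmonic_def smooth_map_def)

lemma ex_charts:
  assumes "x \<in> topspace X"
  obtains c d where "c \<in> A" "d \<in> B" "x \<in> fst c" "f x \<in> fst d"
proof -
  have "f x \<in> topspace Y" using cont_f assms by (auto simp: continuous_map_def)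
  then show ?thesis
    using assms atlas_X atlas_Y that by (auto simp: topological_atlas_def)
qed

lemma rep_dom_open_gen:
  assumes c: "c \<in> A" and T: "openin Y T" and S: "openin X S"
  shows "open (snd c ` (fst c \<inter> S \<inter> f -` T))"
proof -
  have "openin X {x \<in> topspace X. f x \<in> T}"
    by (rule openin_continuous_map_preimage[OF cont_f T])
  then have "open (snd c ` (fst c \<inter> (S \<inter> {x \<in> topspace X. f x \<in> T})))"
    by (intro chart_image_open[OF atlas_X c] openin_Int S)
  also have "fst c \<inter> (S \<inter> {x \<in> topspace X. f x \<in> T}) = fst c \<inter> S \<inter> f -` T"
    using chart_subset[OF atlas_X c] by auto
  finally show ?thesis .
qed

lemma rep_dom_open: "c \<in> A \<Longrightarrow> d \<in> B \<Longrightarrow> open (rep_dom c d f)"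
  using rep_dom_open_gen[of c "fst d" "topspace X"] chart_openin[OF atlas_Y, of d] chart_subset[OF atlas_X, of c]
  by (simp add: rep_dom_def inf_absorb1)

lemma rep_dom_subset: "rep_dom c d f \<subseteq> coord_dom c"
  by (auto simp: rep_dom_def coord_dom_def)

lemma rep_dom_param:
  assumes "c \<in> A" "z \<in> rep_dom c d f"
  shows "param c z \<in> fst c" "f (param c z) \<in> fst d" "snd c (param c z) = z"
  using assms param_chart[OF atlas_X assms(1)] by (auto simp: rep_dom_def)

lemma local_rep_eq: "c \<in> A \<Longrightarrow> x \<in> fst c \<Longrightarrow> local_rep c d f (snd c x) = snd d (f x)"
  by (simp add: local_rep_def param_chart[OF atlas_X])

lemma local_rep_pluriharmonic:
  assumes c: "c \<in> A" and d: "d \<in> B"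
  shows "local_pluriharmonic (rep_dom c d f) (local_rep c d f) (coord_dom d) (g d)"
proof
  show "open (rep_dom c d f)" by (rule rep_dom_open[OF c d])
  show "open (coord_dom d)" by (rule chart_open[OF atlas_Y d])
  show "local_rep c d f ` rep_dom c d f \<subseteq> coord_dom d"
    using local_rep_eq[OF c, of _ d] by (auto simp: rep_dom_def coord_dom_def)
  show "smooth_on (local_rep c d f) (rep_dom c d f)"
    using f c d by (auto simp: pluriharmonic_def smooth_map_def rep_dom_def)
  show "smooth_on (g d) (coord_dom d)" "\<And>y. y \<in> coord_dom d \<Longrightarrow> transpose (g d y) = g d y"
    "\<And>y v. y \<in> coord_dom d \<Longrightarrow> v \<noteq> 0 \<Longrightarrow> 0 < v \<bullet> (g d y *v v)"
    using g d by (auto simp: riemannian_metric_def)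
qed (use f c d in \<open>auto simp: pluriharmonic_def rep_dom_def Let_def\<close>)

abbreviation energy where
  "energy c d \<equiv> local_pluriharmonic.energy (local_rep c d f) (g d)"

text \<open>The two local representatives of \<open>f\<close> differ by transition maps on both
  sides. The chain rule together with the transformation law of the target metric gives the first
  claim; the second is the transformation law of \<open>h\<close>.\<close>

lemma energy_chart_change:
  assumes c: "c \<in> A" "c' \<in> A" and d: "d \<in> B" "d' \<in> B"
    and x: "x \<in> fst c" "x \<in> fst c'" "f x \<in> fst d" "f x \<in> fst d'"
  defines "\<tau> \<equiv> frechet_derivative (transition c c') (at (snd c x))"
  shows "energy c' d' (snd c' x) (\<tau> v) = energy c d (snd c x) v"
    and "hermitian_form (h c' (snd c' x)) (\<tau> v) (\<tau> w) = hermitian_form (h c (snd c x)) v w"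
proof -
  have tx: "transition c c' (snd c x) = snd c' x"
    using x by (simp add: transition_def param_chart[OF atlas_X c(1)])
  show "hermitian_form (h c' (snd c' x)) (\<tau> v) (\<tau> w) = hermitian_form (h c (snd c x)) v w"
  proof -
    have *: "snd c x \<in> snd c ` (fst c \<inter> fst c')" using x by auto
    have "\<forall>c\<in>A. \<forall>d\<in>A. \<forall>x\<in>snd c ` (fst c \<inter> fst d). \<forall>v w.
        hermitian_form (h c x) v w = hermitian_form (h d (transition c d x))
            (frechet_derivative (transition c d) (at x) v) (frechet_derivative (transition c d) (at x) w)"
      using h by (simp add: hermitian_metric_def)
    from this[rule_format, OF c *] show ?thesis by (simp add: \<tau>_def tx)
  qed
  interpret L: local_pluriharmonic "rep_dom c d f" "local_rep c d f" "coord_dom d" "g d"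
    by (rule local_rep_pluriharmonic[OF c(1) d(1)])
  interpret L': local_pluriharmonic "rep_dom c' d' f" "local_rep c' d' f" "coord_dom d'" "g d'"
    by (rule local_rep_pluriharmonic[OF c(2) d(2)])
  let ?F = "local_rep c d f" and ?F' = "local_rep c' d' f" and ?\<sigma> = "transition d d'"
  have z: "snd c x \<in> rep_dom c d f" "snd c' x \<in> rep_dom c' d' f"
    using x by (auto intro: rep_dom_image)
  \<comment> \<open>Holomorphy makes the derivative of the transition map complex linear. It
    therefore commutes with multiplication by \<open>\<i>\<close>, as the second term of
    \<open>energy_real\<close> requires.\<close>
  obtain J where J: "(transition c c' has_derivative (*v) J) (at (snd c x))"
    using X c x by (fastforce simp: complex_manifold_def holomorphic_map_on_def)
  have \<tau>: "\<tau> = (*v) J"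
    unfolding \<tau>_def by (rule frechet_derivative_eqI[OF J])
  have Fx: "?F (snd c x) = snd d (f x)" "?F' (snd c' x) = snd d' (f x)"
    by (rule local_rep_eq[OF c(1) x(1)], rule local_rep_eq[OF c(2) x(2)])
  have "smooth_on ?\<sigma> (snd d ` (fst d \<inter> fst d'))"
    using Y d by (auto simp: smooth_manifold_def)
  then have \<sigma>: "?\<sigma> differentiable at (snd d (f x))"
    using Ck_on_differentiable[of 1 ?\<sigma> "snd d ` (fst d \<inter> fst d')"] x by (auto simp: smooth_on_def)
  \<comment> \<open>On this open set all four charts are available, so the two composites below
    agree near the point and not merely at it; only then do their derivatives agree.\<close>
  define W where "W = snd c ` (fst c \<inter> fst c' \<inter> f -` (fst d \<inter> fst d'))"
  have W: "open W" "snd c x \<in> W"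
    unfolding W_def using x
    by (auto intro!: rep_dom_open_gen[OF c(1) openin_Int[OF chart_openin[OF atlas_Y d(1)] chart_openin[OF atlas_Y d(2)]]
          chart_openin[OF atlas_X c(2)]] simp del: vimage_Int)
  have eq: "(?F' \<circ> transition c c') y = (?\<sigma> \<circ> ?F) y" if "y \<in> W" for y
    using that c d
    by (auto simp: W_def local_rep_def transition_def param_chart[OF atlas_X] param_chart[OF atlas_Y])
  have "frechet_derivative (?F' \<circ> transition c c') (at (snd c x)) = frechet_derivative (?\<sigma> \<circ> ?F) (at (snd c x))"
    by (rule frechet_derivative_cong_open[OF W eq])
  moreover have "frechet_derivative (?F' \<circ> transition c c') (at (snd c x)) =
      frechet_derivative ?F' (at (snd c' x)) \<circ> \<tau>"
    unfolding \<tau>_def tx[symmetric]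
    by (rule frechet_derivative_compose) (use J L'.differentiable_F[OF z(2)] in \<open>auto simp: differentiable_def tx\<close>)
  moreover have "frechet_derivative (?\<sigma> \<circ> ?F) (at (snd c x)) =
      frechet_derivative ?\<sigma> (at (snd d (f x))) \<circ> frechet_derivative ?F (at (snd c x))"
    unfolding Fx(1)[symmetric]
    by (rule frechet_derivative_compose) (use \<sigma> L.differentiable_F[OF z(1)] Fx in auto)
  ultimately have chain: "frechet_derivative ?F' (at (snd c' x)) (\<tau> u) =
      frechet_derivative ?\<sigma> (at (snd d (f x))) (frechet_derivative ?F (at (snd c x)) u)" for u
    by (metis comp_apply)
  have sx: "?\<sigma> (snd d (f x)) = snd d' (f x)"
    using x by (simp add: transition_def param_chart[OF atlas_Y d(1)])
  have metric: "v \<bullet> (g d (snd d (f x)) *v w) = frechet_derivative ?\<sigma> (at (snd d (f x))) v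
      \<bullet> (g d' (snd d' (f x)) *v frechet_derivative ?\<sigma> (at (snd d (f x))) w)" for v w
  proof -
    have *: "snd d (f x) \<in> snd d ` (fst d \<inter> fst d')" using x by auto
    have "\<forall>c\<in>B. \<forall>d\<in>B. \<forall>x\<in>snd c ` (fst c \<inter> fst d). \<forall>v w. v \<bullet> (g c x *v w) =
        frechet_derivative (transition c d) (at x) v
          \<bullet> (g d (transition c d x) *v frechet_derivative (transition c d) (at x) w)"
      using g by (simp add: riemannian_metric_def)
    from this[rule_format, OF d *] show ?thesis by (simp add: sx)
  qed
  have i: "\<i> *s \<tau> v = \<tau> (\<i> *s v)"
    by (simp add: \<tau> vec_eq_iff matrix_vector_mult_def sum_distrib_left mult_ac)
  show "energy c' d' (snd c' x) (\<tau> v) = energy c d (snd c x) v"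
    by (simp add: L.energy_real[OF z(1)] L'.energy_real[OF z(2)] i chain Fx metric)
qed

lemma h_pos: "c \<in> A \<Longrightarrow> z \<in> coord_dom c \<Longrightarrow> v \<noteq> 0 \<Longrightarrow> Re (hermitian_form (h c z) v v) > 0"
  using h by (auto simp: hermitian_metric_def)

text \<open>The closed ball supplies compactness for the maximum, the open ball inside it an open
  set for the cover.\<close>

lemma ex_chart_ball:
  assumes "x \<in> topspace X"
  obtains c d r where "c \<in> A" "d \<in> B" "x \<in> fst c" "r > 0" "cball (snd c x) r \<subseteq> rep_dom c d f"
    "openin X (param c ` ball (snd c x) r)" "x \<in> param c ` ball (snd c x) r"
proof -
  obtain c d where c: "c \<in> A" "d \<in> B" "x \<in> fst c" "f x \<in> fst d"
    by (rule ex_charts[OF assms])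
  obtain r where r: "r > 0" "cball (snd c x) r \<subseteq> rep_dom c d f"
    using rep_dom_open[OF c(1,2)] rep_dom_image[where f = f, OF c(3,4)] by (meson open_contains_cball)
  have "ball (snd c x) r \<subseteq> coord_dom c"
    by (rule subset_trans[OF ball_subset_cball subset_trans[OF r(2) rep_dom_subset]])
  then have "openin X (param c ` ball (snd c x) r)"
    by (intro param_image_openin[OF atlas_X c(1)]) auto
  moreover have "x \<in> param c ` ball (snd c x) r"
    using r(1) param_chart[OF atlas_X c(1,3)] by (metis centre_in_ball image_eqI)
  ultimately show ?thesis using that c r by blast
qed

text \<open>The ratio of the two quadratic forms is continuous on \<open>K\<close> times the unit
  sphere and attains its maximum \<open>m\<close> there. Both forms scale by the square of the
  factor, so the bound extends from unit vectors to all \<open>v\<close>.\<close>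

lemma energy_max_on_compact:
  assumes c: "c \<in> A" and d: "d \<in> B" and K: "compact K" "K \<noteq> {}" "K \<subseteq> rep_dom c d f"
  shows "\<exists>m z0 v0. z0 \<in> K \<and> v0 \<noteq> 0 \<and> energy c d z0 v0 = m * Re (hermitian_form (h c z0) v0 v0) \<and>
    (\<forall>z\<in>K. \<forall>v. energy c d z v \<le> m * Re (hermitian_form (h c z) v v))"
proof -
  interpret L: local_pluriharmonic "rep_dom c d f" "local_rep c d f" "coord_dom d" "g d"
    by (rule local_rep_pluriharmonic[OF c d])
  let ?N = "\<lambda>z v. Re (hermitian_form (h c z) v v)"
  let ?S = "sphere 0 1 :: (complex^'m) set"
  have Kc: "K \<subseteq> coord_dom c" by (rule subset_trans[OF K(3) rep_dom_subset])
  have pos: "?N z v > 0" if "z \<in> K" "v \<noteq> 0" for z v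
    by (rule h_pos[OF c]) (use that Kc in auto)
  have "Ck_on 0 (h c) (coord_dom c)"
    using h c unfolding hermitian_metric_def smooth_on_def by blast
  then have "continuous_on (coord_dom c) (h c)" by simp
  then have 1: "continuous_on (K \<times> ?S) (\<lambda>p. ?N (fst p) (snd p))"
    by (rule continuous_on_subset[OF continuous_on_hermitian_form]) (use Kc in auto)
  have 2: "continuous_on (K \<times> ?S) (\<lambda>p. energy c d (fst p) (snd p))"
    by (rule continuous_on_subset[OF L.continuous_on_energy]) (use K in auto)
  have "continuous_on (K \<times> ?S) (\<lambda>p. energy c d (fst p) (snd p) / ?N (fst p) (snd p))"
  proof (intro continuous_on_divide 1 2 ballI)
    fix p assume "p \<in> K \<times> ?S"
    then have "fst p \<in> K" "snd p \<noteq> 0" by auto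
    from pos[OF this] show "?N (fst p) (snd p) \<noteq> 0" by simp
  qed
  moreover have "compact (K \<times> ?S)" by (intro compact_Times K) simp
  moreover have "K \<times> ?S \<noteq> {}"
  proof -
    \<comment> \<open>\<open>undefined\<close> is just some index: any coordinate vector shows that
      the sphere is nonempty.\<close>
    have "axis undefined 1 \<in> ?S" by simp
    then show ?thesis using K(2) by blast
  qed
  ultimately obtain p where p: "p \<in> K \<times> ?S"
    "\<forall>y\<in>K \<times> ?S. energy c d (fst y) (snd y) / ?N (fst y) (snd y) \<le> energy c d (fst p) (snd p) / ?N (fst p) (snd p)"
    using continuous_attains_sup[of "K \<times> ?S" "\<lambda>p. energy c d (fst p) (snd p) / ?N (fst p) (snd p)"] by blast
  define m where "m = energy c d (fst p) (snd p) / ?N (fst p) (snd p)"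
  have p': "fst p \<in> K" "snd p \<noteq> 0" using p(1) by auto
  have "energy c d z v \<le> m * ?N z v" if z: "z \<in> K" for z v
  proof (cases "v = 0")
    case True
    then show ?thesis
      using L.energy_scaleR[of z 0 0] z K by (simp add: hermitian_form_def subset_iff)
  next
    case False
    define w where "w = (1 / norm v) *\<^sub>R v"
    have w: "w \<in> ?S" "v = norm v *\<^sub>R w" using False by (auto simp: w_def)
    then have "w \<noteq> 0" by auto
    have "energy c d z w \<le> m * ?N z w"
      using p(2)[rule_format, of "(z, w)"] z w(1) pos[OF z \<open>w \<noteq> 0\<close>]
      by (simp add: m_def[symmetric] pos_divide_le_eq)
    then have "(norm v)\<^sup>2 * energy c d z w \<le> (norm v)\<^sup>2 * (m * ?N z w)"
      by (rule mult_left_mono) simp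
    moreover have "energy c d z v = (norm v)\<^sup>2 * energy c d z w"
      by (subst w(2), rule L.energy_scaleR) (use z K in auto)
    moreover have "?N z v = (norm v)\<^sup>2 * ?N z w"
      by (subst (1 2) w(2)) (rule hermitian_form_scaleR)
    ultimately show ?thesis by (simp add: mult_ac)
  qed
  moreover have "energy c d (fst p) (snd p) = m * ?N (fst p) (snd p)"
    using pos[OF p'] by (simp add: m_def)
  ultimately show ?thesis using p' by blast
qed

text \<open>The local representatives are constant on balls, and injectivity of the target charts
  makes \<open>f\<close> locally constant. A level set and its complement are then both open, and
  connectedness finishes.\<close>

lemma frechet_derivative_zero_imp_constant:
  assumes "\<And>c d z. c \<in> A \<Longrightarrow> d \<in> B \<Longrightarrow> z \<in> rep_dom c d f \<Longrightarrow> frechet_derivative (local_rep c d f) (at z) = (\<lambda>v. 0)"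
  shows "f constant_on topspace X"
proof -
  have loc: "\<exists>Q. openin X Q \<and> x \<in> Q \<and> (\<forall>y\<in>Q. f y = f x)" if x: "x \<in> topspace X" for x
  proof -
    obtain c d r where c: "c \<in> A" "d \<in> B" "x \<in> fst c" "r > 0" "cball (snd c x) r \<subseteq> rep_dom c d f"
      "openin X (param c ` ball (snd c x) r)" "x \<in> param c ` ball (snd c x) r"
      by (rule ex_chart_ball[OF x])
    interpret L: local_pluriharmonic "rep_dom c d f" "local_rep c d f" "coord_dom d" "g d"
      by (rule local_rep_pluriharmonic[OF c(1,2)])
    have b: "z \<in> rep_dom c d f" if "z \<in> ball (snd c x) r" for z
      using c(5) that by auto
    have "(local_rep c d f has_derivative (\<lambda>h. 0)) (at z)" if "z \<in> ball (snd c x) r" for z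
      using has_frechet_derivative[OF L.differentiable_F[OF b[OF that]]] assms[OF c(1,2) b[OF that]] by simp
    then have const: "local_rep c d f z = local_rep c d f (snd c x)" if "z \<in> ball (snd c x) r" for z
      by (rule has_derivative_zero_unique_connected[OF open_ball connected_ball _ that]) (use c(4) in auto)
    have "f y = f x" if "y \<in> param c ` ball (snd c x) r" for y
    proof -
      obtain z where z: "z \<in> ball (snd c x) r" "y = param c z" using \<open>y \<in> _\<close> by auto
      have y: "y \<in> fst c" "f y \<in> fst d" "snd c y = z"
        using rep_dom_param[OF c(1) b[OF z(1)]] z(2) by auto
      have x': "f x \<in> fst d"
        using rep_dom_param(2)[OF c(1) b[of "snd c x"]] c(4) param_chart[OF atlas_X c(1,3)] by simp
      have "snd d (f y) = snd d (f x)"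
        using const[OF z(1)] local_rep_eq[OF c(1) y(1), of d] local_rep_eq[OF c(1,3), of d] y(3) by simp
      then show ?thesis
        using chart_inj[OF atlas_Y c(2)] x' y(2) by (auto dest: inj_onD)
    qed
    then show ?thesis using c(6,7) by blast
  qed
  show ?thesis
  proof (cases "topspace X = {}")
    case True
    then show ?thesis by (simp add: constant_on_def)
  next
    case False
    then obtain x0 where x0: "x0 \<in> topspace X" by blast
    let ?S = "{x \<in> topspace X. f x = f x0}"
    have "openin X ?S"
    proof (subst openin_subopen, safe)
      fix x assume x: "x \<in> topspace X" "f x = f x0"
      obtain Q where Q: "openin X Q" "x \<in> Q" "\<forall>y\<in>Q. f y = f x"
        using loc[OF x(1)] by blast
      then show "\<exists>T. openin X T \<and> x \<in> T \<and> T \<subseteq> ?S"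
        using x(2) openin_subset[OF Q(1)] by (intro exI[of _ Q]) auto
    qed
    moreover have "openin X (topspace X - ?S)"
    proof (subst openin_subopen, intro ballI)
      fix x assume "x \<in> topspace X - ?S"
      then have x: "x \<in> topspace X" "f x \<noteq> f x0" by auto
      obtain Q where Q: "openin X Q" "x \<in> Q" "\<forall>y\<in>Q. f y = f x"
        using loc[OF x(1)] by blast
      have "f y \<noteq> f x0" if "y \<in> Q" for y
        using bspec[OF Q(3) that] x(2) by metis
      then have "Q \<subseteq> topspace X - ?S"
        using openin_subset[OF Q(1)] by blast
      then show "\<exists>T. openin X T \<and> x \<in> T \<and> T \<subseteq> topspace X - ?S"
        using Q(1,2) by blast
    qed
    then have "closedin X ?S" by (simp add: closedin_def)
    moreover have "connected_space X" using X by (simp add: complex_manifold_def)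
    ultimately have "?S = {} \<or> ?S = topspace X"
      unfolding connected_space_clopen_in by blast
    then have "?S = topspace X" using x0 by blast
    then show ?thesis by (auto simp: constant_on_def)
  qed
qed

text \<open>Finitely many sets with a compact coordinate description cover the manifold, each with
  its own maximal ratio. Chart independence makes the largest of these ratios a bound in every pair
  of charts, and it is attained in the set to which it belongs.\<close>

lemma ex_global_maximum:
  assumes "compact_space X" "topspace X \<noteq> {}"
  obtains m c d z0 v0 where "c \<in> A" "d \<in> B" "z0 \<in> rep_dom c d f" "v0 \<noteq> 0"
    "energy c d z0 v0 = m * Re (hermitian_form (h c z0) v0 v0)"
    "\<And>c d z v. c \<in> A \<Longrightarrow> d \<in> B \<Longrightarrow> z \<in> rep_dom c d f \<Longrightarrow> energy c d z v \<le> m * Re (hermitian_form (h c z) v v)"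
proof -
  define good where "good Q c d K \<longleftrightarrow> c \<in> A \<and> d \<in> B \<and> compact K \<and> K \<noteq> {} \<and> K \<subseteq> rep_dom c d f \<and>
      Q \<subseteq> param c ` K" for Q c d K
  define \<U> where "\<U> = {Q. openin X Q \<and> (\<exists>c d K. good Q c d K)}"
  have "topspace X \<subseteq> \<Union>\<U>"
  proof
    fix x assume x: "x \<in> topspace X"
    obtain c d r where c: "c \<in> A" "d \<in> B" "x \<in> fst c" "r > 0" "cball (snd c x) r \<subseteq> rep_dom c d f"
      "openin X (param c ` ball (snd c x) r)" "x \<in> param c ` ball (snd c x) r"
      by (rule ex_chart_ball[OF x])
    then have "good (param c ` ball (snd c x) r) c d (cball (snd c x) r)"
      by (auto simp: good_def intro!: image_mono ball_subset_cball)
    then have "param c ` ball (snd c x) r \<in> \<U>" using c(6) unfolding \<U>_def by blast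
    then show "x \<in> \<Union>\<U>" using c(7) by blast
  qed
  moreover have "\<forall>Q\<in>\<U>. openin X Q" by (simp add: \<U>_def)
  ultimately obtain \<F> where \<F>: "finite \<F>" "\<F> \<subseteq> \<U>" "topspace X \<subseteq> \<Union>\<F>"
    using assms(1) unfolding compact_space_alt by meson
  then have "\<F> \<noteq> {}" using assms(2) by auto
  have "\<exists>m c d K z0 v0. good Q c d K \<and> z0 \<in> K \<and> v0 \<noteq> 0 \<and>
      energy c d z0 v0 = m * Re (hermitian_form (h c z0) v0 v0) \<and>
      (\<forall>z\<in>K. \<forall>v. energy c d z v \<le> m * Re (hermitian_form (h c z) v v))" if Q: "Q \<in> \<F>" for Q
  proof -
    obtain c d K where G: "good Q c d K" using \<F>(2) Q unfolding \<U>_def by blast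
    show ?thesis
      using energy_max_on_compact[of c d K] G unfolding good_def by blast
  qed
  then obtain m c d K z0 v0 where *: "\<And>Q. Q \<in> \<F> \<Longrightarrow> good Q (c Q) (d Q) (K Q) \<and> z0 Q \<in> K Q \<and> v0 Q \<noteq> 0 \<and>
      energy (c Q) (d Q) (z0 Q) (v0 Q) = m Q * Re (hermitian_form (h (c Q) (z0 Q)) (v0 Q) (v0 Q)) \<and>
      (\<forall>z\<in>K Q. \<forall>v. energy (c Q) (d Q) z v \<le> m Q * Re (hermitian_form (h (c Q) z) v v))"
    by metis
  have "Max (m ` \<F>) \<in> m ` \<F>" using \<F>(1) \<open>\<F> \<noteq> {}\<close> by (intro Max_in) auto
  then obtain Q where Q: "Q \<in> \<F>" "m Q = Max (m ` \<F>)" by auto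
  have le: "energy c' d' z v \<le> m Q * Re (hermitian_form (h c' z) v v)"
    if c': "c' \<in> A" "d' \<in> B" and z: "z \<in> rep_dom c' d' f" for c' d' z v
  proof -
    define x where "x = param c' z"
    have x: "x \<in> fst c'" "f x \<in> fst d'" "snd c' x = z"
      using rep_dom_param[OF c'(1) z] by (auto simp: x_def)
    then have "x \<in> topspace X" using chart_subset[OF atlas_X c'(1)] by auto
    then obtain P where P: "P \<in> \<F>" "x \<in> P" using \<F>(3) by auto
    have good: "c P \<in> A" "d P \<in> B" "K P \<subseteq> rep_dom (c P) (d P) f" "P \<subseteq> param (c P) ` K P"
      using *[OF P(1)] by (auto simp: good_def)
    obtain y where y: "y \<in> K P" "x = param (c P) y" using good(4) P(2) by auto
    have xP: "x \<in> fst (c P)" "f x \<in> fst (d P)" "snd (c P) x = y"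
      using rep_dom_param[OF good(1) subsetD[OF good(3) y(1)]] y(2) by auto
    let ?w = "frechet_derivative (transition c' (c P)) (at (snd c' x)) v"
    \<comment> \<open>Needed to replace the ratio \<open>m P\<close> of the covering set by the
      larger \<open>m Q\<close> at the end of the chain.\<close>
    have N: "Re (hermitian_form (h c' z) v v) \<ge> 0"
      using h_pos[OF c'(1), of z v] subsetD[OF rep_dom_subset z]
      by (cases "v = 0") (auto simp: hermitian_form_def intro: less_imp_le)
    have "energy c' d' z v = energy (c P) (d P) y ?w"
      using energy_chart_change(1)[OF c'(1) good(1) c'(2) good(2) x(1) xP(1) x(2) xP(2), of v] x(3) xP(3) by simp
    also have "\<dots> \<le> m P * Re (hermitian_form (h (c P) y) ?w ?w)"
      using *[OF P(1)] y(1) by blast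
    also have "\<dots> = m P * Re (hermitian_form (h c' z) v v)"
      using energy_chart_change(2)[OF c'(1) good(1) c'(2) good(2) x(1) xP(1) x(2) xP(2), of v v] x(3) xP(3) by simp
    also have "\<dots> \<le> m Q * Re (hermitian_form (h c' z) v v)"
      using Q(2) P(1) \<F>(1) N by (intro mult_right_mono) auto
    finally show ?thesis .
  qed
  show ?thesis
    using *[OF Q(1)] by (intro that[of "c Q" "d Q" "z0 Q" "v0 Q" "m Q"] le) (auto simp: good_def)
qed

end

theorem theorem1p6:
  fixes X :: "'a topology" and A :: "('a, complex^'m) chart set"
    and Y :: "'b topology" and B :: "('b, real^'n) chart set"
    and g :: "('b, real^'n) chart \<Rightarrow> real^'n \<Rightarrow> real^'n^'n"
    and f :: "'a \<Rightarrow> 'b"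
  assumes "complex_manifold X A" and "compact_space X"
    and "smooth_manifold Y B" and "riemannian_metric B g"
    and "nonpositive_complex_sectional_curvature B g"
    and "pluriharmonic X A Y B g f"
    and "\<exists>h. hermitian_metric A h \<and> uniformly_RC_positive A h"
  shows "f constant_on topspace X"
proof -
  obtain h where hm: "hermitian_metric A h" "uniformly_RC_positive A h"
    using assms(7) by blast
  interpret pluriharmonic_setting X A Y B g f h
    using assms hm by unfold_locales
  show ?thesis
  \<comment> \<open>A maximum can be attained only if there is a point; on the empty space constancy
    is trivial.\<close>
  proof (cases "topspace X = {}")
    case True
    then show ?thesis by (simp add: constant_on_def)
  next
    case False
    obtain m c d q v0 where c: "c \<in> A" "d \<in> B" and q: "q \<in> rep_dom c d f" and v0: "v0 \<noteq> 0"
      and eq: "energy c d q v0 = m * Re (hermitian_form (h c q) v0 v0)"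
      and le: "\<And>c d z v. c \<in> A \<Longrightarrow> d \<in> B \<Longrightarrow> z \<in> rep_dom c d f \<Longrightarrow> energy c d z v \<le> m * Re (hermitian_form (h c z) v v)"
      by (rule ex_global_maximum[OF assms(2) False]) blast
    have qc: "q \<in> coord_dom c" by (rule subsetD[OF rep_dom_subset q])
    have m: "m \<le> 0"
    proof (rule ccontr)
      assume "\<not> m \<le> 0"
      interpret L: local_pluriharmonic "rep_dom c d f" "local_rep c d f" "coord_dom d" "g d"
        by (rule local_rep_pluriharmonic[OF c])
      obtain u where u: "\<And>v. v \<noteq> 0 \<Longrightarrow> Re (chern_curvature (h c) q u (cnj_vec u) v (cnj_vec v)) > 0"
        using hm(2) c(1) qc unfolding uniformly_RC_positive_def by blast
      have "smooth_on (h c) (rep_dom c d f)"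
        using hm(1) c(1) Ck_on_subset[of _ "h c" "coord_dom c" "rep_dom c d f", OF _ rep_dom_subset] by (auto simp: hermitian_metric_def smooth_on_def)
      moreover have "Re (complex_riemann (g d) (local_rep c d f q) Z (cnj_vec W) W (cnj_vec Z)) \<le> 0" for Z W
        using assms(5) c(2) L.F_in_V[OF q] unfolding nonpositive_complex_sectional_curvature_def by blast
      ultimately show False
        using L.no_positive_maximum[of q "h c" u v0 m] q h_pos[OF c(1) qc] u v0 \<open>\<not> m \<le> 0\<close> eq le[OF c]
        by (simp add: L.energy_def)
    qed
    show ?thesis
    proof (rule frechet_derivative_zero_imp_constant, rule ext)
      fix c d z v assume c: "c \<in> A" "d \<in> B" and z: "z \<in> rep_dom c d f"
      interpret L: local_pluriharmonic "rep_dom c d f" "local_rep c d f" "coord_dom d" "g d"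
        by (rule local_rep_pluriharmonic[OF c])
      have "Re (hermitian_form (h c z) v v) \<ge> 0"
        using h_pos[OF c(1), of z v] subsetD[OF rep_dom_subset z]
        by (cases "v = 0") (auto simp: hermitian_form_def intro: less_imp_le)
      \<comment> \<open>The global bound by \<open>m\<close> times the norm of \<open>v\<close>
        holds in every pair of charts, so with \<open>m \<le> 0\<close> it forces the real
        derivative of every local representative to vanish.\<close>
      then have "energy c d z v \<le> 0"
        using le[OF c z, of v] m by (meson mult_nonpos_nonneg order_trans)
      then show "frechet_derivative (local_rep c d f) (at z) v = 0"
        by (rule L.energy_nonpos_imp[OF z])
    qed
  qed
qed

end
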